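(* If $G$ and $H$ are diagram groups, then the group $\mathcal{O}(G,H)$ is also a diagram group.
   Context: The group $\mathcal{O}(G,H)$. For groups $G$ and $H$ take copies $G_i$ of $G$ and $H_i$ of $H$ for all $i\in\mathbf{Z}$; for $g\in G$, $h\in H$ let $g_i\in G_i$, $h_i\in H_i$ be the corresponding elements. Let $G^\infty$ and $H^\infty$ be the (restricted) direct products of all $G_i$, respectively all $H_i$, $i\in\mathbf{Z}$. Put $$\mathcal{O}(G,H)=\left(G^\infty * H^\infty * \langle t\rangle\right)/\mathcal{N},$$ where $\langle t\rangle$ is infinite cyclic, $*$ is the free product, and $\mathcal{N}$ is the normal closure of the relations $g_i^t=g_{i+1}$, $h_i^t=h_{i+1}$ for all $i\in\mathbf{Z}$, $g\in G$, $h\in H$, and $[g_i,h_j]=1$ for all $g\in G$, $h\in H$ and all $i,j\in\mathbf{Z}$ with $i\le j$. Here $a^b=b^{-1}ab$ and $[a,b]=a^{-1}b^{-1}ab$. Diagram groups. A semigroup presentation $\mathcal{P}=\langle\Sigma\mid\mathcal{R}\rangle$ consists of an alphabet $\Sigma$ and a set $\mathcal{R}$ of pairs $(u,v)$ of non-empty words over $\Sigma$, written $u=v$; presentations are assumed anti-symmetric: if $(u=v)\in\mathcal{R}$ then $(v=u)\notin\mathcal{R}$. $\Sigma^+$ and $\Sigma^*$ are the free semigroup and free monoid on $\Sigma$. The graph $\Gamma(\mathcal{P})$ has vertex set $\Sigma^+$ and an edge $(p,u\to v,q)$ from $puq$ to $pvq$ for all $p,q\in\Sigma^*$ and all $u,v$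 with $(u=v)\in\mathcal{R}$ or $(v=u)\in\mathcal{R}$; the inverse edge is $(p,v\to u,q)$. The Squier complex $\mathcal{K}(\mathcal{P})$ is the 2-complex obtained from $\Gamma(\mathcal{P})$ by attaching, for all $p,z,q\in\Sigma^*$ and $(\ell_1=r_1),(\ell_2=r_2)\in\mathcal{R}$, a 2-cell along the closed path $p_1p_2^{-1}$, where $p_1=(p,\ell_1\to r_1,z\ell_2q)(pr_1z,\ell_2\to r_2,q)$ and $p_2=(p\ell_1z,\ell_2\to r_2,q)(p,\ell_1\to r_1,zr_2q)$. For $w\in\Sigma^+$ the diagram group $\mathcal{D}(\mathcal{P},w)$ is (up to isomorphism, by Kilibarda's theorem; this may be taken as the definition) the fundamental group $\pi_1(\mathcal{K}(\mathcal{P}),w)$. A group is a diagram group if it is isomorphic to some $\mathcal{D}(\mathcal{P},w)$. *)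

theory Defs
  imports "HOL-Algebra.Algebra"
begin

section \<open>Free products and normal closures\<close>

text \<open>Elements of the free product are words in letters from the disjoint union of the two
  carriers, modulo deleting identity letters and multiplying adjacent letters of the same factor.\<close>

inductive fp_step :: "('a, 'm) monoid_scheme \<Rightarrow> ('b, 'n) monoid_scheme
    \<Rightarrow> ('a + 'b) list \<Rightarrow> ('a + 'b) list \<Rightarrow> bool"
  for G :: "('a, 'm) monoid_scheme" and H :: "('b, 'n) monoid_scheme" where
  one_left: "fp_step G H (p @ [Inl \<one>\<^bsub>G\<^esub>] @ q) (p @ q)"
| one_right: "fp_step G H (p @ [Inr \<one>\<^bsub>H\<^esub>] @ q) (p @ q)"
| mult_left: "a \<in> carrier G \<Longrightarrow> b \<in> carrier G \<Longrightarrow>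
    fp_step G H (p @ [Inl a, Inl b] @ q) (p @ [Inl (a \<otimes>\<^bsub>G\<^esub> b)] @ q)"
| mult_right: "a \<in> carrier H \<Longrightarrow> b \<in> carrier H \<Longrightarrow>
    fp_step G H (p @ [Inr a, Inr b] @ q) (p @ [Inr (a \<otimes>\<^bsub>H\<^esub> b)] @ q)"

definition fp_rel :: "('a, 'm) monoid_scheme \<Rightarrow> ('b, 'n) monoid_scheme \<Rightarrow> ('a + 'b) list rel"
  where "fp_rel G H = {(v, w). equivclp (fp_step G H) v w}"

definition free_product :: "('a, 'm) monoid_scheme \<Rightarrow> ('b, 'n) monoid_scheme
    \<Rightarrow> ('a + 'b) list set monoid" where
  "free_product G H =
    \<lparr>carrier = lists (Inl ` carrier G \<union> Inr ` carrier H) // fp_rel G H,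
     monoid.mult = (\<lambda>A B. \<Union>v\<in>A. \<Union>w\<in>B. fp_rel G H `` {v @ w}),
     one = fp_rel G H `` {[]}\<rparr>"

definition fp_inl :: "('a, 'm) monoid_scheme \<Rightarrow> ('b, 'n) monoid_scheme \<Rightarrow> 'a \<Rightarrow> ('a + 'b) list set"
  where "fp_inl G H a = fp_rel G H `` {[Inl a]}"

definition fp_inr :: "('a, 'm) monoid_scheme \<Rightarrow> ('b, 'n) monoid_scheme \<Rightarrow> 'b \<Rightarrow> ('a + 'b) list set"
  where "fp_inr G H b = fp_rel G H `` {[Inr b]}"

definition normal_closure :: "('a, 'm) monoid_scheme \<Rightarrow> 'a set \<Rightarrow> 'a set"
  where "normal_closure F S = \<Inter>{N. N \<lhd> F \<and> S \<subseteq> N}"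

definition conjugate :: "('a, 'm) monoid_scheme \<Rightarrow> 'a \<Rightarrow> 'a \<Rightarrow> 'a"
  where "conjugate F a b = inv\<^bsub>F\<^esub> b \<otimes>\<^bsub>F\<^esub> a \<otimes>\<^bsub>F\<^esub> b"

definition commutator :: "('a, 'm) monoid_scheme \<Rightarrow> 'a \<Rightarrow> 'a \<Rightarrow> 'a"
  where "commutator F a b = inv\<^bsub>F\<^esub> a \<otimes>\<^bsub>F\<^esub> inv\<^bsub>F\<^esub> b \<otimes>\<^bsub>F\<^esub> a \<otimes>\<^bsub>F\<^esub> b"


section \<open>The group \<open>O(G, H)\<close>\<close>

definition power_group :: "('a, 'm) monoid_scheme \<Rightarrow> (int \<Rightarrow> 'a) monoid"
  where "power_group G = sum_group UNIV (\<lambda>_. G)"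

definition copy :: "('a, 'm) monoid_scheme \<Rightarrow> int \<Rightarrow> 'a \<Rightarrow> int \<Rightarrow> 'a"
  where "copy G i g = (\<lambda>j. if j = i then g else \<one>\<^bsub>G\<^esub>)"

type_synonym ('a, 'b) O_free_elem = "(((int \<Rightarrow> 'a) + (int \<Rightarrow> 'b)) list set + int) list set"

definition O_free :: "('a, 'm) monoid_scheme \<Rightarrow> ('b, 'n) monoid_scheme
    \<Rightarrow> ('a, 'b) O_free_elem monoid"
  where "O_free G H =
    free_product (free_product (power_group G) (power_group H)) integer_group"

definition O_left :: "('a, 'm) monoid_scheme \<Rightarrow> ('b, 'n) monoid_scheme
    \<Rightarrow> int \<Rightarrow> 'a \<Rightarrow> ('a, 'b) O_free_elem"
  where "O_left G H i g =
    fp_inl (free_product (power_group G) (power_group H)) integer_group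
      (fp_inl (power_group G) (power_group H) (copy G i g))"

definition O_right :: "('a, 'm) monoid_scheme \<Rightarrow> ('b, 'n) monoid_scheme
    \<Rightarrow> int \<Rightarrow> 'b \<Rightarrow> ('a, 'b) O_free_elem"
  where "O_right G H i h =
    fp_inl (free_product (power_group G) (power_group H)) integer_group
      (fp_inr (power_group G) (power_group H) (copy H i h))"

definition O_t :: "('a, 'm) monoid_scheme \<Rightarrow> ('b, 'n) monoid_scheme \<Rightarrow> ('a, 'b) O_free_elem"
  where "O_t G H = fp_inr (free_product (power_group G) (power_group H)) integer_group 1"

text \<open>A relation \<open>u = v\<close> is represented by the relator \<open>u v\<^sup>-\<^sup>1\<close>.\<close>

definition O_relators :: "('a, 'm) monoid_scheme \<Rightarrow> ('b, 'n) monoid_scheme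
    \<Rightarrow> ('a, 'b) O_free_elem set" where
  "O_relators G H =
    {conjugate (O_free G H) (O_left G H i g) (O_t G H)
        \<otimes>\<^bsub>O_free G H\<^esub> inv\<^bsub>O_free G H\<^esub> (O_left G H (i + 1) g) | i g. g \<in> carrier G} \<union>
    {conjugate (O_free G H) (O_right G H i h) (O_t G H)
        \<otimes>\<^bsub>O_free G H\<^esub> inv\<^bsub>O_free G H\<^esub> (O_right G H (i + 1) h) | i h. h \<in> carrier H} \<union>
    {commutator (O_free G H) (O_left G H i g) (O_right G H j h) | i j g h.
        g \<in> carrier G \<and> h \<in> carrier H \<and> i \<le> j}"

definition O_group :: "('a, 'm) monoid_scheme \<Rightarrow> ('b, 'n) monoid_scheme
    \<Rightarrow> ('a, 'b) O_free_elem set monoid"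
  where "O_group G H = O_free G H Mod normal_closure (O_free G H) (O_relators G H)"


section \<open>Fundamental groups of combinatorial 2-complexes\<close>

text \<open>The 1-skeleton is a graph in the sense of Serre: every edge \<open>e\<close> has an inverse edge
  \<open>opp e\<close>. Each 2-cell is given by the closed path along which it is attached.\<close>

record ('v, 'e) complex2 =
  verts :: "'v set"
  edges :: "'e set"
  src :: "'e \<Rightarrow> 'v"
  tgt :: "'e \<Rightarrow> 'v"
  opp :: "'e \<Rightarrow> 'e"
  cells :: "'e list set"

primrec is_path :: "('v, 'e) complex2 \<Rightarrow> 'v \<Rightarrow> 'e list \<Rightarrow> 'v \<Rightarrow> bool" where
  "is_path K u [] v \<longleftrightarrow> u \<in> verts K \<and> u = v"
| "is_path K u (e # p) v \<longleftrightarrow> e \<in> edges K \<and> src K e = u \<and> is_path K (tgt K e) p v"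

inductive homotopy_step :: "('v, 'e) complex2 \<Rightarrow> 'v \<Rightarrow> 'v \<Rightarrow> 'e list \<Rightarrow> 'e list \<Rightarrow> bool"
  for K u v where
  cancel: "is_path K u (p @ [e, opp K e] @ q) v \<Longrightarrow>
    homotopy_step K u v (p @ [e, opp K e] @ q) (p @ q)"
| cell: "is_path K u (p @ c @ q) v \<Longrightarrow> c \<in> cells K \<Longrightarrow>
    homotopy_step K u v (p @ c @ q) (p @ q)"

definition homotopy_rel :: "('v, 'e) complex2 \<Rightarrow> 'v \<Rightarrow> 'v \<Rightarrow> 'e list rel"
  where "homotopy_rel K u v = {(p, q). equivclp (homotopy_step K u v) p q}"

definition pi1 :: "('v, 'e) complex2 \<Rightarrow> 'v \<Rightarrow> 'e list set monoid" where
  "pi1 K v =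
    \<lparr>carrier = {p. is_path K v p v} // homotopy_rel K v v,
     monoid.mult = (\<lambda>A B. \<Union>p\<in>A. \<Union>q\<in>B. homotopy_rel K v v `` {p @ q}),
     one = homotopy_rel K v v `` {[]}\<rparr>"


section \<open>Diagram groups\<close>

definition semigroup_presentation :: "'s set \<Rightarrow> ('s list \<times> 's list) set \<Rightarrow> bool" where
  "semigroup_presentation \<Sigma> R \<longleftrightarrow>
    (\<forall>(u, v)\<in>R. u \<in> lists \<Sigma> \<and> v \<in> lists \<Sigma> \<and> u \<noteq> [] \<and> v \<noteq> []) \<and>
    (\<forall>u v. (u, v) \<in> R \<longrightarrow> (v, u) \<notin> R)"

text \<open>The tuple \<open>(p, u, v, q)\<close> stands for the edge \<open>(p, u \<rightarrow> v, q)\<close> from \<open>puq\<close> to \<open>pvq\<close>.\<close>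

type_synonym 's squier_edge = "'s list \<times> 's list \<times> 's list \<times> 's list"

text \<open>The attaching path is \<open>p\<^sub>1 p\<^sub>2\<^sup>-\<^sup>1\<close>: the first two edges form \<open>p\<^sub>1\<close>, the last two form
  \<open>p\<^sub>2\<^sup>-\<^sup>1\<close>, where \<open>p\<^sub>2 = (pl\<^sub>1z, l\<^sub>2 \<rightarrow> r\<^sub>2, q)(p, l\<^sub>1 \<rightarrow> r\<^sub>1, zr\<^sub>2q)\<close>.\<close>

definition squier_cell :: "'s list \<Rightarrow> 's list \<Rightarrow> 's list \<Rightarrow> 's list \<Rightarrow> 's list \<Rightarrow> 's list \<Rightarrow> 's list
    \<Rightarrow> 's squier_edge list" where
  "squier_cell p l1 r1 z l2 r2 q =
    [(p, l1, r1, z @ l2 @ q), (p @ r1 @ z, l2, r2, q),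
     (p, r1, l1, z @ r2 @ q), (p @ l1 @ z, r2, l2, q)]"

definition squier_complex :: "'s set \<Rightarrow> ('s list \<times> 's list) set
    \<Rightarrow> ('s list, 's squier_edge) complex2" where
  "squier_complex \<Sigma> R =
    \<lparr>verts = lists \<Sigma> - {[]},
     edges = {(p, u, v, q). p \<in> lists \<Sigma> \<and> q \<in> lists \<Sigma> \<and> ((u, v) \<in> R \<or> (v, u) \<in> R)},
     src = (\<lambda>(p, u, v, q). p @ u @ q),
     tgt = (\<lambda>(p, u, v, q). p @ v @ q),
     opp = (\<lambda>(p, u, v, q). (p, v, u, q)),
     cells = {squier_cell p l1 r1 z l2 r2 q | p l1 r1 z l2 r2 q.
       p \<in> lists \<Sigma> \<and> z \<in> lists \<Sigma> \<and> q \<in> lists \<Sigma> \<and> (l1, r1) \<in> R \<and> (l2, r2) \<in> R}\<rparr>"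

definition diagram_group :: "'s set \<Rightarrow> ('s list \<times> 's list) set \<Rightarrow> 's list
    \<Rightarrow> 's squier_edge list set monoid"
  where "diagram_group \<Sigma> R w = pi1 (squier_complex \<Sigma> R) w"

text \<open>HOL cannot quantify existentially over types, so the type \<open>'s\<close> from which the letters of
  the alphabet are drawn is a parameter. The alphabet itself is an arbitrary subset of \<open>'s\<close>.\<close>

definition is_diagram_group :: "'s itself \<Rightarrow> ('a, 'm) monoid_scheme \<Rightarrow> bool" where
  "is_diagram_group (_ :: 's itself) G \<longleftrightarrow> group G \<and>
    (\<exists>(\<Sigma> :: 's set) R w. semigroup_presentation \<Sigma> R \<and> w \<in> lists \<Sigma> \<and> w \<noteq> [] \<and>
      G \<cong> diagram_group \<Sigma> R w)"

end

theory Submission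
  imports Defs "HOL-Library.Nat_Bijection"
begin

text \<open>
Let \<open>G\<close> and \<open>H\<close> be the diagram groups of presentations with rules \<open>R\<^sub>1\<close>, \<open>R\<^sub>2\<close> and base words \<open>w\<^sub>1\<close>, \<open>w\<^sub>2\<close> over
disjoint alphabets. Add letters \<open>a\<close>, \<open>b\<close>, \<open>c\<close> and brackets, and the rules
\<open>a = a[w\<^sub>1]\<close>, \<open>[w\<^sub>1]c = c[w\<^sub>2]\<close>, \<open>b = [w\<^sub>2]b\<close>. Then \<open>O(G, H)\<close> is the diagram group with base word \<open>acb\<close>.

The words in the component of \<open>acb\<close> are \<open>a[u\<^sub>1]...[u\<^sub>m]c[v\<^sub>1]...[v\<^sub>n]b\<close>, where the \<open>u\<^sub>i\<close> and \<open>v\<^sub>j\<close> can be reached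
from \<open>w\<^sub>1\<close> and \<open>w\<^sub>2\<close>. Think of \<open>c\<close> as a movable border between blocks for copies of \<open>G\<close> and blocks for copies
of \<open>H\<close>. The loop that creates \<open>[w\<^sub>1]\<close> at \<open>a\<close>, carries it across the border
and deletes \<open>[w\<^sub>2]\<close> at \<open>b\<close> is \<open>t\<close>; it moves the border by one step. A loop in a block with \<open>d\<close> blocks between
it and \<open>c\<close> is an element of the copy of \<open>G\<close> with index \<open>-d\<close>, or of the copy of \<open>H\<close> with index \<open>d\<close>. Loops in
different blocks of one word commute. With the border in its \<open>n\<close>-th position, that is, after conjugation by
\<open>t\<^sup>n\<close>, there are blocks for \<open>g\<^sub>i\<close> with \<open>i \<le> n\<close> and for \<open>h\<^sub>j\<close> with \<open>n \<le> j\<close>. So \<open>g\<^sub>i\<close> and \<open>h\<^sub>j\<close> fit into one word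
exactly if \<open>i \<le> j\<close>.

The proof constructs homomorphisms in both directions. From \<open>O(G, H)\<close> to the diagram group there is the
one given by the universal property (\<open>O_hom_exists\<close>), with the relations checked in \<open>G_val_shift\<close>,
\<open>H_val_shift\<close>, \<open>G_G_commute\<close>, \<open>H_H_commute\<close> and \<open>G_H_commute\<close>. In the other direction every edge of the
component receives a label in \<open>O(G, H)\<close> that can be read off from the word around it, and \<open>label_square\<close> says
that the labels respect the 2-cells. To see that the two maps are inverse to each other, choose a path from
\<open>acb\<close> to every word of the component. With these paths every edge has a class in the fundamental group, and
the main point is that this class depends only on the label: it is trivial for the rules at \<open>a\<close> and \<open>b\<close>, it is
\<open>t\<close> for the rule at \<open>c\<close> (\<open>V_c\<close>), and for an edge in a block it depends only on the edge inside the block and on the distance of the block from \<open>c\<close>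
(\<open>V_G\<close>, \<open>V_H\<close>). This rests on one tool, the interchange law \<open>path_square\<close>: a context can be changed by a path of
trivial class.
\<close>

section \<open>Combinatorial homotopy\<close>

text \<open>Serre's axioms for the graph, and the demand that every cell is attached along a closed path. The
record type itself imposes none of this.\<close>
locale serre_complex =
  fixes K :: "('v, 'e) complex2"
  assumes opp_edge: "e \<in> edges K \<Longrightarrow> opp K e \<in> edges K"
    and opp_opp: "e \<in> edges K \<Longrightarrow> opp K (opp K e) = e"
    and src_opp: "e \<in> edges K \<Longrightarrow> src K (opp K e) = tgt K e"
    and src_verts: "e \<in> edges K \<Longrightarrow> src K e \<in> verts K"
    and cell_closed: "c \<in> cells K \<Longrightarrow> \<exists>u. is_path K u c u"
begin

lemma tgt_opp: "e \<in> edges K \<Longrightarrow> tgt K (opp K e) = src K e"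
  using opp_edge opp_opp src_opp by metis

lemma tgt_verts: "e \<in> edges K \<Longrightarrow> tgt K e \<in> verts K"
  using opp_edge src_opp src_verts by metis

lemma is_path_verts: "is_path K u p v \<Longrightarrow> u \<in> verts K \<and> v \<in> verts K"
  by (induction p arbitrary: u) (auto simp: src_verts)

lemma is_path_append:
  "is_path K u (p @ q) v \<longleftrightarrow> (\<exists>w. is_path K u p w \<and> is_path K w q v)"
  by (induction p arbitrary: u) (use is_path_verts in auto)

lemma is_path_target_unique: "is_path K u p v \<Longrightarrow> is_path K u p w \<Longrightarrow> v = w"
  by (induction p arbitrary: u) auto

definition path_inv :: "'e list \<Rightarrow> 'e list" where
  "path_inv p = map (opp K) (rev p)"

lemma path_inv_simps [simp]:
  "path_inv [] = []" "path_inv (e # p) = path_inv p @ [opp K e]"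
  "path_inv (p @ q) = path_inv q @ path_inv p"
  by (simp_all add: path_inv_def)

lemma is_path_inv: "is_path K u p v \<Longrightarrow> is_path K v (path_inv p) u"
proof (induction p arbitrary: u)
  case (Cons e p)
  then show ?case
    by (auto simp: is_path_append opp_edge src_opp tgt_opp src_verts tgt_verts)
qed auto

lemma path_inv_inv: "is_path K u p v \<Longrightarrow> path_inv (path_inv p) = p"
  by (induction p arbitrary: u) (auto simp: opp_opp)

lemma cell_loop: "c \<in> cells K \<Longrightarrow> is_path K u c v \<Longrightarrow> u = v"
  using cell_closed[of c] by (cases c) (auto dest: is_path_target_unique)

lemma step_is_path: "homotopy_step K u v p q \<Longrightarrow> is_path K u p v \<and> is_path K u q v"
proof (induction rule: homotopy_step.induct)
  case (cancel p e q)
  then show ?case by (auto simp: is_path_append tgt_opp)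
next
  case (cell p c q)
  then show ?case by (auto simp: is_path_append dest: cell_loop)
qed

abbreviation homotopic :: "'v \<Rightarrow> 'v \<Rightarrow> 'e list \<Rightarrow> 'e list \<Rightarrow> bool" where
  "homotopic u v \<equiv> equivclp (homotopy_step K u v)"

lemma homotopic_is_path: "homotopic u v p q \<Longrightarrow> is_path K u p v \<longleftrightarrow> is_path K u q v"
  by (induction rule: equivclp_induct) (auto dest: step_is_path)

lemma step_context:
  assumes "homotopy_step K u v p q" "is_path K u' a u" "is_path K v b v'"
  shows "homotopy_step K u' v' (a @ p @ b) (a @ q @ b)"
  using assms
proof (induction rule: homotopy_step.induct)
  case (cancel p e q)
  have "is_path K u' ((a @ p) @ [e, opp K e] @ (q @ b)) v'"
    using cancel by (auto simp only: is_path_append)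
  from homotopy_step.cancel[OF this] show ?case by simp
next
  case (cell p c q)
  have "is_path K u' ((a @ p) @ c @ (q @ b)) v'"
    using cell by (auto simp only: is_path_append)
  from homotopy_step.cell[OF this \<open>c \<in> cells K\<close>] show ?case by simp
qed

lemma homotopic_context:
  assumes "homotopic u v p q" "is_path K u' a u" "is_path K v b v'"
  shows "homotopic u' v' (a @ p @ b) (a @ q @ b)"
  using assms(1)
proof (induction rule: equivclp_induct)
  case (step y z)
  have "homotopy_step K u' v' (a @ y @ b) (a @ z @ b) \<or> homotopy_step K u' v' (a @ z @ b) (a @ y @ b)"
    using step(2) step_context[OF _ assms(2,3)] by blast
  with step.IH show ?case
    by (rule equivclp_into_equivclp)
qed simp

lemma homotopic_cancel:
  "is_path K u (p @ r @ path_inv r @ q) v \<Longrightarrow> homotopic u v (p @ r @ path_inv r @ q) (p @ q)"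
proof (induction r arbitrary: p q)
  case (Cons e r)
  have "homotopic u v ((p @ [e]) @ r @ path_inv r @ ([opp K e] @ q)) ((p @ [e]) @ ([opp K e] @ q))"
    by (rule Cons.IH) (use Cons.prems in simp)
  moreover from this have "homotopy_step K u v (p @ [e, opp K e] @ q) (p @ q)"
    using Cons.prems by (intro homotopy_step.cancel) (simp add: homotopic_is_path)
  ultimately show ?case
    by (simp add: equivclp_into_equivclp)
qed simp

lemma homotopic_cancel':
  "is_path K u (p @ path_inv r @ r @ q) v \<Longrightarrow> homotopic u v (p @ path_inv r @ r @ q) (p @ q)"
proof -
  assume "is_path K u (p @ path_inv r @ r @ q) v"
  moreover from this have "path_inv (path_inv r) = r"
    by (auto simp only: is_path_append intro: path_inv_inv)
  ultimately show ?thesis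
    using homotopic_cancel[of u p "path_inv r" q v] by simp
qed

subsection \<open>The fundamental group\<close>

definition cls :: "'v \<Rightarrow> 'e list \<Rightarrow> 'e list set" where
  "cls w p = homotopy_rel K w w `` {p}"

lemma cls_eq: "cls w p = cls w q \<longleftrightarrow> homotopic w w p q"
proof
  show "homotopic w w p q" if "cls w p = cls w q"
    using that by (auto simp: cls_def homotopy_rel_def set_eq_iff intro: equivclp_sym)
  show "cls w p = cls w q" if "homotopic w w p q"
    using that by (auto simp: cls_def homotopy_rel_def intro: equivclp_trans[OF equivclp_sym] equivclp_trans)
qed

lemma in_cls: "q \<in> cls w p \<longleftrightarrow> homotopic w w p q"
  by (simp add: cls_def homotopy_rel_def)

lemma carrier_pi1: "carrier (pi1 K w) = cls w ` {p. is_path K w p w}"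
  by (auto simp: pi1_def quotient_def cls_def)

lemma one_pi1: "\<one>\<^bsub>pi1 K w\<^esub> = cls w []"
  by (simp add: pi1_def cls_def)

lemma cls_mult:
  assumes "is_path K w p w" "is_path K w q w"
  shows "cls w p \<otimes>\<^bsub>pi1 K w\<^esub> cls w q = cls w (p @ q)"
proof -
  have *: "cls w (p' @ q') = cls w (p @ q)" if "p' \<in> cls w p" "q' \<in> cls w q" for p' q'
  proof -
    have h: "homotopic w w p p'" "homotopic w w q q'"
      using that by (simp_all add: in_cls)
    then have p': "is_path K w p' w"
      using assms homotopic_is_path by blast
    have w: "is_path K w [] w"
      using assms is_path_verts by simp
    have "homotopic w w (p @ q) (p' @ q)" "homotopic w w (p' @ q) (p' @ q')"
      using homotopic_context[OF h(1) w assms(2)] homotopic_context[OF h(2) p' w] by simp_all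
    then have "homotopic w w (p' @ q') (p @ q)"
      by (rule equivclp_sym[OF equivclp_trans])
    then show ?thesis
      by (simp only: cls_eq)
  qed
  have "p \<in> cls w p" "q \<in> cls w q"
    by (simp_all add: in_cls)
  moreover have "cls w p \<otimes>\<^bsub>pi1 K w\<^esub> cls w q = (\<Union>p'\<in>cls w p. \<Union>q'\<in>cls w q. cls w (p' @ q'))"
    by (simp add: pi1_def flip: cls_def)
  moreover have "\<dots> = (\<Union>p'\<in>cls w p. \<Union>q'\<in>cls w q. cls w (p @ q))"
    by (intro SUP_cong refl *)
  ultimately show ?thesis
    by auto
qed

lemma cls_in_carrier: "is_path K w p w \<Longrightarrow> cls w p \<in> carrier (pi1 K w)"
  by (auto simp: carrier_pi1)

lemma group_pi1:
  assumes "w \<in> verts K"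
  shows "group (pi1 K w)"
proof (rule groupI)
  show "\<one>\<^bsub>pi1 K w\<^esub> \<in> carrier (pi1 K w)"
    using assms by (auto simp: one_pi1 carrier_pi1)
next
  fix x assume "x \<in> carrier (pi1 K w)"
  then obtain p where p: "is_path K w p w" "x = cls w p"
    by (auto simp: carrier_pi1)
  from p(1) have "is_path K w ([] @ path_inv p @ p @ []) w"
    using is_path_inv is_path_append by (metis append_Nil append_Nil2)
  from homotopic_cancel'[OF this] p have "cls w (path_inv p) \<otimes>\<^bsub>pi1 K w\<^esub> x = \<one>\<^bsub>pi1 K w\<^esub>"
    by (simp add: cls_mult is_path_inv one_pi1 cls_eq)
  then show "\<exists>y\<in>carrier (pi1 K w). y \<otimes>\<^bsub>pi1 K w\<^esub> x = \<one>\<^bsub>pi1 K w\<^esub>"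
    by (rule bexI) (use p is_path_inv in \<open>auto intro!: cls_in_carrier\<close>)
next
  fix x y assume "x \<in> carrier (pi1 K w)" "y \<in> carrier (pi1 K w)"
  then obtain p q where p: "is_path K w p w" "x = cls w p" "is_path K w q w" "y = cls w q"
    by (auto simp: carrier_pi1)
  then have pq: "is_path K w (p @ q) w"
    by (auto simp: is_path_append)
  with p show "x \<otimes>\<^bsub>pi1 K w\<^esub> y \<in> carrier (pi1 K w)"
    by (simp add: cls_mult cls_in_carrier)
  show "x \<otimes>\<^bsub>pi1 K w\<^esub> y \<otimes>\<^bsub>pi1 K w\<^esub> z = x \<otimes>\<^bsub>pi1 K w\<^esub> (y \<otimes>\<^bsub>pi1 K w\<^esub> z)"
    if "z \<in> carrier (pi1 K w)" for z
  proof -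
    from that obtain r where r: "is_path K w r w" "z = cls w r"
      by (auto simp: carrier_pi1)
    with p have qr: "is_path K w (q @ r) w"
      by (auto simp: is_path_append)
    show ?thesis
      using p r pq qr by (simp add: cls_mult)
  qed
next
  fix x assume "x \<in> carrier (pi1 K w)"
  then obtain p where p: "is_path K w p w" "x = cls w p"
    by (auto simp: carrier_pi1)
  then show "\<one>\<^bsub>pi1 K w\<^esub> \<otimes>\<^bsub>pi1 K w\<^esub> x = x"
    using assms by (simp add: one_pi1 cls_mult)
qed

end

subsection \<open>Labellings of a component by group elements\<close>

definition path_val :: "('g, 'm) monoid_scheme \<Rightarrow> ('e \<Rightarrow> 'g) \<Rightarrow> 'e list \<Rightarrow> 'g" where
  "path_val L f p = foldr (\<lambda>e x. f e \<otimes>\<^bsub>L\<^esub> x) p \<one>\<^bsub>L\<^esub>"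

lemma path_val_simps [simp]:
  "path_val L f [] = \<one>\<^bsub>L\<^esub>" "path_val L f (e # p) = f e \<otimes>\<^bsub>L\<^esub> path_val L f p"
  by (simp_all add: path_val_def)

text \<open>A labelling is the datum that defines a homomorphism from a fundamental group to \<open>L\<close> edge by edge:
opposite edges have inverse labels, and the label of the boundary of every cell is trivial. Only edges
that start in \<open>S\<close> are constrained, where \<open>S\<close> is a union of components. This matters in the main
construction, whose labels make sense only on the component of the base word.\<close>
locale labelling = serre_complex K + L: group L
  for K :: "('v, 'e) complex2" and L :: "('g, 'm) monoid_scheme" and S :: "'v set"
    and f :: "'e \<Rightarrow> 'g" +
  assumes S_closed: "e \<in> edges K \<Longrightarrow> src K e \<in> S \<Longrightarrow> tgt K e \<in> S"
    and f_carrier: "e \<in> edges K \<Longrightarrow> src K e \<in> S \<Longrightarrow> f e \<in> carrier L"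
    and f_opp: "e \<in> edges K \<Longrightarrow> src K e \<in> S \<Longrightarrow> f e \<otimes>\<^bsub>L\<^esub> f (opp K e) = \<one>\<^bsub>L\<^esub>"
    and f_cell: "c \<in> cells K \<Longrightarrow> is_path K u c u \<Longrightarrow> u \<in> S \<Longrightarrow> path_val L f c = \<one>\<^bsub>L\<^esub>"
begin

abbreviation "val \<equiv> path_val L f"

lemma path_in_S: "is_path K u p v \<Longrightarrow> u \<in> S \<Longrightarrow> v \<in> S"
  by (induction p arbitrary: u) (auto simp: S_closed)

lemma val_carrier: "is_path K u p v \<Longrightarrow> u \<in> S \<Longrightarrow> val p \<in> carrier L"
  by (induction p arbitrary: u) (auto simp: S_closed f_carrier)

lemma val_append:
  "is_path K u p v \<Longrightarrow> is_path K v q w \<Longrightarrow> u \<in> S \<Longrightarrow> val (p @ q) = val p \<otimes>\<^bsub>L\<^esub> val q"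
proof (induction p arbitrary: u)
  case Nil
  then show ?case using val_carrier by auto
next
  case (Cons e p)
  then show ?case
    using val_carrier[of "tgt K e" p v] val_carrier[of v q w] path_in_S[of "tgt K e" p v]
    by (auto simp: S_closed f_carrier L.m_assoc)
qed

lemma f_opp_inv:
  assumes "e \<in> edges K" "src K e \<in> S"
  shows "f (opp K e) = inv\<^bsub>L\<^esub> f e"
proof -
  have o: "opp K e \<in> edges K" "src K (opp K e) \<in> S"
    using assms by (simp_all add: opp_edge src_opp S_closed)
  then have "f (opp K e) \<otimes>\<^bsub>L\<^esub> f e = \<one>\<^bsub>L\<^esub>"
    using f_opp[of "opp K e"] assms by (simp add: opp_opp)
  then show ?thesis
    using assms o by (intro L.inv_equality[symmetric]) (simp_all add: f_carrier)
qed

lemma val_inv: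
  assumes "is_path K u p v" "u \<in> S"
  shows "val (path_inv p) = inv\<^bsub>L\<^esub> val p"
  using assms
proof (induction p arbitrary: u)
  case (Cons e p)
  then have e: "e \<in> edges K" "src K e \<in> S" "tgt K e \<in> S" and p: "is_path K (tgt K e) p v"
    by (auto simp: S_closed)
  have "is_path K (tgt K e) [opp K e] (src K e)"
    using e by (simp add: opp_edge src_opp tgt_opp src_verts)
  then have "val (path_inv p @ [opp K e]) = val (path_inv p) \<otimes>\<^bsub>L\<^esub> val [opp K e]"
    using is_path_inv[OF p] path_in_S[OF p] e by (intro val_append) auto
  then show ?case
    using Cons.IH[OF p] e p val_carrier[OF p] by (simp add: f_opp_inv f_carrier L.inv_mult_group)
qed simp

lemma val_step:
  assumes "homotopy_step K u v p q" "u \<in> S"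
  shows "val p = val q"
  using assms
proof (induction rule: homotopy_step.induct)
  case (cancel p e q)
  then obtain x y where x: "is_path K u p x" "is_path K x [e, opp K e] y" "is_path K y q v"
    by (auto simp only: is_path_append)
  then have "val (p @ [e, opp K e] @ q) = val p \<otimes>\<^bsub>L\<^esub> (val [e, opp K e] \<otimes>\<^bsub>L\<^esub> val q)"
    using cancel.prems path_in_S
    by (metis is_path_append val_append)
  moreover have "val [e, opp K e] = \<one>\<^bsub>L\<^esub>"
    using x cancel.prems path_in_S[OF x(1)] by (auto simp: f_opp f_carrier opp_edge src_opp S_closed)
  moreover have "x = y"
    using x by (auto simp: tgt_opp)
  ultimately show ?case
    using x cancel.prems path_in_S[OF x(1)] val_append[OF x(1), of q v] val_carrier[OF x(3)] by auto
next
  case (cell p c q)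
  then obtain x y where x: "is_path K u p x" "is_path K x c y" "is_path K y q v"
    by (auto simp only: is_path_append)
  moreover have "x = y"
    using cell_loop[OF cell(2) x(2)] .
  moreover have "val (p @ c @ q) = val p \<otimes>\<^bsub>L\<^esub> (val c \<otimes>\<^bsub>L\<^esub> val q)"
    using x cell.prems path_in_S by (metis is_path_append val_append)
  ultimately show ?case
    using cell f_cell[of c x] path_in_S[OF x(1)] val_append[OF x(1), of q v] val_carrier[OF x(3)] by auto
qed

text \<open>Cancelling an edge with its opposite and deleting a cell both leave the product of the labels
unchanged. Hence a labelling factors through homotopy classes.\<close>
lemma val_homotopic:
  assumes "homotopic u v p q" "u \<in> S"
  shows "val p = val q"
  using assms(1) by (induction rule: equivclp_induct) (use assms(2) val_step in metis)+

definition pi1_hom :: "'e list set \<Rightarrow> 'g" where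
  "pi1_hom A = the_elem (val ` A)"

lemma pi1_hom_cls: "w \<in> S \<Longrightarrow> pi1_hom (cls w p) = val p"
proof -
  assume w: "w \<in> S"
  have "val ` cls w p = {val p}"
    using val_homotopic[OF _ w] by (auto simp: in_cls intro!: image_eqI[of _ _ p])
  then show ?thesis by (simp add: pi1_hom_def)
qed

lemma pi1_hom_hom: "w \<in> S \<Longrightarrow> pi1_hom \<in> hom (pi1 K w) L"
  by (rule homI)
    (auto simp: carrier_pi1 pi1_hom_cls cls_mult val_append val_carrier)

end

text \<open>The paths \<open>\<gamma> u\<close> from the root replace a spanning tree: they connect the root to every vertex of the
component, but they need not be compatible with each other.\<close>
locale rooted_complex = serre_complex K
  for K :: "('v, 'e) complex2" and S :: "'v set" and w :: 'v and \<gamma> :: "'v \<Rightarrow> 'e list" +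
  assumes root: "w \<in> S" and component_closed: "e \<in> edges K \<Longrightarrow> src K e \<in> S \<Longrightarrow> tgt K e \<in> S"
    and \<gamma>_path: "u \<in> S \<Longrightarrow> is_path K w (\<gamma> u) u"
    and \<gamma>_root: "\<gamma> w = []"
begin

text \<open>The loop that runs along the chosen paths and across one edge. The product of these classes along a path is
the class of the whole path, closed up by the chosen paths at its two ends.\<close>
definition edge_class :: "'e \<Rightarrow> 'e list set" where
  "edge_class e = cls w (\<gamma> (src K e) @ [e] @ path_inv (\<gamma> (tgt K e)))"

lemma root_vert: "w \<in> verts K"
  using \<gamma>_path[OF root] is_path_verts by blast

interpretation pi1: group "pi1 K w"
  by (rule group_pi1[OF root_vert])

lemma loop_at_root:
  assumes "is_path K u p v" "u \<in> S" "v \<in> S"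
  shows "is_path K w (\<gamma> u @ p @ path_inv (\<gamma> v)) w"
  unfolding is_path_append using assms \<gamma>_path is_path_inv by blast

lemma path_in_component: "is_path K u p v \<Longrightarrow> u \<in> S \<Longrightarrow> v \<in> S"
  by (induction p arbitrary: u) (auto simp: component_closed)

lemma path_val_edge_class:
  assumes "is_path K u p v" "u \<in> S"
  shows "path_val (pi1 K w) edge_class p = cls w (\<gamma> u @ p @ path_inv (\<gamma> v))"
  using assms
proof (induction p arbitrary: u)
  case Nil
  have "is_path K w ([] @ \<gamma> u @ path_inv (\<gamma> u) @ []) w"
    using loop_at_root[of u "[]" u] Nil by auto
  from homotopic_cancel[OF this] Nil show ?case
    by (auto simp: one_pi1 cls_eq intro: equivclp_sym)
next
  case (Cons e p)
  let ?u = "src K e" and ?x = "tgt K e"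
  have e: "e \<in> edges K" "?u \<in> S" "?x \<in> S" and u: "u = ?u" and p: "is_path K ?x p v"
    using Cons.prems component_closed by auto
  have v: "v \<in> S"
    using path_in_component[OF p e(3)] .
  have 1: "is_path K w (\<gamma> ?u @ [e] @ path_inv (\<gamma> ?x)) w"
    using e by (intro loop_at_root) (auto simp: tgt_verts)
  have 2: "is_path K w (\<gamma> ?x @ p @ path_inv (\<gamma> v)) w"
    using e v p by (intro loop_at_root)
  have "path_val (pi1 K w) edge_class (e # p)
      = cls w ((\<gamma> ?u @ [e] @ path_inv (\<gamma> ?x)) @ (\<gamma> ?x @ p @ path_inv (\<gamma> v)))"
    using Cons.IH[OF p e(3)] cls_mult[OF 1 2] by (simp add: edge_class_def[of e])
  also have "\<dots> = cls w ((\<gamma> ?u @ [e]) @ p @ path_inv (\<gamma> v))"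
    unfolding cls_eq
    using homotopic_cancel'[of w "\<gamma> ?u @ [e]" "\<gamma> ?x" "p @ path_inv (\<gamma> v)" w] 1 2
    by (auto simp: is_path_append)
  finally show ?case
    using u by simp
qed

sublocale labelling K "pi1 K w" S edge_class
proof unfold_locales
  fix e assume e: "e \<in> edges K" "src K e \<in> S"
  show "tgt K e \<in> S"
    using e by (rule component_closed)
  show "edge_class e \<in> carrier (pi1 K w)"
    using e loop_at_root[of "src K e" "[e]" "tgt K e"] component_closed
    by (auto simp: edge_class_def tgt_verts intro!: cls_in_carrier)
  have "is_path K (src K e) [e, opp K e] (src K e)"
    using e by (simp add: opp_edge src_opp tgt_opp src_verts)
  then have 1: "path_val (pi1 K w) edge_class [e, opp K e]
      = cls w (\<gamma> (src K e) @ [e, opp K e] @ path_inv (\<gamma> (src K e)))"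
    using e by (intro path_val_edge_class)
  also have "\<dots> = path_val (pi1 K w) edge_class []"
  proof -
    have "cls w (\<gamma> (src K e) @ [e, opp K e] @ path_inv (\<gamma> (src K e)))
        = cls w (\<gamma> (src K e) @ path_inv (\<gamma> (src K e)))"
      unfolding cls_eq
      using loop_at_root[OF \<open>is_path K (src K e) [e, opp K e] (src K e)\<close> e(2) e(2)]
      by (intro r_into_equivclp homotopy_step.cancel) simp
    then show ?thesis
      using path_val_edge_class[of "src K e" "[]" "src K e"] e by (simp add: src_verts)
  qed
  finally show "edge_class e \<otimes>\<^bsub>pi1 K w\<^esub> edge_class (opp K e) = \<one>\<^bsub>pi1 K w\<^esub>"
    using e loop_at_root[of "tgt K e" "[opp K e]" "src K e"] component_closed
    by (simp add: edge_class_def[of "opp K e"] src_opp tgt_opp src_verts opp_edge cls_in_carrier)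
next
  fix c u assume c: "c \<in> cells K" "is_path K u c u" "u \<in> S"
  have "path_val (pi1 K w) edge_class c = cls w (\<gamma> u @ c @ path_inv (\<gamma> u))"
    using c by (intro path_val_edge_class)
  also have "\<dots> = cls w (\<gamma> u @ path_inv (\<gamma> u))"
    unfolding cls_eq using loop_at_root[of u c u] c
    by (intro r_into_equivclp homotopy_step.cell) auto
  also have "\<dots> = path_val (pi1 K w) edge_class []"
    using path_val_edge_class[of u "[]" u] c is_path_verts by auto
  finally show "path_val (pi1 K w) edge_class c = \<one>\<^bsub>pi1 K w\<^esub>"
    by simp
qed

lemma val_loop: "is_path K w p w \<Longrightarrow> path_val (pi1 K w) edge_class p = cls w p"
  using path_val_edge_class[of w p w] root by (simp add: \<gamma>_root)

text \<open>If the chosen path to \<open>v\<close> continues the chosen path to \<open>u\<close> along \<open>p\<close>, then closing up \<open>p\<close> gives a path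
followed by its inverse. All trivial values in the diagram group below come from this observation.\<close>
lemma val_tree:
  assumes "is_path K u p v" "u \<in> S" "\<gamma> v = \<gamma> u @ p"
  shows "path_val (pi1 K w) edge_class p = \<one>\<^bsub>pi1 K w\<^esub>"
proof -
  have v: "v \<in> S"
    using path_in_component assms by blast
  have "path_val (pi1 K w) edge_class p = cls w (\<gamma> v @ path_inv (\<gamma> v))"
    using path_val_edge_class assms by auto
  also have "\<dots> = path_val (pi1 K w) edge_class []"
    using path_val_edge_class[of v "[]" v] v \<gamma>_path is_path_verts by fastforce
  finally show ?thesis
    by simp
qed

end

lemma (in serre_complex) rooted_by_reachability:
  assumes "w \<in> verts K"
  defines "S \<equiv> {v. \<exists>p. is_path K w p v}"
  shows "\<exists>\<gamma>. rooted_complex K S w \<gamma>"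
proof
  define \<gamma> where "\<gamma> v = (if v = w then [] else SOME p. is_path K w p v)" for v
  show "rooted_complex K S w \<gamma>"
  proof unfold_locales
    show "w \<in> S"
      using assms by (auto simp: S_def intro: exI[of _ "[]"])
    show "tgt K e \<in> S" if e: "e \<in> edges K" "src K e \<in> S" for e
    proof -
      obtain p where "is_path K w p (src K e)"
        using e by (auto simp: S_def)
      then have "is_path K w (p @ [e]) (tgt K e)"
        using e by (auto simp: is_path_append tgt_verts)
      then show ?thesis
        by (auto simp: S_def)
    qed
    show "is_path K w (\<gamma> u) u" if "u \<in> S" for u
      using that assms by (auto simp: \<gamma>_def S_def intro: someI_ex)
  qed (simp add: \<gamma>_def)
qed

subsection \<open>Maps of complexes\<close>

locale complex_map = serre_complex K
  for K :: "('v, 'e) complex2" and K' :: "('w, 'd) complex2" and fv :: "'v \<Rightarrow> 'w"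
    and fe :: "'e \<Rightarrow> 'd" +
  assumes map_verts: "v \<in> verts K \<Longrightarrow> fv v \<in> verts K'"
    and map_edges: "e \<in> edges K \<Longrightarrow> fe e \<in> edges K'"
    and map_src: "e \<in> edges K \<Longrightarrow> src K' (fe e) = fv (src K e)"
    and map_tgt: "e \<in> edges K \<Longrightarrow> tgt K' (fe e) = fv (tgt K e)"
    and map_opp: "e \<in> edges K \<Longrightarrow> opp K' (fe e) = fe (opp K e)"
    and map_cells: "c \<in> cells K \<Longrightarrow> map fe c \<in> cells K'"
begin

lemma map_is_path: "is_path K u p v \<Longrightarrow> is_path K' (fv u) (map fe p) (fv v)"
  by (induction p arbitrary: u) (auto simp: map_verts map_edges map_src map_tgt)

lemma map_homotopic:
  assumes "homotopic u v p q"
  shows "equivclp (homotopy_step K' (fv u) (fv v)) (map fe p) (map fe q)"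
  using assms
proof (induction rule: equivclp_induct)
  case (step y z)
  have "homotopy_step K' (fv u) (fv v) (map fe p) (map fe q)" if "homotopy_step K u v p q" for p q
    using that
  proof (induction rule: homotopy_step.induct)
    case (cancel p e q)
    then have "e \<in> edges K"
      by (auto simp: is_path_append)
    then show ?case
      using map_is_path[OF cancel] homotopy_step.cancel[of K' "fv u" "map fe p" "fe e" "map fe q"]
      by (simp add: map_opp)
  next
    case (cell p c q)
    then show ?case
      using map_is_path[OF cell(1)] homotopy_step.cell[of K' "fv u" "map fe p" "map fe c" "map fe q"]
      by (simp add: map_cells)
  qed
  then show ?case
    using step by (metis equivclp_into_equivclp)
qed simp

end

lemma path_val_map: "path_val L f (map g p) = path_val L (\<lambda>e. f (g e)) p"
  by (induction p) auto

lemma labelling_pullback: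
  assumes "complex_map K K' fv fe" "labelling K' L S' f"
    and S: "fv ` S \<subseteq> S'" "\<And>e. e \<in> edges K \<Longrightarrow> src K e \<in> S \<Longrightarrow> tgt K e \<in> S"
  shows "labelling K L S (\<lambda>e. f (fe e))"
proof -
  interpret complex_map K K' fv fe by fact
  interpret L: labelling K' L S' f by fact
  show ?thesis
  proof unfold_locales
    fix e assume e: "e \<in> edges K" "src K e \<in> S"
    show "tgt K e \<in> S"
      using S e by blast
    have e': "fe e \<in> edges K'" "src K' (fe e) \<in> S'"
      using e S map_edges map_src by auto
    show "f (fe e) \<in> carrier L"
      using L.f_carrier[OF e'] .
    show "f (fe e) \<otimes>\<^bsub>L\<^esub> f (fe (opp K e)) = \<one>\<^bsub>L\<^esub>"
      using L.f_opp[OF e'] map_opp e by simp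
  next
    fix c u assume c: "c \<in> cells K" "is_path K u c u" "u \<in> S"
    have "path_val L f (map fe c) = \<one>\<^bsub>L\<^esub>"
      using c S by (intro L.f_cell[OF map_cells map_is_path]) auto
    then show "path_val L (\<lambda>e. f (fe e)) c = \<one>\<^bsub>L\<^esub>"
      by (simp add: path_val_map)
  qed
qed

lemma labelling_hom:
  assumes "labelling K L S f" "group M" "\<kappa> \<in> hom L M"
  shows "labelling K M S (\<lambda>e. \<kappa> (f e))"
    and "\<And>u P v. is_path K u P v \<Longrightarrow> u \<in> S \<Longrightarrow> path_val M (\<lambda>e. \<kappa> (f e)) P = \<kappa> (path_val L f P)"
proof -
  interpret L: labelling K L S f by fact
  interpret M: group M by fact
  interpret \<kappa>: group_hom L M \<kappa>
    using assms(3) by unfold_locales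
  show val: "path_val M (\<lambda>e. \<kappa> (f e)) P = \<kappa> (path_val L f P)" if "is_path K u P v" "u \<in> S" for u P v
    using that
    by (induction P arbitrary: u) (auto simp: L.S_closed L.f_carrier L.val_carrier)
  show "labelling K M S (\<lambda>e. \<kappa> (f e))"
  proof unfold_locales
    fix e assume e: "e \<in> edges K" "src K e \<in> S"
    then show "tgt K e \<in> S" "\<kappa> (f e) \<in> carrier M"
      by (auto simp: L.S_closed L.f_carrier)
    have "opp K e \<in> edges K" "src K (opp K e) \<in> S"
      using e by (auto simp: L.opp_edge L.src_opp L.S_closed)
    then show "\<kappa> (f e) \<otimes>\<^bsub>M\<^esub> \<kappa> (f (opp K e)) = \<one>\<^bsub>M\<^esub>"
      using e L.f_opp[of e] by (simp add: L.f_carrier flip: \<kappa>.hom_mult)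
  next
    fix c u assume "c \<in> cells K" "is_path K u c u" "u \<in> S"
    then show "path_val M (\<lambda>e. \<kappa> (f e)) c = \<one>\<^bsub>M\<^esub>"
      using val L.f_cell by simp
  qed
qed

text \<open>As the inverse of \<open>fe\<close> is a map of complexes as well, \<open>fe\<close> carries a homotopy class of loops onto a full
homotopy class. So taking images of classes is already the isomorphism.\<close>
lemma pi1_iso:
  assumes "complex_map K K' fv fe" "complex_map K' K gv ge"
    and inv: "\<And>e. e \<in> edges K \<Longrightarrow> ge (fe e) = e" "\<And>e. e \<in> edges K' \<Longrightarrow> fe (ge e) = e"
    and w: "w \<in> verts K" "gv (fv w) = w"
  shows "pi1 K w \<cong> pi1 K' (fv w)"
proof -
  interpret f: complex_map K K' fv fe by fact
  interpret g: complex_map K' K gv ge by fact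
  let ?h = "\<lambda>A. map fe ` A"
  have gf: "map ge (map fe p) = p" if "is_path K u p v" for u p v
    using that by (induction p arbitrary: u) (auto simp: inv)
  have fg: "map fe (map ge p) = p" if "is_path K' u p v" for u p v
    using that by (induction p arbitrary: u) (auto simp: inv)
  have cls: "?h (f.cls w p) = g.cls (fv w) (map fe p)" if p: "is_path K w p w" for p
  proof (intro equalityI subsetI)
    fix q assume "q \<in> g.cls (fv w) (map fe p)"
    then have q: "g.homotopic (fv w) (fv w) (map fe p) q"
      by (simp add: g.in_cls)
    with p have "is_path K' (fv w) q (fv w)"
      using f.map_is_path g.homotopic_is_path by blast
    then have "q = map fe (map ge q)"
      by (simp add: fg del: map_map)
    moreover have "f.homotopic w w p (map ge q)"
      using g.map_homotopic[OF q] w gf[OF p] by simp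
    ultimately show "q \<in> ?h (f.cls w p)"
      by (auto simp: f.in_cls simp del: map_map)
  qed (auto simp: f.in_cls g.in_cls intro: f.map_homotopic)
  have "?h \<in> hom (pi1 K w) (pi1 K' (fv w))"
  proof (rule homI)
    fix A B assume "A \<in> carrier (pi1 K w)" "B \<in> carrier (pi1 K w)"
    then obtain p q where p: "is_path K w p w" "A = f.cls w p" "is_path K w q w" "B = f.cls w q"
      by (auto simp: f.carrier_pi1)
    then show "?h A \<in> carrier (pi1 K' (fv w))"
      by (simp add: cls g.cls_in_carrier f.map_is_path)
    have "is_path K w (p @ q) w"
      using p by (auto simp: f.is_path_append)
    then show "?h (A \<otimes>\<^bsub>pi1 K w\<^esub> B) = ?h A \<otimes>\<^bsub>pi1 K' (fv w)\<^esub> ?h B"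
      using p by (simp add: cls f.cls_mult g.cls_mult f.map_is_path)
  qed
  moreover have "inj_on ?h (carrier (pi1 K w))"
  proof (rule inj_on_inverseI)
    fix A assume "A \<in> carrier (pi1 K w)"
    then obtain p where p: "is_path K w p w" "A = f.cls w p"
      by (auto simp: f.carrier_pi1)
    have "map ge (map fe q) = q" if "q \<in> A" for q
      using that p f.homotopic_is_path by (intro gf[of w _ w]) (auto simp: f.in_cls)
    then show "map ge ` map fe ` A = A"
      by (force simp: image_iff)
  qed
  moreover have "carrier (pi1 K' (fv w)) \<subseteq> ?h ` carrier (pi1 K w)"
  proof
    fix B assume "B \<in> carrier (pi1 K' (fv w))"
    then obtain q where q: "is_path K' (fv w) q (fv w)" "B = g.cls (fv w) q"
      by (auto simp: g.carrier_pi1)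
    then have "is_path K w (map ge q) w"
      using g.map_is_path[OF q(1)] w by simp
    then show "B \<in> ?h ` carrier (pi1 K w)"
      using cls[of "map ge q"] fg[OF q(1)] q by (intro image_eqI[OF _ f.cls_in_carrier]) simp_all
  qed
  ultimately show ?thesis
    by (auto simp: is_iso_def iso_def bij_betw_def dest: hom_carrier)
qed

section \<open>Squier complexes\<close>

lemma semigroup_presentationD:
  assumes "semigroup_presentation \<Sigma> R" "(u, v) \<in> R \<or> (v, u) \<in> R"
  shows "u \<in> lists \<Sigma>" "v \<in> lists \<Sigma>" "u \<noteq> []" "v \<noteq> []"
  using assms unfolding semigroup_presentation_def by fast+

lemma squier_complex_simps [simp]:
  "verts (squier_complex \<Sigma> R) = lists \<Sigma> - {[]}"
  "(p, u, v, q) \<in> edges (squier_complex \<Sigma> R) \<longleftrightarrow>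
    p \<in> lists \<Sigma> \<and> q \<in> lists \<Sigma> \<and> ((u, v) \<in> R \<or> (v, u) \<in> R)"
  "src (squier_complex \<Sigma> R) (p, u, v, q) = p @ u @ q"
  "tgt (squier_complex \<Sigma> R) (p, u, v, q) = p @ v @ q"
  "opp (squier_complex \<Sigma> R) (p, u, v, q) = (p, v, u, q)"
  by (simp_all add: squier_complex_def)

lemma cells_squier_complex:
  "c \<in> cells (squier_complex \<Sigma> R) \<longleftrightarrow> (\<exists>p l1 r1 z l2 r2 q. c = squier_cell p l1 r1 z l2 r2 q \<and>
    p \<in> lists \<Sigma> \<and> z \<in> lists \<Sigma> \<and> q \<in> lists \<Sigma> \<and> (l1, r1) \<in> R \<and> (l2, r2) \<in> R)"
  by (simp add: squier_complex_def)

lemma serre_squier_complex: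
  assumes "semigroup_presentation \<Sigma> R"
  shows "serre_complex (squier_complex \<Sigma> R)"
proof
  note D = semigroup_presentationD[OF assms]
  let ?K = "squier_complex \<Sigma> R"
  fix e assume e: "e \<in> edges ?K"
  obtain p u v q where [simp]: "e = (p, u, v, q)"
    by (cases e)
  show "opp ?K e \<in> edges ?K" "opp ?K (opp ?K e) = e" "src ?K (opp ?K e) = tgt ?K e"
    using e by auto
  show "src ?K e \<in> verts ?K"
    using e D[of u v] by simp
next
  note D = semigroup_presentationD[OF assms]
  let ?K = "squier_complex \<Sigma> R"
  fix c assume "c \<in> cells ?K"
  then obtain p l1 r1 z l2 r2 q where c: "c = squier_cell p l1 r1 z l2 r2 q"
    "p \<in> lists \<Sigma>" "z \<in> lists \<Sigma>" "q \<in> lists \<Sigma>" "(l1, r1) \<in> R" "(l2, r2) \<in> R"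
    unfolding cells_squier_complex by blast
  then have "is_path ?K (p @ l1 @ z @ l2 @ q) c (p @ l1 @ z @ l2 @ q)"
    using D[of l1 r1] D[of l2 r2] by (simp add: squier_cell_def)
  then show "\<exists>u. is_path ?K u c u" ..
qed

text \<open>Whiskering: an edge of the Squier complex with further letters written on both sides.\<close>
definition lift :: "'s list \<Rightarrow> 's list \<Rightarrow> 's squier_edge \<Rightarrow> 's squier_edge" where
  "lift \<alpha> \<beta> = (\<lambda>(p, u, v, q). (\<alpha> @ p, u, v, q @ \<beta>))"

lemma lift_simps [simp]:
  "lift \<alpha> \<beta> (p, u, v, q) = (\<alpha> @ p, u, v, q @ \<beta>)"
  "lift [] [] e = e"
  "lift \<alpha> \<beta> (lift \<alpha>' \<beta>' e) = lift (\<alpha> @ \<alpha>') (\<beta>' @ \<beta>) e"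
  by (simp_all add: lift_def split: prod.split)

text \<open>Rules may be applied in any context, so every homotopy over the smaller presentation can be performed inside a
longer word over the larger one.\<close>
lemma complex_map_lift:
  assumes "semigroup_presentation \<Sigma>1 R1" "\<Sigma>1 \<subseteq> \<Sigma>" "R1 \<subseteq> R" "\<alpha> \<in> lists \<Sigma>" "\<beta> \<in> lists \<Sigma>"
  shows "complex_map (squier_complex \<Sigma>1 R1) (squier_complex \<Sigma> R) (\<lambda>u. \<alpha> @ u @ \<beta>) (lift \<alpha> \<beta>)"
proof -
  interpret serre_complex "squier_complex \<Sigma>1 R1"
    using assms(1) by (rule serre_squier_complex)
  have mono: "u \<in> lists \<Sigma>" if "u \<in> lists \<Sigma>1" for u
    using that assms(2) lists_mono by blast
  show ?thesis
  proof
    fix c assume "c \<in> cells (squier_complex \<Sigma>1 R1)"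
    then obtain p l1 r1 z l2 r2 q where c: "c = squier_cell p l1 r1 z l2 r2 q"
      "p \<in> lists \<Sigma>1" "z \<in> lists \<Sigma>1" "q \<in> lists \<Sigma>1" "(l1, r1) \<in> R1" "(l2, r2) \<in> R1"
      unfolding cells_squier_complex by blast
    have "map (lift \<alpha> \<beta>) c = squier_cell (\<alpha> @ p) l1 r1 z l2 r2 (q @ \<beta>)"
      by (simp add: c squier_cell_def)
    then show "map (lift \<alpha> \<beta>) c \<in> cells (squier_complex \<Sigma> R)"
      unfolding cells_squier_complex using c assms mono by (metis (no_types, lifting) append_in_lists_conv subsetD)
  qed (use assms mono in auto)
qed

lemma (in group) cancel_inv_left:
  "x \<in> carrier G \<Longrightarrow> y \<in> carrier G \<Longrightarrow> x \<otimes> (inv x \<otimes> y) = y"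
  by (simp flip: m_assoc)

lemma (in group) cancel_left_inv:
  "x \<in> carrier G \<Longrightarrow> y \<in> carrier G \<Longrightarrow> inv x \<otimes> (x \<otimes> y) = y"
  by (simp flip: m_assoc)

locale squier_labelling = labelling "squier_complex \<Sigma> R" L S f
  for \<Sigma> :: "'s set" and R L S f +
  assumes presentation: "semigroup_presentation \<Sigma> R"
begin

abbreviation "K \<equiv> squier_complex \<Sigma> R"

lemma map_lift_is_path:
  assumes "is_path K s p s'" "\<alpha> \<in> lists \<Sigma>" "\<beta> \<in> lists \<Sigma>"
  shows "is_path K (\<alpha> @ s @ \<beta>) (map (lift \<alpha> \<beta>) p) (\<alpha> @ s' @ \<beta>)"
  using complex_map.map_is_path[OF complex_map_lift assms(1)] assms presentation by blast

lemma square_corners: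
  assumes "(l1, r1) \<in> R \<or> (r1, l1) \<in> R" "(l2, r2) \<in> R \<or> (r2, l2) \<in> R"
    and "p \<in> lists \<Sigma>" "z \<in> lists \<Sigma>" "q \<in> lists \<Sigma>" and S: "p @ l1 @ z @ l2 @ q \<in> S"
  shows "p @ r1 @ z @ l2 @ q \<in> S" "p @ l1 @ z @ r2 @ q \<in> S"
    "f (p, l1, r1, z @ l2 @ q) \<in> carrier L" "f (p @ r1 @ z, l2, r2, q) \<in> carrier L"
    "f (p @ l1 @ z, l2, r2, q) \<in> carrier L" "f (p, l1, r1, z @ r2 @ q) \<in> carrier L"
    "f (p, r1, l1, z @ l2 @ q) = inv\<^bsub>L\<^esub> f (p, l1, r1, z @ l2 @ q)"
    "f (p @ r1 @ z, r2, l2, q) = inv\<^bsub>L\<^esub> f (p @ r1 @ z, l2, r2, q)"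
    "f (p @ l1 @ z, r2, l2, q) = inv\<^bsub>L\<^esub> f (p @ l1 @ z, l2, r2, q)"
    "f (p, r1, l1, z @ r2 @ q) = inv\<^bsub>L\<^esub> f (p, l1, r1, z @ r2 @ q)"
proof -
  note D = semigroup_presentationD[OF presentation, of l1 r1] semigroup_presentationD[OF presentation, of l2 r2]
  let ?a = "(p, l1, r1, z @ l2 @ q)" and ?b = "(p @ r1 @ z, l2, r2, q)"
  let ?c = "(p @ l1 @ z, l2, r2, q)" and ?d = "(p, l1, r1, z @ r2 @ q)"
  have e: "?a \<in> edges K" "?b \<in> edges K" "?c \<in> edges K" "?d \<in> edges K"
    using assms D by auto
  have s: "src K ?a \<in> S" "src K ?c \<in> S"
    using S by simp_all
  then have s': "src K ?b \<in> S" "src K ?d \<in> S"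
    using S_closed[OF e(1) s(1)] S_closed[OF e(3) s(2)] by simp_all
  then show "p @ r1 @ z @ l2 @ q \<in> S" "p @ l1 @ z @ r2 @ q \<in> S"
    by simp_all
  show "f ?a \<in> carrier L" "f ?b \<in> carrier L" "f ?c \<in> carrier L" "f ?d \<in> carrier L"
    "f (p, r1, l1, z @ l2 @ q) = inv\<^bsub>L\<^esub> f ?a" "f (p @ r1 @ z, r2, l2, q) = inv\<^bsub>L\<^esub> f ?b"
    "f (p @ l1 @ z, r2, l2, q) = inv\<^bsub>L\<^esub> f ?c" "f (p, r1, l1, z @ r2 @ q) = inv\<^bsub>L\<^esub> f ?d"
    using f_carrier[OF e(1) s(1)] f_carrier[OF e(2) s'(1)] f_carrier[OF e(3) s(2)] f_carrier[OF e(4) s'(2)]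
      f_opp_inv[OF e(1) s(1)] f_opp_inv[OF e(2) s'(1)] f_opp_inv[OF e(3) s(2)] f_opp_inv[OF e(4) s'(2)]
    by simp_all
qed

text \<open>The boundary of a 2-cell, read as an equation: rewriting in two disjoint places commutes. There are
cells only for pairs of rules that are both read from left to right. The next two lemmas remove this
restriction by passing to inverses.\<close>
lemma edge_square_oriented:
  assumes R: "(l1, r1) \<in> R" "(l2, r2) \<in> R" and pzq: "p \<in> lists \<Sigma>" "z \<in> lists \<Sigma>" "q \<in> lists \<Sigma>"
    and S: "p @ l1 @ z @ l2 @ q \<in> S"
  shows "f (p, l1, r1, z @ l2 @ q) \<otimes>\<^bsub>L\<^esub> f (p @ r1 @ z, l2, r2, q)
    = f (p @ l1 @ z, l2, r2, q) \<otimes>\<^bsub>L\<^esub> f (p, l1, r1, z @ r2 @ q)"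
    (is "?A \<otimes>\<^bsub>L\<^esub> ?B = ?C \<otimes>\<^bsub>L\<^esub> ?D")
proof -
  note corners = square_corners[OF disjI1[OF R(1)] disjI1[OF R(2)] pzq S]
  have "squier_cell p l1 r1 z l2 r2 q \<in> cells K"
    unfolding cells_squier_complex using R pzq by blast
  moreover have "is_path K (p @ l1 @ z @ l2 @ q) (squier_cell p l1 r1 z l2 r2 q) (p @ l1 @ z @ l2 @ q)"
    using R pzq semigroup_presentationD[OF presentation, of l1 r1]
      semigroup_presentationD[OF presentation, of l2 r2] by (simp add: squier_cell_def)
  ultimately have "path_val L f (squier_cell p l1 r1 z l2 r2 q) = \<one>\<^bsub>L\<^esub>"
    using S by (rule f_cell)
  then have "(?A \<otimes>\<^bsub>L\<^esub> ?B) \<otimes>\<^bsub>L\<^esub> inv\<^bsub>L\<^esub> (?C \<otimes>\<^bsub>L\<^esub> ?D) = \<one>\<^bsub>L\<^esub>"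
    using corners by (simp add: squier_cell_def L.inv_mult_group L.m_assoc)
  then show ?thesis
    using corners L.inv_equality[of "?A \<otimes>\<^bsub>L\<^esub> ?B" "inv\<^bsub>L\<^esub> (?C \<otimes>\<^bsub>L\<^esub> ?D)"] by simp
qed

lemma edge_square_half:
  assumes "(l1, r1) \<in> R" "(l2, r2) \<in> R \<or> (r2, l2) \<in> R" and pzq: "p \<in> lists \<Sigma>" "z \<in> lists \<Sigma>" "q \<in> lists \<Sigma>"
    and S: "p @ l1 @ z @ l2 @ q \<in> S"
  shows "f (p, l1, r1, z @ l2 @ q) \<otimes>\<^bsub>L\<^esub> f (p @ r1 @ z, l2, r2, q)
    = f (p @ l1 @ z, l2, r2, q) \<otimes>\<^bsub>L\<^esub> f (p, l1, r1, z @ r2 @ q)"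
    (is "?A \<otimes>\<^bsub>L\<^esub> ?B = ?C \<otimes>\<^bsub>L\<^esub> ?D")
  using assms(2)
proof
  assume R: "(r2, l2) \<in> R"
  note corners = square_corners[OF disjI1[OF assms(1)] assms(2) pzq S]
  have "?D \<otimes>\<^bsub>L\<^esub> f (p @ r1 @ z, r2, l2, q) = f (p @ l1 @ z, r2, l2, q) \<otimes>\<^bsub>L\<^esub> ?A"
    using pzq corners by (intro edge_square_oriented[OF assms(1) R])
  then have "?C \<otimes>\<^bsub>L\<^esub> (?D \<otimes>\<^bsub>L\<^esub> inv\<^bsub>L\<^esub> ?B) \<otimes>\<^bsub>L\<^esub> ?B = ?C \<otimes>\<^bsub>L\<^esub> (inv\<^bsub>L\<^esub> ?C \<otimes>\<^bsub>L\<^esub> ?A) \<otimes>\<^bsub>L\<^esub> ?B"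
    using corners by simp
  then show ?thesis
    using corners by (simp add: L.m_assoc L.cancel_inv_left)
qed (use assms edge_square_oriented in blast)

lemma edge_square:
  assumes "(l1, r1) \<in> R \<or> (r1, l1) \<in> R" "(l2, r2) \<in> R \<or> (r2, l2) \<in> R"
    and pzq: "p \<in> lists \<Sigma>" "z \<in> lists \<Sigma>" "q \<in> lists \<Sigma>" and S: "p @ l1 @ z @ l2 @ q \<in> S"
  shows "f (p, l1, r1, z @ l2 @ q) \<otimes>\<^bsub>L\<^esub> f (p @ r1 @ z, l2, r2, q)
    = f (p @ l1 @ z, l2, r2, q) \<otimes>\<^bsub>L\<^esub> f (p, l1, r1, z @ r2 @ q)"
    (is "?A \<otimes>\<^bsub>L\<^esub> ?B = ?C \<otimes>\<^bsub>L\<^esub> ?D")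
  using assms(1)
proof
  assume R: "(r1, l1) \<in> R"
  note corners = square_corners[OF assms]
  have "f (p, r1, l1, z @ l2 @ q) \<otimes>\<^bsub>L\<^esub> ?C = ?B \<otimes>\<^bsub>L\<^esub> f (p, r1, l1, z @ r2 @ q)"
    using assms(2) pzq corners by (intro edge_square_half[OF R])
  then have "?A \<otimes>\<^bsub>L\<^esub> (inv\<^bsub>L\<^esub> ?A \<otimes>\<^bsub>L\<^esub> ?C) \<otimes>\<^bsub>L\<^esub> ?D = ?A \<otimes>\<^bsub>L\<^esub> (?B \<otimes>\<^bsub>L\<^esub> inv\<^bsub>L\<^esub> ?D) \<otimes>\<^bsub>L\<^esub> ?D"
    using corners by simp
  then show ?thesis
    using corners by (simp add: L.m_assoc L.cancel_inv_left)
qed (use assms edge_square_half in blast)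

lemma path_square_edge:
  assumes "is_path K r Q r'" "(l, l') \<in> R \<or> (l', l) \<in> R" "p \<in> lists \<Sigma>" "z \<in> lists \<Sigma>" "\<beta> \<in> lists \<Sigma>"
    and "p @ l @ z @ r @ \<beta> \<in> S"
  shows "f (p, l, l', z @ r @ \<beta>) \<otimes>\<^bsub>L\<^esub> val (map (lift (p @ l' @ z) \<beta>) Q)
    = val (map (lift (p @ l @ z) \<beta>) Q) \<otimes>\<^bsub>L\<^esub> f (p, l, l', z @ r' @ \<beta>)"
  using assms(1,6)
proof (induction Q arbitrary: r)
  case Nil
  have "(p, l, l', z @ r @ \<beta>) \<in> edges K" "src K (p, l, l', z @ r @ \<beta>) \<in> S"
    using assms(2-5) Nil by auto
  from f_carrier[OF this] show ?case
    using Nil by simp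
next
  case (Cons e Q)
  obtain p2 l2 r2 q2 where e: "e = (p2, l2, r2, q2)"
    by (cases e)
  let ?r2 = "p2 @ r2 @ q2"
  have r: "r = p2 @ l2 @ q2" and l2: "(l2, r2) \<in> R \<or> (r2, l2) \<in> R" "p2 \<in> lists \<Sigma>" "q2 \<in> lists \<Sigma>"
    and Q: "is_path K ?r2 Q r'"
    using Cons.prems e by auto
  note D = semigroup_presentationD[OF presentation, of l l'] semigroup_presentationD[OF presentation, of l2 r2]
  let ?A = "f (p, l, l', z @ p2 @ l2 @ q2 @ \<beta>)" and ?B = "f (p @ l' @ z @ p2, l2, r2, q2 @ \<beta>)"
  let ?C = "f (p @ l @ z @ p2, l2, r2, q2 @ \<beta>)" and ?D = "f (p, l, l', z @ p2 @ r2 @ q2 @ \<beta>)"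
  let ?V = "val (map (lift (p @ l' @ z) \<beta>) Q)" and ?W = "val (map (lift (p @ l @ z) \<beta>) Q)"
  let ?E = "f (p, l, l', z @ r' @ \<beta>)"
  have S0: "p @ l @ z @ p2 @ l2 @ q2 @ \<beta> \<in> S"
    using Cons.prems r by simp
  have e1: "(p, l, l', z @ p2 @ l2 @ q2 @ \<beta>) \<in> edges K"
    and e3: "(p @ l @ z @ p2, l2, r2, q2 @ \<beta>) \<in> edges K"
    and e2: "(p @ l' @ z @ p2, l2, r2, q2 @ \<beta>) \<in> edges K"
    and e4: "(p, l, l', z @ p2 @ r2 @ q2 @ \<beta>) \<in> edges K"
    using assms(2-5) l2 D by auto
  have S1: "p @ l' @ z @ p2 @ l2 @ q2 @ \<beta> \<in> S" "p @ l @ z @ p2 @ r2 @ q2 @ \<beta> \<in> S"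
    using S_closed[OF e1] S_closed[OF e3] S0 by simp_all
  then have S2: "p @ l' @ z @ p2 @ r2 @ q2 @ \<beta> \<in> S"
    using S_closed[OF e4] by simp
  have car: "?A \<in> carrier L" "?B \<in> carrier L" "?C \<in> carrier L" "?D \<in> carrier L"
    using f_carrier[OF e1] f_carrier[OF e2] f_carrier[OF e3] f_carrier[OF e4] S0 S1 by simp_all
  have pV: "is_path K ((p @ l' @ z) @ ?r2 @ \<beta>) (map (lift (p @ l' @ z) \<beta>) Q) ((p @ l' @ z) @ r' @ \<beta>)"
    using assms D by (intro map_lift_is_path[OF Q]) auto
  have pW: "is_path K ((p @ l @ z) @ ?r2 @ \<beta>) (map (lift (p @ l @ z) \<beta>) Q) ((p @ l @ z) @ r' @ \<beta>)"
    using assms D by (intro map_lift_is_path[OF Q]) auto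
  have V: "?V \<in> carrier L" and W: "?W \<in> carrier L"
    using val_carrier[OF pV] val_carrier[OF pW] S1 S2 by simp_all
  have "(p, l, l', z @ r' @ \<beta>) \<in> edges K"
    using assms D is_path_verts[OF Q] by auto
  moreover have "src K (p, l, l', z @ r' @ \<beta>) \<in> S"
    using path_in_S[OF pW] S1 by simp
  ultimately have E: "?E \<in> carrier L"
    by (rule f_carrier)
  have sq: "?A \<otimes>\<^bsub>L\<^esub> ?B = ?C \<otimes>\<^bsub>L\<^esub> ?D"
    using edge_square[of l l' l2 r2 p "z @ p2" "q2 @ \<beta>"] assms(2-5) l2 S0 by simp
  have IH: "?D \<otimes>\<^bsub>L\<^esub> ?V = ?W \<otimes>\<^bsub>L\<^esub> ?E"
    using Cons.IH[OF Q] S1 by simp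
  have "?A \<otimes>\<^bsub>L\<^esub> (?B \<otimes>\<^bsub>L\<^esub> ?V) = ?C \<otimes>\<^bsub>L\<^esub> (?D \<otimes>\<^bsub>L\<^esub> ?V)"
    using sq car V by (simp flip: L.m_assoc)
  also have "\<dots> = ?C \<otimes>\<^bsub>L\<^esub> ?W \<otimes>\<^bsub>L\<^esub> ?E"
    using IH car W E by (simp add: L.m_assoc)
  finally show ?case
    by (simp add: e r)
qed

text \<open>The interchange law: \<open>P\<close> and \<open>Q\<close> rewrite disjoint parts of a word, so the square that they span is
filled with 2-cells. By induction on both paths it follows from the law for single edges.\<close>
lemma path_square:
  assumes "is_path K s P s'" "is_path K r Q r'" "\<alpha> \<in> lists \<Sigma>" "\<beta> \<in> lists \<Sigma>"
    and "\<alpha> @ s @ r @ \<beta> \<in> S"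
  shows "val (map (lift \<alpha> (r @ \<beta>)) P) \<otimes>\<^bsub>L\<^esub> val (map (lift (\<alpha> @ s') \<beta>) Q)
    = val (map (lift (\<alpha> @ s) \<beta>) Q) \<otimes>\<^bsub>L\<^esub> val (map (lift \<alpha> (r' @ \<beta>)) P)"
  using assms(1,5)
proof (induction P arbitrary: s)
  case Nil
  have "is_path K ((\<alpha> @ s) @ r @ \<beta>) (map (lift (\<alpha> @ s) \<beta>) Q) ((\<alpha> @ s) @ r' @ \<beta>)"
    using assms Nil by (intro map_lift_is_path[OF assms(2)]) auto
  from val_carrier[OF this] show ?case
    using Nil by simp
next
  case (Cons e P)
  obtain p l l' q where e: "e = (p, l, l', q)"
    by (cases e)
  let ?s1 = "p @ l' @ q"
  have s: "s = p @ l @ q" and l: "(l, l') \<in> R \<or> (l', l) \<in> R" "p \<in> lists \<Sigma>" "q \<in> lists \<Sigma>"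
    and P: "is_path K ?s1 P s'"
    using Cons.prems e by auto
  note D = semigroup_presentationD[OF presentation, of l l'] is_path_verts[OF assms(2)] is_path_verts[OF P]
  have S0: "\<alpha> @ p @ l @ q @ r @ \<beta> \<in> S"
    using Cons.prems s by simp
  have e1: "(\<alpha> @ p, l, l', q @ r @ \<beta>) \<in> edges K" "(\<alpha> @ p, l, l', q @ r' @ \<beta>) \<in> edges K"
    using l D assms by auto
  have S1: "\<alpha> @ ?s1 @ r @ \<beta> \<in> S"
    using S_closed[OF e1(1)] S0 by simp
  let ?A = "f (\<alpha> @ p, l, l', q @ r @ \<beta>)" and ?D = "f (\<alpha> @ p, l, l', q @ r' @ \<beta>)"
  let ?Q0 = "val (map (lift (\<alpha> @ s) \<beta>) Q)" and ?Q1 = "val (map (lift (\<alpha> @ ?s1) \<beta>) Q)"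
  let ?Q2 = "val (map (lift (\<alpha> @ s') \<beta>) Q)"
  let ?P = "val (map (lift \<alpha> (r @ \<beta>)) P)" and ?P' = "val (map (lift \<alpha> (r' @ \<beta>)) P)"
  have p0: "is_path K ((\<alpha> @ s) @ r @ \<beta>) (map (lift (\<alpha> @ s) \<beta>) Q) ((\<alpha> @ s) @ r' @ \<beta>)"
    and p1: "is_path K ((\<alpha> @ ?s1) @ r @ \<beta>) (map (lift (\<alpha> @ ?s1) \<beta>) Q) ((\<alpha> @ ?s1) @ r' @ \<beta>)"
    and p2: "is_path K ((\<alpha> @ s') @ r @ \<beta>) (map (lift (\<alpha> @ s') \<beta>) Q) ((\<alpha> @ s') @ r' @ \<beta>)"
    by (rule map_lift_is_path[OF assms(2)]; use assms D l s in simp)+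
  have pP: "is_path K (\<alpha> @ ?s1 @ r @ \<beta>) (map (lift \<alpha> (r @ \<beta>)) P) (\<alpha> @ s' @ r @ \<beta>)"
    and pP': "is_path K (\<alpha> @ ?s1 @ r' @ \<beta>) (map (lift \<alpha> (r' @ \<beta>)) P) (\<alpha> @ s' @ r' @ \<beta>)"
    by (rule map_lift_is_path[OF P]; use assms D l s in simp)+
  have Sr: "\<alpha> @ s @ r' @ \<beta> \<in> S" "\<alpha> @ ?s1 @ r' @ \<beta> \<in> S" "\<alpha> @ s' @ r @ \<beta> \<in> S"
    using path_in_S[OF p0] path_in_S[OF p1] path_in_S[OF pP] S0 S1 s by simp_all
  have car: "?A \<in> carrier L" "?D \<in> carrier L" "?Q0 \<in> carrier L" "?Q1 \<in> carrier L" "?Q2 \<in> carrier L"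
    "?P \<in> carrier L" "?P' \<in> carrier L"
    using f_carrier[OF e1(1)] f_carrier[OF e1(2)] val_carrier[OF p0] val_carrier[OF p1]
      val_carrier[OF p2] val_carrier[OF pP] val_carrier[OF pP'] S0 S1 Sr s by simp_all
  have sq: "?A \<otimes>\<^bsub>L\<^esub> ?Q1 = ?Q0 \<otimes>\<^bsub>L\<^esub> ?D"
    using path_square_edge[OF assms(2) l(1), of "\<alpha> @ p" q \<beta>] l assms s S0 by simp
  have IH: "?P \<otimes>\<^bsub>L\<^esub> ?Q2 = ?Q1 \<otimes>\<^bsub>L\<^esub> ?P'"
    using Cons.IH[OF P] S1 by simp
  have "?A \<otimes>\<^bsub>L\<^esub> ?P \<otimes>\<^bsub>L\<^esub> ?Q2 = ?A \<otimes>\<^bsub>L\<^esub> ?Q1 \<otimes>\<^bsub>L\<^esub> ?P'"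
    using IH car by (simp add: L.m_assoc)
  also have "\<dots> = ?Q0 \<otimes>\<^bsub>L\<^esub> (?D \<otimes>\<^bsub>L\<^esub> ?P')"
    using sq car by (simp add: L.m_assoc)
  finally show ?case
    by (simp add: e)
qed

text \<open>If moving \<open>Q\<close> is trivial in both contexts, then the value of \<open>P\<close> does not notice that \<open>Q\<close> has been
performed to its right. This is the tool for changing the context of an edge.\<close>
lemma square_trivial_right:
  assumes P: "is_path K s P s'" and Q: "is_path K r Q r'" and "\<alpha> \<in> lists \<Sigma>" "\<beta> \<in> lists \<Sigma>"
    and S: "\<alpha> @ s @ r @ \<beta> \<in> S"
    and triv: "val (map (lift (\<alpha> @ s) \<beta>) Q) = \<one>\<^bsub>L\<^esub>" "val (map (lift (\<alpha> @ s') \<beta>) Q) = \<one>\<^bsub>L\<^esub>"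
  shows "val (map (lift \<alpha> (r' @ \<beta>)) P) = val (map (lift \<alpha> (r @ \<beta>)) P)"
proof -
  have v: "r \<in> lists \<Sigma>" "r' \<in> lists \<Sigma>" "s \<in> lists \<Sigma>"
    using is_path_verts[OF Q] is_path_verts[OF P] by auto
  have 1: "is_path K (\<alpha> @ s @ r @ \<beta>) (map (lift \<alpha> (r @ \<beta>)) P) (\<alpha> @ s' @ r @ \<beta>)"
    and 2: "is_path K (\<alpha> @ s @ r' @ \<beta>) (map (lift \<alpha> (r' @ \<beta>)) P) (\<alpha> @ s' @ r' @ \<beta>)"
    by (rule map_lift_is_path[OF P]; use assms v in simp)+
  have 3: "is_path K ((\<alpha> @ s) @ r @ \<beta>) (map (lift (\<alpha> @ s) \<beta>) Q) ((\<alpha> @ s) @ r' @ \<beta>)"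
    by (rule map_lift_is_path[OF Q]; use assms v in simp)
  have "\<alpha> @ s @ r' @ \<beta> \<in> S"
    using path_in_S[OF 3] S by simp
  then show ?thesis
    using path_square[OF P Q assms(3,4) S] val_carrier[OF 1 S] val_carrier[OF 2] by (simp add: triv)
qed

lemma square_trivial_left:
  assumes P: "is_path K s P s'" and Q: "is_path K r Q r'" and "\<alpha> \<in> lists \<Sigma>" "\<beta> \<in> lists \<Sigma>"
    and S: "\<alpha> @ s @ r @ \<beta> \<in> S"
    and triv: "val (map (lift \<alpha> (r @ \<beta>)) P) = \<one>\<^bsub>L\<^esub>" "val (map (lift \<alpha> (r' @ \<beta>)) P) = \<one>\<^bsub>L\<^esub>"
  shows "val (map (lift (\<alpha> @ s') \<beta>) Q) = val (map (lift (\<alpha> @ s) \<beta>) Q)"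
proof -
  have v: "r \<in> lists \<Sigma>" "s' \<in> lists \<Sigma>" "s \<in> lists \<Sigma>"
    using is_path_verts[OF Q] is_path_verts[OF P] by auto
  have 1: "is_path K (\<alpha> @ s @ r @ \<beta>) (map (lift \<alpha> (r @ \<beta>)) P) (\<alpha> @ s' @ r @ \<beta>)"
    by (rule map_lift_is_path[OF P]; use assms v in simp)
  have 2: "is_path K ((\<alpha> @ s) @ r @ \<beta>) (map (lift (\<alpha> @ s) \<beta>) Q) ((\<alpha> @ s) @ r' @ \<beta>)"
    and 3: "is_path K ((\<alpha> @ s') @ r @ \<beta>) (map (lift (\<alpha> @ s') \<beta>) Q) ((\<alpha> @ s') @ r' @ \<beta>)"
    by (rule map_lift_is_path[OF Q]; use assms v in simp)+
  have "\<alpha> @ s' @ r @ \<beta> \<in> S"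
    using path_in_S[OF 1] S by simp
  then show ?thesis
    using path_square[OF P Q assms(3,4) S] val_carrier[OF 2] val_carrier[OF 3] S by (simp add: triv)
qed

end

section \<open>Free products\<close>

locale free_prod = G: group G + H: group H
  for G :: "('a, 'm) monoid_scheme" and H :: "('b, 'n) monoid_scheme"
begin

definition words :: "('a + 'b) list set" where
  "words = lists (Inl ` carrier G \<union> Inr ` carrier H)"

definition wcls :: "('a + 'b) list \<Rightarrow> ('a + 'b) list set" where
  "wcls w = fp_rel G H `` {w}"

abbreviation fp_equiv :: "('a + 'b) list \<Rightarrow> ('a + 'b) list \<Rightarrow> bool" where
  "fp_equiv \<equiv> equivclp (fp_step G H)"

lemma in_wcls: "v \<in> wcls w \<longleftrightarrow> fp_equiv w v"
  by (simp add: wcls_def fp_rel_def)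

lemma wcls_eq: "wcls v = wcls w \<longleftrightarrow> fp_equiv v w"
proof
  show "fp_equiv v w" if "wcls v = wcls w"
    using that in_wcls[of w w] in_wcls[of w v] by simp
  show "wcls v = wcls w" if "fp_equiv v w"
    using that by (auto simp: in_wcls intro: equivclp_trans[OF equivclp_sym] equivclp_trans)
qed

lemma step_words: "fp_step G H v w \<Longrightarrow> v \<in> words \<longleftrightarrow> w \<in> words"
  by (induction rule: fp_step.induct) (auto simp: words_def)

lemma equiv_words: "fp_equiv v w \<Longrightarrow> v \<in> words \<longleftrightarrow> w \<in> words"
  by (induction rule: equivclp_induct) (auto dest: step_words)

lemma step_context: "fp_step G H v w \<Longrightarrow> fp_step G H (a @ v @ b) (a @ w @ b)"
proof (induction rule: fp_step.induct)
  case (one_left p q)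
  show ?case using fp_step.one_left[of G H "a @ p" "q @ b"] by simp
next
  case (one_right p q)
  show ?case using fp_step.one_right[of G H "a @ p" "q @ b"] by simp
next
  case (mult_left x y p q)
  then show ?case using fp_step.mult_left[of x G y H "a @ p" "q @ b"] by simp
next
  case (mult_right x y p q)
  then show ?case using fp_step.mult_right[of x H y G "a @ p" "q @ b"] by simp
qed

lemma equiv_context: "fp_equiv v w \<Longrightarrow> fp_equiv (a @ v @ b) (a @ w @ b)"
proof (induction rule: equivclp_induct)
  case (step y z)
  then have "fp_step G H (a @ y @ b) (a @ z @ b) \<or> fp_step G H (a @ z @ b) (a @ y @ b)"
    using step_context by blast
  with step.IH show ?case
    by (rule equivclp_into_equivclp)
qed simp

lemma carrier_free_product: "carrier (free_product G H) = wcls ` words"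
  by (auto simp: free_product_def quotient_def wcls_def words_def)

lemma one_free_product: "\<one>\<^bsub>free_product G H\<^esub> = wcls []"
  by (simp add: free_product_def wcls_def)

lemma wcls_mult: "wcls v \<otimes>\<^bsub>free_product G H\<^esub> wcls w = wcls (v @ w)"
proof -
  have *: "wcls (v' @ w') = wcls (v @ w)" if "v' \<in> wcls v" "w' \<in> wcls w" for v' w'
  proof -
    have "fp_equiv (v @ w) (v' @ w)" "fp_equiv (v' @ w) (v' @ w')"
      using equiv_context[of v v' "[]" w] equiv_context[of w w' v' "[]"] that
      by (simp_all add: in_wcls)
    then have "fp_equiv (v' @ w') (v @ w)"
      by (rule equivclp_sym[OF equivclp_trans])
    then show ?thesis
      by (simp only: wcls_eq)
  qed
  have "v \<in> wcls v" "w \<in> wcls w"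
    by (simp_all add: in_wcls)
  moreover have "wcls v \<otimes>\<^bsub>free_product G H\<^esub> wcls w = (\<Union>v'\<in>wcls v. \<Union>w'\<in>wcls w. wcls (v' @ w'))"
    by (simp add: free_product_def flip: wcls_def)
  moreover have "\<dots> = (\<Union>v'\<in>wcls v. \<Union>w'\<in>wcls w. wcls (v @ w))"
    by (intro SUP_cong refl *)
  ultimately show ?thesis
    by auto
qed

lemma group_free_product: "group (free_product G H)"
proof (rule groupI)
  fix x assume "x \<in> carrier (free_product G H)"
  then obtain w where w: "w \<in> words" "x = wcls w"
    by (auto simp: carrier_free_product)
  have "\<exists>v\<in>words. fp_equiv (v @ w) []"
    using w(1)
  proof (induction w)
    case Nil
    then show ?case
      by (intro bexI[of _ "[]"]) (simp_all add: words_def)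
  next
    case (Cons s w)
    then obtain v where v: "v \<in> words" "fp_equiv (v @ w) []"
      by (auto simp: words_def)
    obtain s' where s': "[s'] \<in> words" "fp_equiv [s', s] []"
    proof (cases s)
      case (Inl a)
      with Cons.prems have a: "a \<in> carrier G"
        by (auto simp: words_def)
      have "fp_step G H [Inl (inv\<^bsub>G\<^esub> a), Inl a] [Inl \<one>\<^bsub>G\<^esub>]" "fp_step G H [Inl \<one>\<^bsub>G\<^esub>] []"
        using fp_step.mult_left[of "inv\<^bsub>G\<^esub> a" G a H "[]" "[]"] fp_step.one_left[of G H "[]" "[]"] a
        by simp_all
      then have "fp_equiv [Inl (inv\<^bsub>G\<^esub> a), Inl a] []"
        by (meson equivclp_trans r_into_equivclp)
      with a Inl that[of "Inl (inv\<^bsub>G\<^esub> a)"] show ?thesis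
        by (auto simp: words_def)
    next
      case (Inr a)
      with Cons.prems have a: "a \<in> carrier H"
        by (auto simp: words_def)
      have "fp_step G H [Inr (inv\<^bsub>H\<^esub> a), Inr a] [Inr \<one>\<^bsub>H\<^esub>]" "fp_step G H [Inr \<one>\<^bsub>H\<^esub>] []"
        using fp_step.mult_right[of "inv\<^bsub>H\<^esub> a" H a G "[]" "[]"] fp_step.one_right[of G H "[]" "[]"] a
        by simp_all
      then have "fp_equiv [Inr (inv\<^bsub>H\<^esub> a), Inr a] []"
        by (meson equivclp_trans r_into_equivclp)
      with a Inr that[of "Inr (inv\<^bsub>H\<^esub> a)"] show ?thesis
        by (auto simp: words_def)
    qed
    have "fp_equiv (v @ [s', s] @ w) (v @ [] @ w)"
      using s'(2) by (rule equiv_context)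
    with v(2) have "fp_equiv ((v @ [s']) @ s # w) []"
      by (auto intro: equivclp_trans)
    moreover have "v @ [s'] \<in> words"
      using v s' by (simp add: words_def)
    ultimately show ?case by blast
  qed
  then show "\<exists>y\<in>carrier (free_product G H). y \<otimes>\<^bsub>free_product G H\<^esub> x = \<one>\<^bsub>free_product G H\<^esub>"
    using w by (auto simp: carrier_free_product wcls_mult one_free_product wcls_eq)
next
  have app: "v @ w \<in> words" if "v \<in> words" "w \<in> words" for v w
    using that by (simp add: words_def)
  fix x y assume "x \<in> carrier (free_product G H)" "y \<in> carrier (free_product G H)"
  then show "x \<otimes>\<^bsub>free_product G H\<^esub> y \<in> carrier (free_product G H)"
    by (auto simp: carrier_free_product wcls_mult intro!: imageI app)
next
  show "\<one>\<^bsub>free_product G H\<^esub> \<in> carrier (free_product G H)"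
    by (auto simp: carrier_free_product one_free_product words_def)
qed (auto simp: carrier_free_product one_free_product wcls_mult)

lemma fp_inl_hom: "fp_inl G H \<in> hom G (free_product G H)"
proof (rule homI)
  fix a b assume "a \<in> carrier G" "b \<in> carrier G"
  then have "fp_step G H [Inl a, Inl b] [Inl (a \<otimes>\<^bsub>G\<^esub> b)]"
    using fp_step.mult_left[of a G b H "[]" "[]"] by simp
  then have "fp_equiv [Inl (a \<otimes>\<^bsub>G\<^esub> b)] ([Inl a] @ [Inl b])"
    by (auto intro: equivclp_sym)
  then show "fp_inl G H (a \<otimes>\<^bsub>G\<^esub> b) = fp_inl G H a \<otimes>\<^bsub>free_product G H\<^esub> fp_inl G H b"
    unfolding fp_inl_def wcls_def[symmetric] wcls_mult wcls_eq .
qed (auto simp: fp_inl_def carrier_free_product words_def simp flip: wcls_def)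

lemma fp_inr_hom: "fp_inr G H \<in> hom H (free_product G H)"
proof (rule homI)
  fix a b assume "a \<in> carrier H" "b \<in> carrier H"
  then have "fp_step G H [Inr a, Inr b] [Inr (a \<otimes>\<^bsub>H\<^esub> b)]"
    using fp_step.mult_right[of a H b G "[]" "[]"] by simp
  then have "fp_equiv [Inr (a \<otimes>\<^bsub>H\<^esub> b)] ([Inr a] @ [Inr b])"
    by (auto intro: equivclp_sym)
  then show "fp_inr G H (a \<otimes>\<^bsub>H\<^esub> b) = fp_inr G H a \<otimes>\<^bsub>free_product G H\<^esub> fp_inr G H b"
    unfolding fp_inr_def wcls_def[symmetric] wcls_mult wcls_eq .
qed (auto simp: fp_inr_def carrier_free_product words_def simp flip: wcls_def)

lemma wcls_Cons:
  "wcls (x # w) = (case x of Inl a \<Rightarrow> fp_inl G H a | Inr b \<Rightarrow> fp_inr G H b) \<otimes>\<^bsub>free_product G H\<^esub> wcls w"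
  by (cases x) (simp_all add: fp_inl_def fp_inr_def wcls_mult flip: wcls_def)

text \<open>The universal property. The value of a word is the product of the values of its letters, and the steps
that define the free product do not change it.\<close>
lemma free_product_hom_exists:
  assumes "group L" and f: "f \<in> hom G L" and k: "k \<in> hom H L"
  shows "\<exists>F\<in>hom (free_product G H) L. (\<forall>a\<in>carrier G. F (fp_inl G H a) = f a) \<and>
    (\<forall>b\<in>carrier H. F (fp_inr G H b) = k b)"
proof -
  interpret L: group L by fact
  interpret f: group_hom G L f
    using f by unfold_locales
  interpret k: group_hom H L k
    using k by unfold_locales
  let ?v = "path_val L (case_sum f k)"
  have car: "?v w \<in> carrier L" if "w \<in> words" for w
    using that by (induction w) (auto simp: words_def)
  have app: "?v (v @ w) = ?v v \<otimes>\<^bsub>L\<^esub> ?v w" if "v \<in> words" "w \<in> words" for v w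
    using that
  proof (induction v)
    case (Cons x v)
    then show ?case
      using car[of v] car[of w] by (auto simp: words_def L.m_assoc)
  qed (auto simp: car)
  have val_step: "?v v = ?v w" if "fp_step G H v w" "v \<in> words" for v w
    using that
  proof (induction rule: fp_step.induct)
    case (one_left p q)
    then have "p \<in> words" "q \<in> words" "[Inl \<one>\<^bsub>G\<^esub>] \<in> words"
      by (simp_all add: words_def)
    then show ?case
      using app[of p "[Inl \<one>\<^bsub>G\<^esub>] @ q"] app[of p q] car[of q] by (simp add: words_def)
  next
    case (one_right p q)
    then have "p \<in> words" "q \<in> words" "[Inr \<one>\<^bsub>H\<^esub>] \<in> words"
      by (simp_all add: words_def)
    then show ?case
      using app[of p "[Inr \<one>\<^bsub>H\<^esub>] @ q"] app[of p q] car[of q] by (simp add: words_def)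
  next
    case (mult_left a b p q)
    then have "p \<in> words" "q \<in> words"
      by (simp_all add: words_def)
    then show ?case
      using app[of p "[Inl a, Inl b] @ q"] app[of p "[Inl (a \<otimes>\<^bsub>G\<^esub> b)] @ q"] car[of q] mult_left
      by (simp add: words_def L.m_assoc)
  next
    case (mult_right a b p q)
    then have "p \<in> words" "q \<in> words"
      by (simp_all add: words_def)
    then show ?case
      using app[of p "[Inr a, Inr b] @ q"] app[of p "[Inr (a \<otimes>\<^bsub>H\<^esub> b)] @ q"] car[of q] mult_right
      by (simp add: words_def L.m_assoc)
  qed
  have inv: "?v v = ?v w" if "fp_equiv v w" "v \<in> words" for v w
    using that
  proof (induction rule: equivclp_induct)
    case (step y z)
    then have "y \<in> words" "z \<in> words"
      using equiv_words[of v y] step_words by auto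
    with step(2) have "?v y = ?v z"
      using val_step by fastforce
    with step show ?case by simp
  qed simp
  let ?F = "\<lambda>A. the_elem (?v ` A)"
  have F: "?F (wcls w) = ?v w" if "w \<in> words" for w
  proof -
    have "?v ` wcls w = {?v w}"
    proof (intro equalityI subsetI)
      fix x assume "x \<in> ?v ` wcls w"
      then obtain u where "x = ?v u" "fp_equiv w u"
        by (auto simp: in_wcls)
      then show "x \<in> {?v w}"
        using inv[of w u] that by simp
    qed (auto simp: in_wcls)
    then show ?thesis by simp
  qed
  show ?thesis
  proof (intro bexI[of _ ?F] conjI ballI)
    show "?F \<in> hom (free_product G H) L"
    proof (rule homI)
      fix x y assume "x \<in> carrier (free_product G H)" "y \<in> carrier (free_product G H)"
      then obtain v w where "v \<in> words" "x = wcls v" "w \<in> words" "y = wcls w"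
        by (auto simp: carrier_free_product)
      moreover from this have "v @ w \<in> words"
        by (simp add: words_def)
      ultimately show "?F (x \<otimes>\<^bsub>free_product G H\<^esub> y) = ?F x \<otimes>\<^bsub>L\<^esub> ?F y"
        by (simp add: wcls_mult F app)
    qed (auto simp: carrier_free_product F car)
    show "?F (fp_inl G H a) = f a" if "a \<in> carrier G" for a
      using F[of "[Inl a]"] that by (simp add: fp_inl_def words_def flip: wcls_def)
    show "?F (fp_inr G H b) = k b" if "b \<in> carrier H" for b
      using F[of "[Inr b]"] that by (simp add: fp_inr_def words_def flip: wcls_def)
  qed
qed

lemma free_product_hom_unique:
  assumes "group L" "F \<in> hom (free_product G H) L" "F' \<in> hom (free_product G H) L"
    and l: "\<And>a. a \<in> carrier G \<Longrightarrow> F (fp_inl G H a) = F' (fp_inl G H a)"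
    and r: "\<And>b. b \<in> carrier H \<Longrightarrow> F (fp_inr G H b) = F' (fp_inr G H b)"
    and x: "x \<in> carrier (free_product G H)"
  shows "F x = F' x"
proof -
  interpret F: group_hom "free_product G H" L F
    using assms group_free_product by (simp add: group_hom_def group_hom_axioms_def)
  interpret F': group_hom "free_product G H" L F'
    using assms group_free_product by (simp add: group_hom_def group_hom_axioms_def)
  have "F (wcls w) = F' (wcls w)" if "w \<in> words" for w
    using that
  proof (induction w)
    case Nil
    then show ?case
      using F.hom_one F'.hom_one by (simp add: one_free_product)
  next
    case (Cons s w)
    then have w: "wcls w \<in> carrier (free_product G H)" "F (wcls w) = F' (wcls w)"
      by (auto simp: carrier_free_product words_def)
    from Cons.prems consider a where "s = Inl a" "a \<in> carrier G" | b where "s = Inr b" "b \<in> carrier H"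
      by (auto simp: words_def)
    then show ?case
    proof cases
      case 1
      with w l show ?thesis
        using hom_in_carrier[OF fp_inl_hom, of a] by (simp add: wcls_Cons)
    next
      case 2
      with w r show ?thesis
        using hom_in_carrier[OF fp_inr_hom, of b] by (simp add: wcls_Cons)
    qed
  qed
  with x show ?thesis
    by (auto simp: carrier_free_product)
qed

end

section \<open>Restricted powers\<close>

context group
begin

lemma group_power_group: "group (power_group G)"
  unfolding power_group_def by (rule sum_group) (rule group_axioms)

lemma carrier_power_group:
  "carrier (power_group G) = {f. (\<forall>i. f i \<in> carrier G) \<and> finite {i. f i \<noteq> \<one>}}"
  unfolding power_group_def
  by (subst carrier_sum_group) (auto simp: group_axioms PiE_def Pi_def)

lemma mult_power_group: "f \<otimes>\<^bsub>power_group G\<^esub> g = (\<lambda>i. f i \<otimes> g i)"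
  by (simp add: power_group_def restrict_def)

lemma one_power_group: "\<one>\<^bsub>power_group G\<^esub> = (\<lambda>i. \<one>)"
  by (simp add: power_group_def restrict_def)

lemma copy_hom: "copy G i \<in> hom G (power_group G)"
proof (rule homI)
  show "copy G i x \<in> carrier (power_group G)" if "x \<in> carrier G" for x
    using that by (auto simp: copy_def carrier_power_group intro: finite_subset[of _ "{i}"])
qed (auto simp: copy_def mult_power_group fun_eq_iff)

lemma copies_commute:
  assumes "i \<noteq> j" "x \<in> carrier G" "y \<in> carrier G"
  shows "copy G i x \<otimes>\<^bsub>power_group G\<^esub> copy G j y = copy G j y \<otimes>\<^bsub>power_group G\<^esub> copy G i x"
  using assms by (auto simp: copy_def mult_power_group fun_eq_iff)

lemma power_group_hom_unique:
  assumes "group L" "F \<in> hom (power_group G) L" "F' \<in> hom (power_group G) L"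
    and copy: "\<And>i a. a \<in> carrier G \<Longrightarrow> F (copy G i a) = F' (copy G i a)"
    and x: "x \<in> carrier (power_group G)"
  shows "F x = F' x"
proof -
  interpret F: group_hom "power_group G" L F
    using assms group_power_group by (simp add: group_hom_def group_hom_axioms_def)
  interpret F': group_hom "power_group G" L F'
    using assms group_power_group by (simp add: group_hom_def group_hom_axioms_def)
  have "finite {i. x i \<noteq> \<one>}"
    using x by (simp add: carrier_power_group)
  then show ?thesis
    using x
  proof (induction "{i. x i \<noteq> \<one>}" arbitrary: x rule: finite_induct)
    case empty
    then have "x = \<one>\<^bsub>power_group G\<^esub>"
      by (auto simp: one_power_group fun_eq_iff)
    then show ?case
      using F.hom_one F'.hom_one by simp
  next
    case (insert i I)
    let ?y = "x(i := \<one>)"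
    have I: "I = {j. ?y j \<noteq> \<one>}"
      using insert by auto
    moreover from I have y: "?y \<in> carrier (power_group G)"
      using insert by (auto simp: carrier_power_group)
    ultimately have "F ?y = F' ?y"
      by (rule insert)
    moreover have xi: "x i \<in> carrier G"
      using insert by (simp add: carrier_power_group)
    moreover have "x = copy G i (x i) \<otimes>\<^bsub>power_group G\<^esub> ?y"
      using insert by (auto simp: copy_def mult_power_group carrier_power_group fun_eq_iff)
    ultimately show ?case
      using copy hom_in_carrier[OF copy_hom xi] y by (metis F.hom_mult F'.hom_mult)
  qed
qed

text \<open>The target is not commutative, so the product over the finite support needs an order. Here it runs
through an enumeration of \<open>\<int>\<close> by natural numbers; the partial products are multiplicative because
distinct copies commute, and they stabilise because the support is finite.\<close>
lemma power_group_hom_exists: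
  fixes L :: "('l, 'k) monoid_scheme"
  assumes "group L" and \<phi>: "\<And>i. \<phi> i \<in> hom G L"
    and commute: "\<And>i j x y. i \<noteq> j \<Longrightarrow> x \<in> carrier G \<Longrightarrow> y \<in> carrier G \<Longrightarrow>
      \<phi> i x \<otimes>\<^bsub>L\<^esub> \<phi> j y = \<phi> j y \<otimes>\<^bsub>L\<^esub> \<phi> i x"
  shows "\<exists>F\<in>hom (power_group G) L. \<forall>i. \<forall>a\<in>carrier G. F (copy G i a) = \<phi> i a"
proof -
  interpret L: group L by fact
  define P where "P f n = path_val L (\<lambda>k. \<phi> (int_decode k) (f (int_decode k))) [0..<n]" for f n
  note \<phi>c = hom_in_carrier[OF \<phi>]
  have \<phi>m: "\<phi> i (x \<otimes> y) = \<phi> i x \<otimes>\<^bsub>L\<^esub> \<phi> i y" if "x \<in> carrier G" "y \<in> carrier G" for i x y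
    using \<phi>[of i] that by (rule hom_mult)
  have \<phi>1: "\<phi> i \<one> = \<one>\<^bsub>L\<^esub>" for i
    using hom_one[OF \<phi>] group_axioms L.group_axioms .
  have P0: "P f 0 = \<one>\<^bsub>L\<^esub>" for f
    by (simp add: P_def)
  have app: "path_val L h (xs @ [n]) = path_val L h xs \<otimes>\<^bsub>L\<^esub> h n" 
    if "\<And>k. h k \<in> carrier L" for h xs and n :: nat
  proof (induction xs)
    case (Cons x xs)
    have "path_val L h xs \<in> carrier L"
      by (induction xs) (auto simp: that)
    with Cons that show ?case by (simp add: L.m_assoc)
  qed (simp add: that)
  have PS: "P f (Suc n) = P f n \<otimes>\<^bsub>L\<^esub> \<phi> (int_decode n) (f (int_decode n))"
    if "\<And>i. f i \<in> carrier G" for f n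
    using app[of "\<lambda>k. \<phi> (int_decode k) (f (int_decode k))" "[0..<n]" n] that \<phi>c by (simp add: P_def)
  have Pc: "P f n \<in> carrier L" if "\<And>i. f i \<in> carrier G" for f n
    by (induction n) (auto simp: P0 PS that \<phi>c)
  have Pcomm: "P f n \<otimes>\<^bsub>L\<^esub> \<phi> (int_decode m) a = \<phi> (int_decode m) a \<otimes>\<^bsub>L\<^esub> P f n"
    if f: "\<And>i. f i \<in> carrier G" and a: "a \<in> carrier G" and "n \<le> m" for f n m a
    using \<open>n \<le> m\<close>
  proof (induction n)
    case (Suc n)
    let ?x = "P f n" and ?y = "\<phi> (int_decode n) (f (int_decode n))" and ?z = "\<phi> (int_decode m) a"
    have ne: "int_decode n \<noteq> int_decode m"
      using Suc.prems by (simp add: inj_eq[OF inj_int_decode])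
    have c: "?x \<in> carrier L" "?y \<in> carrier L" "?z \<in> carrier L"
      using f a Pc \<phi>c by auto
    have yz: "?y \<otimes>\<^bsub>L\<^esub> ?z = ?z \<otimes>\<^bsub>L\<^esub> ?y"
      using commute[OF ne] f a by simp
    have "?x \<otimes>\<^bsub>L\<^esub> ?y \<otimes>\<^bsub>L\<^esub> ?z = ?x \<otimes>\<^bsub>L\<^esub> ?z \<otimes>\<^bsub>L\<^esub> ?y"
      using c yz by (simp add: L.m_assoc)
    also have "\<dots> = ?z \<otimes>\<^bsub>L\<^esub> (?x \<otimes>\<^bsub>L\<^esub> ?y)"
      using c Suc by (simp add: L.m_assoc)
    finally show ?case
      using f by (simp add: PS)
  qed (use a \<phi>c in \<open>simp add: P0\<close>)
  have Pmult: "P (\<lambda>i. f i \<otimes> g i) n = P f n \<otimes>\<^bsub>L\<^esub> P g n"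
    if f: "\<And>i. f i \<in> carrier G" and g: "\<And>i. g i \<in> carrier G" for f g n
  proof (induction n)
    case (Suc n)
    let ?i = "int_decode n"
    have fg: "f i \<otimes> g i \<in> carrier G" for i
      using f g by simp
    have c: "P f n \<in> carrier L" "P g n \<in> carrier L" "\<phi> ?i (f ?i) \<in> carrier L" "\<phi> ?i (g ?i) \<in> carrier L"
      using f g Pc \<phi>c by auto
    have k: "P g n \<otimes>\<^bsub>L\<^esub> \<phi> ?i (f ?i) = \<phi> ?i (f ?i) \<otimes>\<^bsub>L\<^esub> P g n"
      using Pcomm[of g "f ?i" n n] f g by simp
    have "P (\<lambda>i. f i \<otimes> g i) (Suc n) = P f n \<otimes>\<^bsub>L\<^esub> (P g n \<otimes>\<^bsub>L\<^esub> \<phi> ?i (f ?i)) \<otimes>\<^bsub>L\<^esub> \<phi> ?i (g ?i)"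
      using c f g fg Suc by (simp add: PS \<phi>m L.m_assoc)
    then show ?case
      using c f g by (simp add: k PS L.m_assoc)
  qed (simp add: P0)
  \<comment> \<open>From \<open>bound f\<close> on, all factors are trivial.\<close>
  define bound where "bound f = (SOME N. \<forall>k\<ge>N. f (int_decode k) = \<one>)" for f
  have bound: "f (int_decode k) = \<one>" if "f \<in> carrier (power_group G)" "bound f \<le> k" for f k
  proof -
    have "finite (int_encode ` {i. f i \<noteq> \<one>})"
      using that by (simp add: carrier_power_group)
    then obtain N where N: "\<forall>x\<in>int_encode ` {i. f i \<noteq> \<one>}. x < N"
      using finite_nat_set_iff_bounded by blast
    have "\<forall>k\<ge>N. f (int_decode k) = \<one>"
    proof (intro allI impI, rule ccontr)
      fix k assume "k \<ge> N" "f (int_decode k) \<noteq> \<one>"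
      then have "int_encode (int_decode k) < N"
        using N by blast
      with \<open>k \<ge> N\<close> show False by simp
    qed
    then have "\<forall>k\<ge>bound f. f (int_decode k) = \<one>"
      unfolding bound_def by (rule someI)
    with that show ?thesis by blast
  qed
  have stab: "P f n = P f (bound f)" if f: "f \<in> carrier (power_group G)" "bound f \<le> n" for f n
    using that(2)
  proof (induction n rule: dec_induct)
    case (step n)
    then show ?case
      using that(1) bound[OF that(1)] Pc[of f] by (simp add: PS \<phi>1 carrier_power_group)
  qed simp
  let ?F = "\<lambda>f. P f (bound f)"
  have "?F \<in> hom (power_group G) L"
  proof (rule homI)
    fix f g assume f: "f \<in> carrier (power_group G)" and g: "g \<in> carrier (power_group G)"
    let ?h = "f \<otimes>\<^bsub>power_group G\<^esub> g"
    have h: "?h \<in> carrier (power_group G)"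
      using f g group.is_monoid[OF group_power_group] by (simp add: monoid.m_closed)
    define n where "n = max (bound f) (max (bound g) (bound ?h))"
    have "?F ?h = P ?h n"
      using stab[OF h, of n] by (simp add: n_def)
    also have "\<dots> = P f n \<otimes>\<^bsub>L\<^esub> P g n"
      using f g by (simp add: mult_power_group Pmult carrier_power_group)
    also have "\<dots> = ?F f \<otimes>\<^bsub>L\<^esub> ?F g"
      using stab[OF f, of n] stab[OF g, of n] by (simp add: n_def)
    finally show "?F ?h = ?F f \<otimes>\<^bsub>L\<^esub> ?F g" .
  qed (simp add: Pc carrier_power_group)
  moreover have "?F (copy G i a) = \<phi> i a" if a: "a \<in> carrier G" for i a
  proof -
    let ?c = "copy G i a" and ?k = "int_encode i"
    have c: "?c j \<in> carrier G" for j
      using a by (simp add: copy_def)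
    have 0: "P ?c n = \<one>\<^bsub>L\<^esub>" if "n \<le> ?k" for n
      using that
    proof (induction n)
      case (Suc n)
      then have "int_decode n \<noteq> i"
        by auto
      then have "?c (int_decode n) = \<one>"
        by (simp add: copy_def)
      with Suc show ?case by (simp add: PS[of ?c, OF c] \<phi>1)
    qed (simp add: P0)
    have 1: "P ?c n = \<phi> i a" if "Suc ?k \<le> n" for n
      using that
    proof (induction n rule: dec_induct)
      case base
      show ?case
        using 0[of ?k] a \<phi>c by (simp add: PS[of ?c, OF c]) (simp add: copy_def)
    next
      case (step n)
      then have "int_decode n \<noteq> i"
        by auto
      then have "?c (int_decode n) = \<one>"
        by (simp add: copy_def)
      with step a \<phi>c show ?case by (simp add: PS[of ?c, OF c] \<phi>1)
    qed
    have "?c \<in> carrier (power_group G)"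
      using hom_in_carrier[OF copy_hom a] .
    from stab[OF this, of "max (Suc ?k) (bound ?c)"] 1[of "max (Suc ?k) (bound ?c)"] show ?thesis
      by simp
  qed
  ultimately show ?thesis
    by (intro bexI[of _ ?F] allI ballI)
qed

end

section \<open>The universal property of the group \<open>O(G, H)\<close>\<close>

lemma (in group) normal_normal_closure:
  assumes "S \<subseteq> carrier G"
  shows "normal_closure G S \<lhd> G"
proof -
  let ?A = "{N. N \<lhd> G \<and> S \<subseteq> N}"
  have "carrier G \<lhd> G"
    by (auto simp: normal_inv_iff subgroup_self)
  with assms have ne: "?A \<noteq> {}"
    by blast
  have "subgroup (\<Inter>?A) G"
    using ne by (intro subgroups_Inter) (auto simp: normal_inv_iff)
  then show ?thesis
    by (auto simp: normal_closure_def normal_inv_iff)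
qed

text \<open>Conjugation by \<open>\<tau>\<^sup>i\<close>, in the convention \<open>x\<^sup>y = y\<^sup>-\<^sup>1xy\<close>. In \<open>O(G, H)\<close> conjugation by \<open>t\<^sup>i\<close> carries the
copies with index \<open>0\<close> to those with index \<open>i\<close>.\<close>
definition shift :: "('a, 'm) monoid_scheme \<Rightarrow> 'a \<Rightarrow> int \<Rightarrow> 'a \<Rightarrow> 'a" where
  "shift L \<tau> i x = \<tau> [^]\<^bsub>L\<^esub> (- i) \<otimes>\<^bsub>L\<^esub> x \<otimes>\<^bsub>L\<^esub> \<tau> [^]\<^bsub>L\<^esub> i"

context group
begin

lemma shift_hom:
  assumes "\<tau> \<in> carrier G"
  shows "shift G \<tau> i \<in> hom G G"
proof (rule homI)
  fix x y assume "x \<in> carrier G" "y \<in> carrier G"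
  then show "shift G \<tau> i (x \<otimes> y) = shift G \<tau> i x \<otimes> shift G \<tau> i y"
    using assms by (simp add: shift_def m_assoc int_pow_neg cancel_inv_left)
qed (use assms in \<open>simp add: shift_def\<close>)

lemma shift_carrier [simp]: "\<tau> \<in> carrier G \<Longrightarrow> x \<in> carrier G \<Longrightarrow> shift G \<tau> i x \<in> carrier G"
  by (simp add: shift_def)

lemma shift_shift:
  assumes "\<tau> \<in> carrier G" "x \<in> carrier G"
  shows "shift G \<tau> i (shift G \<tau> j x) = shift G \<tau> (i + j) x"
proof -
  have "shift G \<tau> i (shift G \<tau> j x)
      = (\<tau> [^] (- i) \<otimes> \<tau> [^] (- j)) \<otimes> x \<otimes> (\<tau> [^] j \<otimes> \<tau> [^] i)"
    using assms by (simp add: shift_def m_assoc)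
  then show ?thesis
    using assms by (simp add: shift_def add.commute flip: int_pow_mult)
qed

lemma shift_0: "\<tau> \<in> carrier G \<Longrightarrow> x \<in> carrier G \<Longrightarrow> shift G \<tau> 0 x = x"
  by (simp add: shift_def)

text \<open>Whether two conjugates commute depends only on the difference of the exponents.\<close>
lemma shift_commute:
  assumes "\<tau> \<in> carrier G" "x \<in> carrier G" "y \<in> carrier G"
    and "x \<otimes> shift G \<tau> (j - i) y = shift G \<tau> (j - i) y \<otimes> x"
  shows "shift G \<tau> i x \<otimes> shift G \<tau> j y = shift G \<tau> j y \<otimes> shift G \<tau> i x"
proof -
  have j: "shift G \<tau> j y = shift G \<tau> i (shift G \<tau> (j - i) y)"
    using assms by (simp add: shift_shift)
  show ?thesis
    unfolding j using assms hom_mult[OF shift_hom, of \<tau>, symmetric] by simp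
qed

end

locale O_pair = G: group G + H: group H
  for G :: "('a, 'm) monoid_scheme" and H :: "('b, 'n) monoid_scheme"
begin

sublocale PF: free_prod "power_group G" "power_group H"
  by (intro free_prod.intro G.group_power_group H.group_power_group)

sublocale OF: free_prod "free_product (power_group G) (power_group H)" integer_group
  by (intro free_prod.intro PF.group_free_product group_integer_group)

abbreviation F where "F \<equiv> O_free G H"
abbreviation N where "N \<equiv> normal_closure F (O_relators G H)"
abbreviation OGH where "OGH \<equiv> O_group G H"

sublocale F: group F
  unfolding O_free_def by (rule OF.group_free_product)

lemma O_left_hom: "O_left G H i \<in> hom G F"
proof -
  have "O_left G H i = fp_inl (free_product (power_group G) (power_group H)) integer_group
      \<circ> (fp_inl (power_group G) (power_group H) \<circ> copy G i)"
    by (simp add: fun_eq_iff O_left_def)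
  then show ?thesis
    unfolding O_free_def using hom_compose[OF hom_compose[OF G.copy_hom PF.fp_inl_hom] OF.fp_inl_hom] by simp
qed

lemma O_right_hom: "O_right G H i \<in> hom H F"
proof -
  have "O_right G H i = fp_inl (free_product (power_group G) (power_group H)) integer_group
      \<circ> (fp_inr (power_group G) (power_group H) \<circ> copy H i)"
    by (simp add: fun_eq_iff O_right_def)
  then show ?thesis
    unfolding O_free_def using hom_compose[OF hom_compose[OF H.copy_hom PF.fp_inr_hom] OF.fp_inl_hom] by simp
qed

lemma O_t_carrier: "O_t G H \<in> carrier F"
  unfolding O_free_def O_t_def using hom_in_carrier[OF OF.fp_inr_hom] by simp

lemmas F_carrier = hom_in_carrier[OF O_left_hom] hom_in_carrier[OF O_right_hom] O_t_carrier

lemma relators_carrier: "O_relators G H \<subseteq> carrier F"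
  by (auto simp: O_relators_def conjugate_def commutator_def F_carrier)

sublocale N: normal N F
  by (rule F.normal_normal_closure[OF relators_carrier])

lemma group_OGH: "group OGH"
  unfolding O_group_def by (rule N.factorgroup_is_group)

sublocale OGH: group OGH
  by (rule group_OGH)

definition proj where "proj x = N #>\<^bsub>F\<^esub> x"

lemma proj_hom: "proj \<in> hom F OGH"
  unfolding O_group_def proj_def[abs_def] by (rule N.r_coset_hom_Mod)

sublocale proj: group_hom F OGH proj
  by unfold_locales (rule proj_hom)

lemma carrier_OGH: "carrier OGH = proj ` carrier F"
  by (simp add: O_group_def proj_def[abs_def] carrier_FactGroup)

lemma proj_relator: "r \<in> O_relators G H \<Longrightarrow> proj r = \<one>\<^bsub>OGH\<^esub>"
proof -
  assume r: "r \<in> O_relators G H"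
  then have "r \<in> N"
    by (auto simp: normal_closure_def)
  then have "proj r = N"
    using r relators_carrier unfolding proj_def by (intro F.coset_join2 N.is_subgroup) auto
  then show ?thesis
    by (simp add: O_group_def)
qed

definition gen_G where "gen_G i g = proj (O_left G H i g)"
definition gen_H where "gen_H i h = proj (O_right G H i h)"
definition gen_t where "gen_t = proj (O_t G H)"

lemma gen_G_hom: "gen_G i \<in> hom G OGH"
  using hom_compose[OF O_left_hom proj_hom, of i] by (simp add: comp_def gen_G_def[abs_def])

lemma gen_H_hom: "gen_H i \<in> hom H OGH"
  using hom_compose[OF O_right_hom proj_hom, of i] by (simp add: comp_def gen_H_def[abs_def])

lemma gen_t_carrier: "gen_t \<in> carrier OGH"
  by (simp add: gen_t_def F_carrier)

lemmas gen_carrier [simp] = hom_in_carrier[OF gen_G_hom] hom_in_carrier[OF gen_H_hom] gen_t_carrier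

lemma gen_G_shift:
  assumes "g \<in> carrier G"
  shows "gen_G i g \<otimes>\<^bsub>OGH\<^esub> gen_t = gen_t \<otimes>\<^bsub>OGH\<^esub> gen_G (i + 1) g"
proof -
  have "conjugate F (O_left G H i g) (O_t G H) \<otimes>\<^bsub>F\<^esub> inv\<^bsub>F\<^esub> (O_left G H (i + 1) g) \<in> O_relators G H"
    unfolding O_relators_def using assms by blast
  from proj_relator[OF this]
  have "inv\<^bsub>OGH\<^esub> gen_t \<otimes>\<^bsub>OGH\<^esub> gen_G i g \<otimes>\<^bsub>OGH\<^esub> gen_t \<otimes>\<^bsub>OGH\<^esub> inv\<^bsub>OGH\<^esub> gen_G (i + 1) g = \<one>\<^bsub>OGH\<^esub>"
    using assms by (simp add: conjugate_def F_carrier gen_G_def gen_t_def)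
  then have "inv\<^bsub>OGH\<^esub> gen_t \<otimes>\<^bsub>OGH\<^esub> gen_G i g \<otimes>\<^bsub>OGH\<^esub> gen_t = gen_G (i + 1) g"
    using assms OGH.inv_equality[of "inv\<^bsub>OGH\<^esub> gen_t \<otimes>\<^bsub>OGH\<^esub> gen_G i g \<otimes>\<^bsub>OGH\<^esub> gen_t" "inv\<^bsub>OGH\<^esub> gen_G (i + 1) g"]
    by simp
  then have "gen_t \<otimes>\<^bsub>OGH\<^esub> (inv\<^bsub>OGH\<^esub> gen_t \<otimes>\<^bsub>OGH\<^esub> (gen_G i g \<otimes>\<^bsub>OGH\<^esub> gen_t)) = gen_t \<otimes>\<^bsub>OGH\<^esub> gen_G (i + 1) g"
    using assms by (simp add: OGH.m_assoc)
  then show ?thesis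
    using assms by (simp add: OGH.cancel_inv_left)
qed

lemma gen_H_shift:
  assumes "h \<in> carrier H"
  shows "gen_H i h \<otimes>\<^bsub>OGH\<^esub> gen_t = gen_t \<otimes>\<^bsub>OGH\<^esub> gen_H (i + 1) h"
proof -
  have "conjugate F (O_right G H i h) (O_t G H) \<otimes>\<^bsub>F\<^esub> inv\<^bsub>F\<^esub> (O_right G H (i + 1) h) \<in> O_relators G H"
    unfolding O_relators_def using assms by blast
  from proj_relator[OF this]
  have "inv\<^bsub>OGH\<^esub> gen_t \<otimes>\<^bsub>OGH\<^esub> gen_H i h \<otimes>\<^bsub>OGH\<^esub> gen_t \<otimes>\<^bsub>OGH\<^esub> inv\<^bsub>OGH\<^esub> gen_H (i + 1) h = \<one>\<^bsub>OGH\<^esub>"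
    using assms by (simp add: conjugate_def F_carrier gen_H_def gen_t_def)
  then have "inv\<^bsub>OGH\<^esub> gen_t \<otimes>\<^bsub>OGH\<^esub> gen_H i h \<otimes>\<^bsub>OGH\<^esub> gen_t = gen_H (i + 1) h"
    using assms OGH.inv_equality[of "inv\<^bsub>OGH\<^esub> gen_t \<otimes>\<^bsub>OGH\<^esub> gen_H i h \<otimes>\<^bsub>OGH\<^esub> gen_t" "inv\<^bsub>OGH\<^esub> gen_H (i + 1) h"]
    by simp
  then have "gen_t \<otimes>\<^bsub>OGH\<^esub> (inv\<^bsub>OGH\<^esub> gen_t \<otimes>\<^bsub>OGH\<^esub> (gen_H i h \<otimes>\<^bsub>OGH\<^esub> gen_t)) = gen_t \<otimes>\<^bsub>OGH\<^esub> gen_H (i + 1) h"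
    using assms by (simp add: OGH.m_assoc)
  then show ?thesis
    using assms by (simp add: OGH.cancel_inv_left)
qed

lemma gen_G_eq_shift:
  assumes g: "g \<in> carrier G"
  shows "gen_G i g = shift OGH gen_t i (gen_G 0 g)"
proof -
  have step: "gen_G (i + 1) g = shift OGH gen_t 1 (gen_G i g)" for i
    using gen_G_shift[OF g, of i] g by (simp add: shift_def OGH.int_pow_neg OGH.m_assoc OGH.cancel_left_inv)
  show ?thesis
  proof (induction i rule: int_induct[where k = 0])
    case base
    then show ?case
      using g by (simp add: OGH.shift_0)
  next
    case (step1 i)
    then show ?case
      using g step[of i] by (simp add: OGH.shift_shift add.commute)
  next
    case (step2 i)
    have "shift OGH gen_t (- 1) (gen_G i g) = gen_G (i - 1) g"
      using step[of "i - 1"] g by (simp add: OGH.shift_shift OGH.shift_0)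
    with step2 show ?case
      using g by (simp add: OGH.shift_shift)
  qed
qed

lemma gen_H_eq_shift:
  assumes h: "h \<in> carrier H"
  shows "gen_H i h = shift OGH gen_t i (gen_H 0 h)"
proof -
  have step: "gen_H (i + 1) h = shift OGH gen_t 1 (gen_H i h)" for i
    using gen_H_shift[OF h, of i] h by (simp add: shift_def OGH.int_pow_neg OGH.m_assoc OGH.cancel_left_inv)
  show ?thesis
  proof (induction i rule: int_induct[where k = 0])
    case base
    then show ?case
      using h by (simp add: OGH.shift_0)
  next
    case (step1 i)
    then show ?case
      using h step[of i] by (simp add: OGH.shift_shift add.commute)
  next
    case (step2 i)
    have "shift OGH gen_t (- 1) (gen_H i h) = gen_H (i - 1) h"
      using step[of "i - 1"] h by (simp add: OGH.shift_shift OGH.shift_0)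
    with step2 show ?case
      using h by (simp add: OGH.shift_shift)
  qed
qed

lemma gen_G_commute:
  assumes "i \<noteq> j" "x \<in> carrier G" "y \<in> carrier G"
  shows "gen_G i x \<otimes>\<^bsub>OGH\<^esub> gen_G j y = gen_G j y \<otimes>\<^bsub>OGH\<^esub> gen_G i x"
proof -
  note c = hom_in_carrier[OF G.copy_hom] hom_in_carrier[OF PF.fp_inl_hom]
  have "O_left G H i x \<otimes>\<^bsub>F\<^esub> O_left G H j y = O_left G H j y \<otimes>\<^bsub>F\<^esub> O_left G H i x"
    using G.copies_commute[OF assms] assms(2,3)
    by (simp add: O_left_def O_free_def c flip: hom_mult[OF OF.fp_inl_hom] hom_mult[OF PF.fp_inl_hom])
  then show ?thesis
    using assms by (simp add: gen_G_def F_carrier flip: proj.hom_mult)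
qed

lemma gen_H_commute:
  assumes "i \<noteq> j" "x \<in> carrier H" "y \<in> carrier H"
  shows "gen_H i x \<otimes>\<^bsub>OGH\<^esub> gen_H j y = gen_H j y \<otimes>\<^bsub>OGH\<^esub> gen_H i x"
proof -
  note c = hom_in_carrier[OF H.copy_hom] hom_in_carrier[OF PF.fp_inr_hom]
  have "O_right G H i x \<otimes>\<^bsub>F\<^esub> O_right G H j y = O_right G H j y \<otimes>\<^bsub>F\<^esub> O_right G H i x"
    using H.copies_commute[OF assms] assms(2,3)
    by (simp add: O_right_def O_free_def c flip: hom_mult[OF OF.fp_inl_hom] hom_mult[OF PF.fp_inr_hom])
  then show ?thesis
    using assms by (simp add: gen_H_def F_carrier flip: proj.hom_mult)
qed

lemma gen_GH_commute:
  assumes "i \<le> j" "g \<in> carrier G" "h \<in> carrier H"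
  shows "gen_G i g \<otimes>\<^bsub>OGH\<^esub> gen_H j h = gen_H j h \<otimes>\<^bsub>OGH\<^esub> gen_G i g"
proof -
  have "commutator F (O_left G H i g) (O_right G H j h) \<in> O_relators G H"
    unfolding O_relators_def using assms by blast
  from proj_relator[OF this]
  have "inv\<^bsub>OGH\<^esub> gen_G i g \<otimes>\<^bsub>OGH\<^esub> inv\<^bsub>OGH\<^esub> gen_H j h \<otimes>\<^bsub>OGH\<^esub> gen_G i g \<otimes>\<^bsub>OGH\<^esub> gen_H j h = \<one>\<^bsub>OGH\<^esub>"
    using assms by (simp add: commutator_def F_carrier gen_G_def gen_H_def)
  then have "inv\<^bsub>OGH\<^esub> (gen_H j h \<otimes>\<^bsub>OGH\<^esub> gen_G i g) \<otimes>\<^bsub>OGH\<^esub> (gen_G i g \<otimes>\<^bsub>OGH\<^esub> gen_H j h) = \<one>\<^bsub>OGH\<^esub>"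
    using assms by (simp add: OGH.inv_mult_group OGH.m_assoc)
  then have "(gen_H j h \<otimes>\<^bsub>OGH\<^esub> gen_G i g) \<otimes>\<^bsub>OGH\<^esub> (inv\<^bsub>OGH\<^esub> (gen_H j h \<otimes>\<^bsub>OGH\<^esub> gen_G i g)
      \<otimes>\<^bsub>OGH\<^esub> (gen_G i g \<otimes>\<^bsub>OGH\<^esub> gen_H j h)) = gen_H j h \<otimes>\<^bsub>OGH\<^esub> gen_G i g"
    using assms by simp
  then show ?thesis
    using assms OGH.cancel_inv_left[of "gen_H j h \<otimes>\<^bsub>OGH\<^esub> gen_G i g"] by simp
qed

text \<open>The universal property of \<open>O(G, H)\<close>. The relations \<open>g\<^sub>i\<^sup>t = g\<^sub>i\<^sub>+\<^sub>1\<close> force the image of the \<open>i\<close>-th copy to be the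
image of copy \<open>0\<close> conjugated by \<open>\<tau>\<^sup>i\<close>. Up to conjugation by a power of \<open>\<tau>\<close>, the remaining relations
involve one element of copy \<open>0\<close>, which gives the three hypotheses on commuting elements.\<close>
lemma O_hom_exists:
  fixes L :: "('l, 'k) monoid_scheme"
  assumes "group L" and \<phi>: "\<phi> \<in> hom G L" and \<psi>: "\<psi> \<in> hom H L" and \<tau>: "\<tau> \<in> carrier L"
    and GG: "\<And>k x y. k > 0 \<Longrightarrow> x \<in> carrier G \<Longrightarrow> y \<in> carrier G \<Longrightarrow>
      \<phi> x \<otimes>\<^bsub>L\<^esub> shift L \<tau> k (\<phi> y) = shift L \<tau> k (\<phi> y) \<otimes>\<^bsub>L\<^esub> \<phi> x"
    and HH: "\<And>k x y. k > 0 \<Longrightarrow> x \<in> carrier H \<Longrightarrow> y \<in> carrier H \<Longrightarrow>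
      \<psi> x \<otimes>\<^bsub>L\<^esub> shift L \<tau> k (\<psi> y) = shift L \<tau> k (\<psi> y) \<otimes>\<^bsub>L\<^esub> \<psi> x"
    and GH: "\<And>k x y. k \<ge> 0 \<Longrightarrow> x \<in> carrier G \<Longrightarrow> y \<in> carrier H \<Longrightarrow>
      \<phi> x \<otimes>\<^bsub>L\<^esub> shift L \<tau> k (\<psi> y) = shift L \<tau> k (\<psi> y) \<otimes>\<^bsub>L\<^esub> \<phi> x"
  shows "\<exists>\<Phi>\<in>hom OGH L. (\<forall>i. \<forall>g\<in>carrier G. \<Phi> (gen_G i g) = shift L \<tau> i (\<phi> g)) \<and>
    (\<forall>i. \<forall>h\<in>carrier H. \<Phi> (gen_H i h) = shift L \<tau> i (\<psi> h)) \<and> \<Phi> gen_t = \<tau>"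
proof -
  interpret L: group L by fact
  note c = hom_in_carrier[OF \<phi>] hom_in_carrier[OF \<psi>] \<tau>
  have comm: "shift L \<tau> i x \<otimes>\<^bsub>L\<^esub> shift L \<tau> j y = shift L \<tau> j y \<otimes>\<^bsub>L\<^esub> shift L \<tau> i x"
    if A: "A \<subseteq> carrier L" "\<And>k x y. k > 0 \<Longrightarrow> x \<in> A \<Longrightarrow> y \<in> A \<Longrightarrow>
      x \<otimes>\<^bsub>L\<^esub> shift L \<tau> k y = shift L \<tau> k y \<otimes>\<^bsub>L\<^esub> x" "i \<noteq> j" "x \<in> A" "y \<in> A" for A x y i j
  proof (cases "i < j")
    case True
    then show ?thesis
      using that by (intro L.shift_commute \<tau>) auto
  next
    case False
    then have "shift L \<tau> j y \<otimes>\<^bsub>L\<^esub> shift L \<tau> i x = shift L \<tau> i x \<otimes>\<^bsub>L\<^esub> shift L \<tau> j y"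
      using that by (intro L.shift_commute \<tau>) auto
    then show ?thesis ..
  qed
  have "(\<lambda>x. shift L \<tau> i (\<phi> x)) \<in> hom G L" "(\<lambda>x. shift L \<tau> i (\<psi> x)) \<in> hom H L" for i
    using hom_compose[OF \<phi> L.shift_hom[OF \<tau>]] hom_compose[OF \<psi> L.shift_hom[OF \<tau>]]
    by (simp_all add: comp_def)
  note sh = this
  obtain P where P: "P \<in> hom (power_group G) L"
    "\<And>i a. a \<in> carrier G \<Longrightarrow> P (copy G i a) = shift L \<tau> i (\<phi> a)"
    using G.power_group_hom_exists[of L "\<lambda>i x. shift L \<tau> i (\<phi> x)", OF L.group_axioms sh(1)]
      comm[of "\<phi> ` carrier G"] c GG by (smt (verit) image_iff image_subsetI)
  obtain Q where Q: "Q \<in> hom (power_group H) L"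
    "\<And>i a. a \<in> carrier H \<Longrightarrow> Q (copy H i a) = shift L \<tau> i (\<psi> a)"
    using H.power_group_hom_exists[of L "\<lambda>i x. shift L \<tau> i (\<psi> x)", OF L.group_axioms sh(2)]
      comm[of "\<psi> ` carrier H"] c HH by (smt (verit) image_iff image_subsetI)
  obtain PQ where PQ: "PQ \<in> hom (free_product (power_group G) (power_group H)) L"
    "\<And>a. a \<in> carrier (power_group G) \<Longrightarrow> PQ (fp_inl (power_group G) (power_group H) a) = P a"
    "\<And>b. b \<in> carrier (power_group H) \<Longrightarrow> PQ (fp_inr (power_group G) (power_group H) b) = Q b"
    using PF.free_product_hom_exists[OF L.group_axioms P(1) Q(1)] by blast
  obtain \<Theta> where \<Theta>: "\<Theta> \<in> hom F L"
    "\<And>a. a \<in> carrier (free_product (power_group G) (power_group H)) \<Longrightarrow>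
      \<Theta> (fp_inl (free_product (power_group G) (power_group H)) integer_group a) = PQ a"
    "\<And>n. \<Theta> (fp_inr (free_product (power_group G) (power_group H)) integer_group n) = \<tau> [^]\<^bsub>L\<^esub> n"
    using OF.free_product_hom_exists[OF L.group_axioms PQ(1) L.hom_integer_group_pow[OF \<tau>]]
    unfolding O_free_def by auto
  note cc = hom_in_carrier[OF G.copy_hom] hom_in_carrier[OF H.copy_hom]
    hom_in_carrier[OF PF.fp_inl_hom] hom_in_carrier[OF PF.fp_inr_hom]
  have \<Theta>_left: "\<Theta> (O_left G H i g) = shift L \<tau> i (\<phi> g)" if "g \<in> carrier G" for i g
    using that by (simp add: O_left_def \<Theta> PQ P cc)
  have \<Theta>_right: "\<Theta> (O_right G H i h) = shift L \<tau> i (\<psi> h)" if "h \<in> carrier H" for i h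
    using that by (simp add: O_right_def \<Theta> PQ Q cc)
  have \<Theta>_t: "\<Theta> (O_t G H) = \<tau>"
    using \<tau> by (simp add: O_t_def \<Theta>)
  interpret \<Theta>: group_hom F L \<Theta>
    using \<Theta>(1) by unfold_locales
  have conj: "inv\<^bsub>L\<^esub> \<tau> \<otimes>\<^bsub>L\<^esub> shift L \<tau> i x \<otimes>\<^bsub>L\<^esub> \<tau> = shift L \<tau> (i + 1) x" if "x \<in> carrier L" for i x
    using L.shift_shift[OF \<tau> that, of 1 i] \<tau> by (simp add: shift_def[of L \<tau> 1] L.int_pow_neg add.commute)
  have "O_relators G H \<subseteq> kernel F L \<Theta>"
  proof
    fix r assume r: "r \<in> O_relators G H"
    then have "r \<in> carrier F"
      using relators_carrier by blast
    moreover have "\<Theta> r = \<one>\<^bsub>L\<^esub>"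
      using r unfolding O_relators_def
    proof (elim UnE CollectE exE conjE)
      fix i g assume "r = conjugate F (O_left G H i g) (O_t G H) \<otimes>\<^bsub>F\<^esub> inv\<^bsub>F\<^esub> (O_left G H (i + 1) g)"
        and "g \<in> carrier G"
      then show ?thesis
        by (simp add: conjugate_def F_carrier \<Theta>_left \<Theta>_t conj c)
    next
      fix i h assume "r = conjugate F (O_right G H i h) (O_t G H) \<otimes>\<^bsub>F\<^esub> inv\<^bsub>F\<^esub> (O_right G H (i + 1) h)"
        and "h \<in> carrier H"
      then show ?thesis
        by (simp add: conjugate_def F_carrier \<Theta>_right \<Theta>_t conj c)
    next
      fix i j g h assume r: "r = commutator F (O_left G H i g) (O_right G H j h)"
        and gh: "g \<in> carrier G" "h \<in> carrier H" "i \<le> j"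
      let ?x = "shift L \<tau> i (\<phi> g)" and ?y = "shift L \<tau> j (\<psi> h)"
      have xy: "?x \<otimes>\<^bsub>L\<^esub> ?y = ?y \<otimes>\<^bsub>L\<^esub> ?x"
        using gh by (intro L.shift_commute GH c) auto
      have "\<Theta> r = inv\<^bsub>L\<^esub> ?x \<otimes>\<^bsub>L\<^esub> (inv\<^bsub>L\<^esub> ?y \<otimes>\<^bsub>L\<^esub> (?x \<otimes>\<^bsub>L\<^esub> ?y))"
        using gh by (simp add: r commutator_def F_carrier \<Theta>_left \<Theta>_right L.m_assoc c)
      then show ?thesis
        using gh by (simp add: xy L.cancel_left_inv c)
    qed
    ultimately show "r \<in> kernel F L \<Theta>"
      by (simp add: kernel_def)
  qed
  then have "N \<subseteq> kernel F L \<Theta>"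
    unfolding normal_closure_def using \<Theta>.normal_kernel by (intro Inter_lower) simp
  then obtain \<Phi> where \<Phi>: "\<Phi> \<in> hom (F Mod N) L" "\<And>x. x \<in> carrier F \<Longrightarrow> \<Phi> (N #>\<^bsub>F\<^esub> x) = \<Theta> x"
    using \<Theta>.FactGroup_universal_kernel[OF N.normal_axioms] by blast
  show ?thesis
  proof (intro bexI[of _ \<Phi>] conjI allI ballI)
    show "\<Phi> \<in> hom OGH L"
      using \<Phi>(1) by (simp add: O_group_def)
  qed (simp_all add: gen_G_def gen_H_def gen_t_def proj_def \<Phi>(2) F_carrier \<Theta>_left \<Theta>_right \<Theta>_t)
qed

text \<open>The group is generated by the copies and by \<open>t\<close>: the uniqueness statements for the two free products
and for the restricted powers are applied one inside the other.\<close>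
lemma O_hom_unique:
  assumes "group L" "\<Phi> \<in> hom OGH L" "\<Phi>' \<in> hom OGH L"
    and l: "\<And>i g. g \<in> carrier G \<Longrightarrow> \<Phi> (gen_G i g) = \<Phi>' (gen_G i g)"
    and r: "\<And>i h. h \<in> carrier H \<Longrightarrow> \<Phi> (gen_H i h) = \<Phi>' (gen_H i h)"
    and t: "\<Phi> gen_t = \<Phi>' gen_t"
    and x: "x \<in> carrier OGH"
  shows "\<Phi> x = \<Phi>' x"
proof -
  interpret L: group L by fact
  note h = hom_compose[OF proj_hom assms(2)] hom_compose[OF proj_hom assms(3)]
  let ?inl = "fp_inl (free_product (power_group G) (power_group H)) integer_group"
  let ?inr = "fp_inr (free_product (power_group G) (power_group H)) integer_group"
  let ?f = "\<Phi> \<circ> proj" and ?f' = "\<Phi>' \<circ> proj"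
  have inl: "?inl \<in> hom (free_product (power_group G) (power_group H)) F"
    unfolding O_free_def by (rule OF.fp_inl_hom)
  have "?f y = ?f' y" if "y \<in> carrier F" for y
  proof (rule OF.free_product_hom_unique[OF L.group_axioms])
    show "?f \<in> hom (free_product (free_product (power_group G) (power_group H)) integer_group) L"
      "?f' \<in> hom (free_product (free_product (power_group G) (power_group H)) integer_group) L"
      "y \<in> carrier (free_product (free_product (power_group G) (power_group H)) integer_group)"
      using h that by (simp_all add: O_free_def)
  next
    fix z assume z: "z \<in> carrier (free_product (power_group G) (power_group H))"
    have "(?f \<circ> ?inl) z = (?f' \<circ> ?inl) z"
    proof (rule PF.free_product_hom_unique[OF L.group_axioms _ _ _ _ z])
      fix a assume a: "a \<in> carrier (power_group G)"
      have "(?f \<circ> ?inl \<circ> fp_inl (power_group G) (power_group H)) a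
          = (?f' \<circ> ?inl \<circ> fp_inl (power_group G) (power_group H)) a"
      proof (rule G.power_group_hom_unique[OF L.group_axioms _ _ _ a])
        fix i g assume "g \<in> carrier G"
        then show "(?f \<circ> ?inl \<circ> fp_inl (power_group G) (power_group H)) (copy G i g)
            = (?f' \<circ> ?inl \<circ> fp_inl (power_group G) (power_group H)) (copy G i g)"
          using l[of g i] by (simp add: gen_G_def O_left_def)
      qed (intro hom_compose[OF PF.fp_inl_hom] hom_compose[OF inl] h)+
      then show "(?f \<circ> ?inl) (fp_inl (power_group G) (power_group H) a)
          = (?f' \<circ> ?inl) (fp_inl (power_group G) (power_group H) a)"
        by simp
    next
      fix a assume a: "a \<in> carrier (power_group H)"
      have "(?f \<circ> ?inl \<circ> fp_inr (power_group G) (power_group H)) a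
          = (?f' \<circ> ?inl \<circ> fp_inr (power_group G) (power_group H)) a"
      proof (rule H.power_group_hom_unique[OF L.group_axioms _ _ _ a])
        fix i g assume "g \<in> carrier H"
        then show "(?f \<circ> ?inl \<circ> fp_inr (power_group G) (power_group H)) (copy H i g)
            = (?f' \<circ> ?inl \<circ> fp_inr (power_group G) (power_group H)) (copy H i g)"
          using r[of g i] by (simp add: gen_H_def O_right_def)
      qed (intro hom_compose[OF PF.fp_inr_hom] hom_compose[OF inl] h)+
      then show "(?f \<circ> ?inl) (fp_inr (power_group G) (power_group H) a)
          = (?f' \<circ> ?inl) (fp_inr (power_group G) (power_group H) a)"
        by simp
    qed (intro hom_compose[OF inl] h)+
    then show "?f (?inl z) = ?f' (?inl z)"
      by simp
  next
    fix n :: int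
    have "?inr \<in> hom integer_group F"
      unfolding O_free_def by (rule OF.fp_inr_hom)
    then interpret inr: group_hom integer_group F ?inr
      by unfold_locales
    interpret f: group_hom F L ?f using h by unfold_locales
    interpret f': group_hom F L ?f' using h by unfold_locales
    have "?inr n = O_t G H [^]\<^bsub>F\<^esub> n"
      using inr.hom_int_pow[of 1 n] by (simp add: O_t_def)
    moreover have "?f (O_t G H) = ?f' (O_t G H)"
      using t by (simp add: gen_t_def)
    ultimately show "?f (?inr n) = ?f' (?inr n)"
      using f.hom_int_pow[OF O_t_carrier, of n] f'.hom_int_pow[OF O_t_carrier, of n] by simp
  qed
  with x show ?thesis
    by (auto simp: carrier_OGH)
qed

end

section \<open>Renaming the letters of a presentation\<close>

lemma semigroup_presentation_rename:
  assumes "semigroup_presentation \<Sigma> R" "inj f"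
  shows "semigroup_presentation (f ` \<Sigma>) (map_prod (map f) (map f) ` R)"
  using assms unfolding semigroup_presentation_def
  by (fastforce simp: inj_map_eq_map)

lemma complex_map_rename:
  assumes "semigroup_presentation \<Sigma> R" "f ` \<Sigma> \<subseteq> \<Sigma>'" "map_prod (map f) (map f) ` R \<subseteq> R'"
  shows "complex_map (squier_complex \<Sigma> R) (squier_complex \<Sigma>' R') (map f)
    (\<lambda>(p, u, v, q). (map f p, map f u, map f v, map f q))"
proof -
  interpret serre_complex "squier_complex \<Sigma> R"
    using assms(1) by (rule serre_squier_complex)
  have mono: "map f u \<in> lists \<Sigma>'" if "u \<in> lists \<Sigma>" for u
    using that assms(2) by (auto simp: image_subset_iff)
  have mono': "(map f u, map f v) \<in> R'" if "(u, v) \<in> R" for u v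
    using that assms(3) by force
  show ?thesis
  proof
    fix c assume "c \<in> cells (squier_complex \<Sigma> R)"
    then obtain p l1 r1 z l2 r2 q where c: "c = squier_cell p l1 r1 z l2 r2 q"
      "p \<in> lists \<Sigma>" "z \<in> lists \<Sigma>" "q \<in> lists \<Sigma>" "(l1, r1) \<in> R" "(l2, r2) \<in> R"
      unfolding cells_squier_complex by blast
    have "map (\<lambda>(p, u, v, q). (map f p, map f u, map f v, map f q)) c
        = squier_cell (map f p) (map f l1) (map f r1) (map f z) (map f l2) (map f r2) (map f q)"
      by (simp add: c squier_cell_def)
    then show "map (\<lambda>(p, u, v, q). (map f p, map f u, map f v, map f q)) c \<in> cells (squier_complex \<Sigma>' R')"
      unfolding cells_squier_complex using c mono mono' by blast
  next
    fix e assume "e \<in> edges (squier_complex \<Sigma> R)"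
    then show "(case e of (p, u, v, q) \<Rightarrow> (map f p, map f u, map f v, map f q)) \<in> edges (squier_complex \<Sigma>' R')"
      using mono mono' by (cases e) auto
  qed (use mono in \<open>auto\<close>)
qed

text \<open>This makes it possible to draw the letters of both given presentations, and the new letters, from one
sum type, so that the given Squier complexes become subcomplexes of the new one.\<close>
lemma diagram_group_rename:
  assumes "semigroup_presentation \<Sigma> R" "inj f" "w \<in> lists \<Sigma>" "w \<noteq> []"
  shows "diagram_group \<Sigma> R w \<cong> diagram_group (f ` \<Sigma>) (map_prod (map f) (map f) ` R) (map f w)"
  unfolding diagram_group_def
proof (rule pi1_iso)
  let ?R = "map_prod (map f) (map f) ` R"
  have gf: "map (inv_into UNIV f) (map f u) = u" for u
    using assms(2) by (simp add: comp_def)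
  have fg: "map f (map (inv_into UNIV f) u) = u" if "u \<in> lists (f ` \<Sigma>)" for u
    using that by (auto simp: f_inv_into_f[of _ f UNIV] intro!: map_idI)
  have P: "semigroup_presentation (f ` \<Sigma>) ?R"
    using assms(1,2) by (rule semigroup_presentation_rename)
  show "complex_map (squier_complex \<Sigma> R) (squier_complex (f ` \<Sigma>) ?R) (map f)
      (\<lambda>(p, u, v, q). (map f p, map f u, map f v, map f q))"
    using assms(1) by (rule complex_map_rename) auto
  show "complex_map (squier_complex (f ` \<Sigma>) ?R) (squier_complex \<Sigma> R) (map (inv_into UNIV f))
      (\<lambda>(p, u, v, q). (map (inv_into UNIV f) p, map (inv_into UNIV f) u, map (inv_into UNIV f) v, map (inv_into UNIV f) q))"
    using P by (rule complex_map_rename) (use assms(2) in \<open>auto simp: image_comp comp_def\<close>)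
  show "w \<in> verts (squier_complex \<Sigma> R)" "map (inv_into UNIV f) (map f w) = w"
    using assms gf by simp_all
  show "(\<lambda>(p, u, v, q). (map (inv_into UNIV f) p, map (inv_into UNIV f) u, map (inv_into UNIV f) v, map (inv_into UNIV f) q))
      ((\<lambda>(p, u, v, q). (map f p, map f u, map f v, map f q)) e) = e"
    if "e \<in> edges (squier_complex \<Sigma> R)" for e
    using gf by (cases e) simp
  show "(\<lambda>(p, u, v, q). (map f p, map f u, map f v, map f q))
      ((\<lambda>(p, u, v, q). (map (inv_into UNIV f) p, map (inv_into UNIV f) u, map (inv_into UNIV f) v, map (inv_into UNIV f) q)) e) = e"
    if "e \<in> edges (squier_complex (f ` \<Sigma>) ?R)" for e
    using that fg semigroup_presentationD[OF P] by (cases e) (simp, blast)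
qed

section \<open>Words with a marked letter\<close>

lemma split_unique:
  assumes "p @ x # q = p' @ x # q'" "x \<notin> set p'" "x \<notin> set q'"
  shows "p = p' \<and> q = q'"
  using assms by (auto simp: append_eq_append_conv2 append_eq_Cons_conv Cons_eq_append_conv)

lemma split_first:
  assumes "p @ x # q = p' @ x # q'" "x \<notin> set p" "x \<notin> set p'"
  shows "p = p' \<and> q = q'"
  using assms by (auto simp: append_eq_append_conv2 append_eq_Cons_conv Cons_eq_append_conv)

lemma split_last:
  assumes "p @ x # q = p' @ x # q'" "x \<notin> set q" "x \<notin> set q'"
  shows "p = p' \<and> q = q'"
  using assms by (auto simp: append_eq_append_conv2 append_eq_Cons_conv Cons_eq_append_conv)

text \<open>A subword that avoids a letter \<open>x\<close> lies on one side of every occurrence of \<open>x\<close>. All parsing below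
consists in applying this to brackets and markers.\<close>
lemma subword_beside:
  assumes "p @ u @ q = s @ x # t" "x \<notin> set u" "u \<noteq> []"
  obtains q' where "q = q' @ x # t" "s = p @ u @ q'"
    | p' where "p = s @ x # p'" "p' @ u @ q = t"
  using assms by (auto simp: append_eq_append_conv2 append_eq_Cons_conv Cons_eq_append_conv)

locale bracketing =
  fixes bo bc :: 'l
begin

text \<open>Every word is enclosed in its own pair of brackets. Without them a rule could be applied across the
border of two neighbouring words.\<close>
definition blk :: "'l list list \<Rightarrow> 'l list" where
  "blk us = concat (map (\<lambda>u. bo # u @ [bc]) us)"

lemma blk_simps [simp]:
  "blk [] = []" "blk (u # us) = bo # u @ bc # blk us" "blk (us @ vs) = blk us @ blk vs"
  by (simp_all add: blk_def)

lemma set_blk: "set (blk us) \<subseteq> {bo, bc} \<union> \<Union> (set ` set us)"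
  by (induction us) auto

lemma subword_of_blocks:
  assumes "p @ u @ q = blk us @ t" "bo \<notin> set u" "bc \<notin> set u" "u \<noteq> []"
  obtains us1 x y us2 where "us = us1 @ (x @ u @ y) # us2" "p = blk us1 @ bo # x" "q = y @ bc # blk us2 @ t"
    | p' where "p = blk us @ p'" "p' @ u @ q = t"
  using assms
proof (induction us arbitrary: p thesis)
  case Nil
  then show ?case by simp
next
  case (Cons w us)
  from Cons.prems(3,4,6) obtain p1 where p1: "p = bo # p1" "p1 @ u @ q = w @ bc # blk us @ t"
    by (cases p; cases u) auto
  from p1(2) show ?case
  proof (rule subword_beside)
    fix q' assume "q = q' @ bc # blk us @ t" "w = p1 @ u @ q'"
    then show thesis
      using Cons.prems(1)[of "[]" p1 q' us] p1 by simp
  next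
    fix p' assume p': "p1 = w @ bc # p'" "p' @ u @ q = blk us @ t"
    show thesis
    proof (rule Cons.IH[OF _ _ p'(2)])
      fix us1 x y us2
      assume "us = us1 @ (x @ u @ y) # us2" "p' = blk us1 @ bo # x" "q = y @ bc # blk us2 @ t"
      then show thesis
        using Cons.prems(1)[of "w # us1" x y us2] p1 p' by simp
    next
      fix p'' assume "p' = blk us @ p''" "p'' @ u @ q = t"
      then show thesis
        using Cons.prems(2)[of p''] p1 p' by simp
    qed (use Cons.prems in auto)
  qed (use Cons.prems in auto)
qed

lemma last_block:
  assumes "p @ bo # w @ [bc] = blk us" "bo \<notin> set w" "\<forall>u\<in>set us. bo \<notin> set u" "bo \<noteq> bc"
  obtains us' where "us = us' @ [w]" "p = blk us'"
proof (cases us rule: rev_cases)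
  case Nil
  with assms show ?thesis by simp
next
  case (snoc us' w')
  then have "p @ bo # w = blk us' @ bo # w'"
    using assms by simp
  then have "p = blk us' \<and> w = w'"
    by (rule split_last) (use assms snoc in auto)
  with that snoc show ?thesis by simp
qed

lemma first_block:
  assumes "bo # w @ bc # q = blk us @ t" "bc \<notin> set w" "\<forall>u\<in>set us. bc \<notin> set u" "t = [] \<or> hd t \<noteq> bo"
  obtains us' where "us = w # us'" "q = blk us' @ t"
proof (cases us)
  case Nil
  with assms show ?thesis by (cases t) auto
next
  case (Cons w' us')
  then have "w @ bc # q = w' @ bc # (blk us' @ t)"
    using assms by simp
  then have "w = w' \<and> q = blk us' @ t"
    by (rule split_first) (use assms Cons in auto)
  with that Cons show ?thesis by simp
qed

lemma blk_inject:
  assumes "blk us = blk vs" "\<forall>u\<in>set us. bc \<notin> set u" "\<forall>u\<in>set vs. bc \<notin> set u"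
  shows "us = vs"
  using assms
proof (induction us arbitrary: vs)
  case Nil
  then show ?case by (cases vs) auto
next
  case (Cons u us)
  then have "bo # u @ bc # blk us = blk vs @ []" by simp
  then obtain vs' where "vs = u # vs'" "blk us = blk vs' @ []"
    by (rule first_block) (use Cons.prems in auto)
  with Cons show ?case by simp
qed

end

section \<open>The presentation\<close>

text \<open>The letters \<open>a\<close>, \<open>b\<close>, \<open>c\<close>, \<open>bo\<close>, \<open>bc\<close> are new. In the comments, \<open>bo\<close> and \<open>bc\<close> are written as square
brackets.\<close>
locale O_presentation = bracketing bo bc
  for bo bc :: 'l +
  fixes \<Sigma>1 \<Sigma>2 :: "'l set" and R1 R2 :: "('l list \<times> 'l list) set" and w1 w2 :: "'l list"
    and a b c :: 'l
  assumes pres1: "semigroup_presentation \<Sigma>1 R1" and w1: "w1 \<in> lists \<Sigma>1" "w1 \<noteq> []"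
    and pres2: "semigroup_presentation \<Sigma>2 R2" and w2: "w2 \<in> lists \<Sigma>2" "w2 \<noteq> []"
    and disjoint: "\<Sigma>1 \<inter> \<Sigma>2 = {}"
    and distinct: "distinct [a, b, c, bo, bc]"
    and fresh: "a \<notin> \<Sigma>1 \<union> \<Sigma>2" "b \<notin> \<Sigma>1 \<union> \<Sigma>2" "c \<notin> \<Sigma>1 \<union> \<Sigma>2" "bo \<notin> \<Sigma>1 \<union> \<Sigma>2" "bc \<notin> \<Sigma>1 \<union> \<Sigma>2"
begin

definition \<Sigma> :: "'l set" where
  "\<Sigma> = \<Sigma>1 \<union> \<Sigma>2 \<union> {a, b, c, bo, bc}"

text \<open>The new rules are \<open>a = a[w\<^sub>1]\<close>, \<open>[w\<^sub>1]c = c[w\<^sub>2]\<close> and \<open>b = [w\<^sub>2]b\<close>. The outer two create blocks at the ends of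
the word, and the middle one moves the border \<open>c\<close> between the two kinds of blocks.\<close>
definition R :: "('l list \<times> 'l list) set" where
  "R = R1 \<union> R2 \<union> {([a], a # bo # w1 @ [bc]), (bo # w1 @ [bc, c], c # bo # w2 @ [bc]),
    ([b], bo # w2 @ [bc, b])}"

lemma letters_distinct [simp]:
  "a \<noteq> b" "a \<noteq> c" "a \<noteq> bo" "a \<noteq> bc" "b \<noteq> c" "b \<noteq> bo" "b \<noteq> bc" "c \<noteq> bo" "c \<noteq> bc" "bo \<noteq> bc"
  "b \<noteq> a" "c \<noteq> a" "bo \<noteq> a" "bc \<noteq> a" "c \<noteq> b" "bo \<noteq> b" "bc \<noteq> b" "bo \<noteq> c" "bc \<noteq> c" "bc \<noteq> bo"
  using distinct by auto

lemma letters_in [simp]: "a \<in> \<Sigma>" "b \<in> \<Sigma>" "c \<in> \<Sigma>" "bo \<in> \<Sigma>" "bc \<in> \<Sigma>"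
  by (simp_all add: \<Sigma>_def)

lemma sub_alphabets: "\<Sigma>1 \<subseteq> \<Sigma>" "\<Sigma>2 \<subseteq> \<Sigma>" "R1 \<subseteq> R" "R2 \<subseteq> R"
  by (auto simp: \<Sigma>_def R_def)

lemma not_marker:
  assumes "u \<in> lists \<Sigma>1 \<or> u \<in> lists \<Sigma>2"
  shows "a \<notin> set u" "b \<notin> set u" "c \<notin> set u" "bo \<notin> set u" "bc \<notin> set u"
  using assms fresh by (auto simp: in_lists_conv_set)

lemmas w_not_marker [simp] = not_marker[OF disjI1[OF w1(1)]] not_marker[OF disjI2[OF w2(1)]]

definition rule :: "'l list \<Rightarrow> 'l list \<Rightarrow> bool" where
  "rule u v \<longleftrightarrow> (u, v) \<in> R \<or> (v, u) \<in> R"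

definition rule1 :: "'l list \<Rightarrow> 'l list \<Rightarrow> bool" where
  "rule1 u v \<longleftrightarrow> (u, v) \<in> R1 \<or> (v, u) \<in> R1"

definition rule2 :: "'l list \<Rightarrow> 'l list \<Rightarrow> bool" where
  "rule2 u v \<longleftrightarrow> (u, v) \<in> R2 \<or> (v, u) \<in> R2"

lemma rule1D: "rule1 u v \<Longrightarrow> u \<in> lists \<Sigma>1 \<and> v \<in> lists \<Sigma>1 \<and> u \<noteq> [] \<and> v \<noteq> []"
  unfolding rule1_def using semigroup_presentationD[OF pres1] by metis

lemma rule2D: "rule2 u v \<Longrightarrow> u \<in> lists \<Sigma>2 \<and> v \<in> lists \<Sigma>2 \<and> u \<noteq> [] \<and> v \<noteq> []"
  unfolding rule2_def using semigroup_presentationD[OF pres2] by metis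

lemma rule_cases:
  assumes "rule u v"
  obtains (one) "rule1 u v" | (two) "rule2 u v"
    | (a) "u = [a]" "v = a # bo # w1 @ [bc]" | (a') "v = [a]" "u = a # bo # w1 @ [bc]"
    | (c) "u = bo # w1 @ [bc, c]" "v = c # bo # w2 @ [bc]"
    | (c') "v = bo # w1 @ [bc, c]" "u = c # bo # w2 @ [bc]"
    | (b) "u = [b]" "v = bo # w2 @ [bc, b]" | (b') "v = [b]" "u = bo # w2 @ [bc, b]"
  using assms unfolding rule_def rule1_def rule2_def R_def by blast

lemma presentation: "semigroup_presentation \<Sigma> R"
proof -
  have in_R: "u \<in> lists \<Sigma> \<and> v \<in> lists \<Sigma> \<and> u \<noteq> [] \<and> v \<noteq> []" if "(u, v) \<in> R" for u v
  proof -
    have "rule u v"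
      using that by (simp add: rule_def)
    moreover have "w1 \<in> lists \<Sigma>" "w2 \<in> lists \<Sigma>"
      using w1 w2 sub_alphabets lists_mono by blast+
    ultimately show ?thesis
    proof (cases rule: rule_cases)
      case one
      then show ?thesis
        using rule1D lists_mono[OF sub_alphabets(1)] by blast
    next
      case two
      then show ?thesis
        using rule2D lists_mono[OF sub_alphabets(2)] by blast
    qed auto
  qed
  have R1: "u \<in> lists \<Sigma>1 \<and> v \<in> lists \<Sigma>1 \<and> u \<noteq> []" if "(u, v) \<in> R1" for u v
    using rule1D[of u v] that by (simp add: rule1_def)
  have R2: "u \<in> lists \<Sigma>2 \<and> v \<in> lists \<Sigma>2 \<and> u \<noteq> []" if "(u, v) \<in> R2" for u v
    using rule2D[of u v] that by (simp add: rule2_def)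
  have anti: "(v, u) \<notin> R" if uv: "(u, v) \<in> R" for u v
  proof
    assume vu: "(v, u) \<in> R"
    consider "(u, v) \<in> R1" | "(u, v) \<in> R2" | "u = [a]" "v = a # bo # w1 @ [bc]"
      | "u = bo # w1 @ [bc, c]" "v = c # bo # w2 @ [bc]" | "u = [b]" "v = bo # w2 @ [bc, b]"
      using uv unfolding R_def by blast
    then show False
    proof cases
      case 1
      have "(v, u) \<notin> R1"
        using 1 pres1 unfolding semigroup_presentation_def by blast
      moreover have "(v, u) \<notin> R2"
        using R1[OF 1] R2[of v u] disjoint by (cases u) auto
      moreover have "a \<notin> set u" "b \<notin> set u" "c \<notin> set u" "a \<notin> set v" "b \<notin> set v" "c \<notin> set v"
        using R1[OF 1] not_marker by blast+
      ultimately show False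
        using vu unfolding R_def by auto
    next
      case 2
      have "(v, u) \<notin> R2"
        using 2 pres2 unfolding semigroup_presentation_def by blast
      moreover have "(v, u) \<notin> R1"
        using R2[OF 2] R1[of v u] disjoint by (cases u) auto
      moreover have "a \<notin> set u" "b \<notin> set u" "c \<notin> set u" "a \<notin> set v" "b \<notin> set v" "c \<notin> set v"
        using R2[OF 2] not_marker by blast+
      ultimately show False
        using vu unfolding R_def by auto
    next
      case 3
      then have "(v, u) \<notin> R1" "(v, u) \<notin> R2"
        using R1[of v u] R2[of v u] not_marker[of u] by auto
      with 3 vu show False
        unfolding R_def by auto
    next
      case 4
      then have "(v, u) \<notin> R1" "(v, u) \<notin> R2"
        using R1[of v u] R2[of v u] not_marker[of u] by auto
      with 4 vu show False
        unfolding R_def by auto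
    next
      case 5
      then have "(v, u) \<notin> R1" "(v, u) \<notin> R2"
        using R1[of v u] R2[of v u] not_marker[of u] by auto
      with 5 vu show False
        unfolding R_def by auto
    qed
  qed
  show ?thesis
    unfolding semigroup_presentation_def using in_R anti by blast
qed

lemma rule_nonempty: "rule u v \<Longrightarrow> u \<noteq> []"
  unfolding rule_def using semigroup_presentationD[OF presentation] by metis

text \<open>The words that can be reached from \<open>acb\<close>: blocks over the first alphabet to the left of \<open>c\<close>, and blocks
over the second alphabet to its right.\<close>
definition enc :: "'l list list \<Rightarrow> 'l list list \<Rightarrow> 'l list" where
  "enc us vs = a # blk us @ c # blk vs @ [b]"

lemma base_word: "enc [] [] \<in> lists \<Sigma>" "enc [] [] \<noteq> []"
  by (simp_all add: enc_def)

lemma marker_notin_blk: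
  assumes "us \<in> lists (lists \<Sigma>1) \<or> us \<in> lists (lists \<Sigma>2)"
  shows "a \<notin> set (blk us)" "b \<notin> set (blk us)" "c \<notin> set (blk us)"
    "\<forall>u\<in>set us. bo \<notin> set u" "\<forall>u\<in>set us. bc \<notin> set u"
proof -
  have u: "u \<in> lists \<Sigma>1 \<or> u \<in> lists \<Sigma>2" if "u \<in> set us" for u
    using assms that by (auto simp: in_lists_conv_set)
  then show "\<forall>u\<in>set us. bo \<notin> set u" "\<forall>u\<in>set us. bc \<notin> set u"
    using not_marker by blast+
  show "a \<notin> set (blk us)" "b \<notin> set (blk us)" "c \<notin> set (blk us)"
    using set_blk[of us] not_marker[OF u] by auto
qed

lemma blk_letters:
  assumes "us \<in> lists (lists \<Sigma>1) \<or> us \<in> lists (lists \<Sigma>2)"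
  shows "blk us \<in> lists \<Sigma>"
  using assms by (induction us) (use sub_alphabets in \<open>auto simp: in_lists_conv_set\<close>)

lemma enc_inject:
  assumes "enc us vs = enc us' vs'" "us \<in> lists (lists \<Sigma>1)" "us' \<in> lists (lists \<Sigma>1)"
    "vs \<in> lists (lists \<Sigma>2)" "vs' \<in> lists (lists \<Sigma>2)"
  shows "us = us' \<and> vs = vs'"
proof -
  have "blk us @ c # blk vs @ [b] = blk us' @ c # blk vs' @ [b]"
    using assms(1) by (simp add: enc_def)
  then have "blk us = blk us' \<and> blk vs @ [b] = blk vs' @ [b]"
    by (rule split_first) (use assms marker_notin_blk in auto)
  then show ?thesis
    using assms blk_inject[OF _ marker_notin_blk(5) marker_notin_blk(5), of us us']
      blk_inject[OF _ marker_notin_blk(5) marker_notin_blk(5), of vs vs'] by simp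
qed

text \<open>Where can a rule be applied in the part of the word to the right of \<open>c\<close>? Either inside a block, or at
the letter \<open>b\<close>. The following lemmas extend the answer to the left, up to \<open>a\<close>.\<close>
lemma parse_right:
  assumes eq: "p @ u @ q = blk vs @ [b]" and uv: "rule u v" and vs: "vs \<in> lists (lists \<Sigma>2)"
  obtains (H) vs1 x y vs2 where "rule2 u v" "vs = vs1 @ (x @ u @ y) # vs2"
      "p = blk vs1 @ bo # x" "q = y @ bc # blk vs2 @ [b]"
    | (b) "u = [b]" "v = bo # w2 @ [bc, b]" "p = blk vs" "q = []"
    | (b') vs' where "u = bo # w2 @ [bc, b]" "v = [b]" "vs = vs' @ [w2]" "p = blk vs'" "q = []"
proof -
  have "set u \<subseteq> set (blk vs @ [b])"
    unfolding eq[symmetric] by auto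
  then have ac: "a \<notin> set u" "c \<notin> set u"
    using marker_notin_blk[of vs] vs by auto
  have letters: thesis if u: "u \<in> lists (\<Sigma>1 \<union> \<Sigma>2)" 
  proof -
    have m: "b \<notin> set u" "bo \<notin> set u" "bc \<notin> set u"
      using u fresh by (auto simp: in_lists_conv_set)
    from eq m(2,3) rule_nonempty[OF uv] show thesis
    proof (rule subword_of_blocks)
      fix us1 x y us2
      assume d: "vs = us1 @ (x @ u @ y) # us2" "p = blk us1 @ bo # x" "q = y @ bc # blk us2 @ [b]"
      then have "u \<in> lists \<Sigma>2"
        using vs by simp
      then have "\<not> rule1 u v"
        using rule1D[of u v] disjoint by (cases u) auto
      then have "rule2 u v"
        by (rule_tac rule_cases[OF uv]) (use m ac in auto)
      then show thesis
        using H d by simp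
    next
      fix p' assume "p = blk vs @ p'" "p' @ u @ q = [b]"
      then have "set u \<subseteq> {b}"
        by (metis append_is_Nil_conv set_append sup.bounded_iff list.set(1,2) sup_ge1 sup_ge2 subset_trans order_refl)
      with m rule_nonempty[OF uv] show thesis
        by (cases u) auto
    qed
  qed
  show thesis
    using uv
  proof (cases rule: rule_cases)
    case one
    then show thesis
      using letters rule1D[of u v] lists_mono[of \<Sigma>1 "\<Sigma>1 \<union> \<Sigma>2"] by blast
  next
    case two
    then show thesis
      using letters rule2D[of u v] lists_mono[of \<Sigma>2 "\<Sigma>1 \<union> \<Sigma>2"] by blast
  next
    case b
    then have "p @ b # q = blk vs @ b # []"
      using eq by simp
    then have "p = blk vs \<and> q = []"
      by (rule split_unique) (use marker_notin_blk[of vs] vs in auto)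
    with b that(2) show thesis by simp
  next
    case b'
    then have "(p @ bo # w2 @ [bc]) @ b # q = blk vs @ b # []"
      using eq by simp
    then have *: "p @ bo # w2 @ [bc] = blk vs \<and> q = []"
      by (rule split_unique) (use marker_notin_blk[of vs] vs in auto)
    then obtain vs' where "vs = vs' @ [w2]" "p = blk vs'"
      using last_block[of p w2 vs] marker_notin_blk[of vs] vs by auto
    with * b' that(3) show thesis by simp
  qed (use ac in simp_all)
qed

lemma parse_middle:
  assumes eq: "p @ u @ q = blk us @ c # blk vs @ [b]" and uv: "rule u v"
    and us: "us \<in> lists (lists \<Sigma>1)" and vs: "vs \<in> lists (lists \<Sigma>2)"
  obtains (G) us1 x y us2 where "rule1 u v" "us = us1 @ (x @ u @ y) # us2"
      "p = blk us1 @ bo # x" "q = y @ bc # blk us2 @ c # blk vs @ [b]"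
    | (c) us' where "u = bo # w1 @ [bc, c]" "v = c # bo # w2 @ [bc]" "us = us' @ [w1]"
      "p = blk us'" "q = blk vs @ [b]"
    | (c') vs' where "u = c # bo # w2 @ [bc]" "v = bo # w1 @ [bc, c]" "vs = w2 # vs'"
      "p = blk us" "q = blk vs' @ [b]"
    | (right) p' where "p = blk us @ c # p'" "p' @ u @ q = blk vs @ [b]"
proof -
  have "set u \<subseteq> set (blk us @ c # blk vs @ [b])"
    unfolding eq[symmetric] by auto
  then have a: "a \<notin> set u"
    using marker_notin_blk[of vs] marker_notin_blk[of us] vs us by auto
  have letters: thesis if u: "u \<in> lists (\<Sigma>1 \<union> \<Sigma>2)" 
  proof -
    have m: "b \<notin> set u" "c \<notin> set u" "bo \<notin> set u" "bc \<notin> set u"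
      using u fresh by (auto simp: in_lists_conv_set)
    from eq m(3,4) rule_nonempty[OF uv] show thesis
    proof (rule subword_of_blocks)
      fix us1 x y us2
      assume d: "us = us1 @ (x @ u @ y) # us2" "p = blk us1 @ bo # x" "q = y @ bc # blk us2 @ c # blk vs @ [b]"
      then have "u \<in> lists \<Sigma>1"
        using us by simp
      then have "\<not> rule2 u v"
        using rule2D[of u v] disjoint by (cases u) auto
      then have "rule1 u v"
        by (rule_tac rule_cases[OF uv]) (use m a in auto)
      then show thesis
        using G d by simp
    next
      fix p' assume p': "p = blk us @ p'" "p' @ u @ q = c # blk vs @ [b]"
      with m rule_nonempty[OF uv] obtain p'' where "p' = c # p''"
        by (cases p'; cases u) auto
      with p' that right show thesis by simp
    qed
  qed
  have beside: thesis if "c \<notin> set u" "b \<in> set u"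
    using eq that(1) rule_nonempty[OF uv]
  proof (rule subword_beside)
    fix q' assume "blk us = p @ u @ q'"
    then have "b \<in> set (blk us)"
      using that by simp
    then show thesis
      using marker_notin_blk[of us] us by simp
  next
    fix p' assume "p = blk us @ c # p'" "p' @ u @ q = blk vs @ [b]"
    then show thesis by (rule right)
  qed
  show thesis
    using uv
  proof (cases rule: rule_cases)
    case one
    then show thesis
      using letters rule1D[of u v] lists_mono[of \<Sigma>1 "\<Sigma>1 \<union> \<Sigma>2"] by blast
  next
    case two
    then show thesis
      using letters rule2D[of u v] lists_mono[of \<Sigma>2 "\<Sigma>1 \<union> \<Sigma>2"] by blast
  next
    case b
    then show thesis using beside by simp
  next
    case b'
    then show thesis using beside by simp
  next
    case c
    then have "(p @ bo # w1 @ [bc]) @ c # q = blk us @ c # blk vs @ [b]"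
      using eq by simp
    then have *: "p @ bo # w1 @ [bc] = blk us \<and> q = blk vs @ [b]"
      by (rule split_unique) (use marker_notin_blk[of vs] marker_notin_blk[of us] vs us in auto)
    then obtain us' where "us = us' @ [w1]" "p = blk us'"
      using last_block[of p w1 us] marker_notin_blk[of us] us by auto
    with * c that(2) show thesis by simp
  next
    case c'
    then have "p @ c # bo # w2 @ bc # q = blk us @ c # blk vs @ [b]"
      using eq by simp
    then have *: "p = blk us \<and> bo # w2 @ bc # q = blk vs @ [b]"
      by (rule split_unique) (use marker_notin_blk[of vs] marker_notin_blk[of us] vs us in auto)
    then obtain vs' where "vs = w2 # vs'" "q = blk vs' @ [b]"
      using first_block[of w2 q vs "[b]"] marker_notin_blk[of vs] vs by auto
    with * c' that(3) show thesis by simp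
  qed (use a in simp_all)
qed

lemma parse_enc:
  assumes eq: "p @ u @ q = enc us vs" and uv: "rule u v"
    and us: "us \<in> lists (lists \<Sigma>1)" and vs: "vs \<in> lists (lists \<Sigma>2)"
  obtains (a) "u = [a]" "v = a # bo # w1 @ [bc]" "p = []" "q = blk us @ c # blk vs @ [b]"
    | (a') us' where "u = a # bo # w1 @ [bc]" "v = [a]" "us = w1 # us'" "p = []" "q = blk us' @ c # blk vs @ [b]"
    | (middle) p' where "p = a # p'" "p' @ u @ q = blk us @ c # blk vs @ [b]"
proof -
  have m: "a \<notin> set (blk us @ c # blk vs @ [b])"
    using marker_notin_blk[of vs] marker_notin_blk[of us] vs us by auto
  show thesis
  proof (cases "a \<in> set u")
    case False
    then obtain p' where "p = a # p'"
      using eq rule_nonempty[OF uv] by (cases p; cases u) (auto simp: enc_def)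
    with eq show thesis
      by (intro middle) (auto simp: enc_def)
  next
    case True
    then consider "u = [a]" "v = a # bo # w1 @ [bc]" | "u = a # bo # w1 @ [bc]" "v = [a]"
      by (rule_tac rule_cases[OF uv]) (use rule1D[of u v] rule2D[of u v] not_marker[of u] in auto)
    then show thesis
    proof cases
      case 1
      then have "p @ a # q = [] @ a # blk us @ c # blk vs @ [b]"
        using eq by (simp add: enc_def)
      then have "p = [] \<and> q = blk us @ c # blk vs @ [b]"
        by (rule split_unique) (use m in auto)
      with 1 that(1) show thesis by simp
    next
      case 2
      then have "p @ a # bo # w1 @ bc # q = [] @ a # blk us @ c # blk vs @ [b]"
        using eq by (simp add: enc_def)
      then have *: "p = [] \<and> bo # w1 @ bc # q = blk us @ c # blk vs @ [b]"
        by (rule split_unique) (use m in auto)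
      then obtain us' where "us = w1 # us'" "q = blk us' @ c # blk vs @ [b]"
        using first_block[of w1 q us "c # blk vs @ [b]"] marker_notin_blk[of us] us by auto
      with * 2 that(2) show thesis by simp
    qed
  qed
qed

text \<open>The answer for a word whose leading part is the rest of a block. It locates the second edge of a 2-cell
whose first edge lies in that block.\<close>
lemma parse_block_rest:
  assumes eq: "p @ u @ q = y @ bc # t" and uv: "rule u v" and y: "y \<in> lists \<Sigma>1 \<or> y \<in> lists \<Sigma>2"
  obtains (inside) q' where "rule1 u v \<or> rule2 u v" "y = p @ u @ q'" "q = q' @ bc # t"
    | (beyond) p' where "p = y @ bc # p'" "p' @ u @ q = t"
proof (cases "rule1 u v \<or> rule2 u v")
  case True
  then have "bc \<notin> set u"
    using rule1D[of u v] rule2D[of u v] not_marker[of u] by blast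
  from eq this rule_nonempty[OF uv] show thesis
    by (rule subword_beside) (use True that in auto)
next
  case False
  then obtain x u' where u: "u = x # u'" "x \<in> {a, b, c, bo}"
    by (rule_tac rule_cases[OF uv]) auto
  then have "x \<notin> set y" "x \<noteq> bc"
    using not_marker[OF y] by auto
  with eq u have "\<exists>p'. p = y @ bc # p' \<and> p' @ u @ q = t"
    by (auto simp: append_eq_append_conv2 append_eq_Cons_conv Cons_eq_append_conv)
  with beyond show thesis by blast
qed

end

section \<open>The component of the base word\<close>

locale O_complex = O_presentation bo bc \<Sigma>1 \<Sigma>2 R1 R2 w1 w2 a b c
    + K1: rooted_complex "squier_complex \<Sigma>1 R1" S1 w1 \<gamma>1
    + K2: rooted_complex "squier_complex \<Sigma>2 R2" S2 w2 \<gamma>2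
  for bo bc :: 'l and \<Sigma>1 \<Sigma>2 R1 R2 w1 w2 a b c and S1 S2 :: "'l list set" and \<gamma>1 \<gamma>2
begin

(* Membership in lists is kept folded, since it is the form in which the rules below are stated. *)
declare in_lists_conv_set [simp del] in_listsD [rule del] in_listsI [rule del]

abbreviation K where "K \<equiv> squier_complex \<Sigma> R"
abbreviation lifts where "lifts \<alpha> \<beta> \<equiv> map (lift \<alpha> \<beta>)"

sublocale K: serre_complex K
  using presentation by (rule serre_squier_complex)

lemma S1_words: "u \<in> S1 \<Longrightarrow> u \<in> lists \<Sigma>1"
  using K1.is_path_verts[OF K1.\<gamma>_path] by auto

lemma S2_words: "u \<in> S2 \<Longrightarrow> u \<in> lists \<Sigma>2"
  using K2.is_path_verts[OF K2.\<gamma>_path] by auto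

lemma lists_S1: "us \<in> lists S1 \<Longrightarrow> us \<in> lists (lists \<Sigma>1)"
  using S1_words by (auto simp: in_lists_conv_set)

lemma lists_S2: "vs \<in> lists S2 \<Longrightarrow> vs \<in> lists (lists \<Sigma>2)"
  using S2_words by (auto simp: in_lists_conv_set)

lemma words_in_\<Sigma> [simp]:
  "u \<in> S1 \<Longrightarrow> u \<in> lists \<Sigma>" "v \<in> S2 \<Longrightarrow> v \<in> lists \<Sigma>"
  "us \<in> lists S1 \<Longrightarrow> blk us \<in> lists \<Sigma>" "vs \<in> lists S2 \<Longrightarrow> blk vs \<in> lists \<Sigma>"
  "w1 \<in> lists \<Sigma>" "w2 \<in> lists \<Sigma>"
  using blk_letters[OF disjI1[OF lists_S1]] blk_letters[OF disjI2[OF lists_S2]]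
    S1_words lists_mono[OF sub_alphabets(1)] S2_words lists_mono[OF sub_alphabets(2)] w1 w2
  by (simp_all add: subset_iff)

lemma S1_step:
  assumes "x @ u @ y \<in> S1" "rule1 u v"
  shows "x @ v @ y \<in> S1" "x \<in> lists \<Sigma>1" "y \<in> lists \<Sigma>1" "(x, u, v, y) \<in> edges (squier_complex \<Sigma>1 R1)"
proof -
  show xy: "x \<in> lists \<Sigma>1" "y \<in> lists \<Sigma>1"
    using S1_words[OF assms(1)] by simp_all
  then show "(x, u, v, y) \<in> edges (squier_complex \<Sigma>1 R1)"
    using assms(2) by (simp add: rule1_def)
  from K1.component_closed[OF this] assms(1) show "x @ v @ y \<in> S1"
    by simp
qed

lemma S2_step:
  assumes "x @ u @ y \<in> S2" "rule2 u v"
  shows "x @ v @ y \<in> S2" "x \<in> lists \<Sigma>2" "y \<in> lists \<Sigma>2" "(x, u, v, y) \<in> edges (squier_complex \<Sigma>2 R2)"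
proof -
  show xy: "x \<in> lists \<Sigma>2" "y \<in> lists \<Sigma>2"
    using S2_words[OF assms(1)] by simp_all
  then show "(x, u, v, y) \<in> edges (squier_complex \<Sigma>2 R2)"
    using assms(2) by (simp add: rule2_def)
  from K2.component_closed[OF this] assms(1) show "x @ v @ y \<in> S2"
    by simp
qed

lemma rule_in_\<Sigma>: "rule u v \<Longrightarrow> u \<in> lists \<Sigma> \<and> v \<in> lists \<Sigma>"
  unfolding rule_def using semigroup_presentationD[OF presentation] by metis

lemma rules [simp]:
  "rule [a] (a # bo # w1 @ [bc])" "rule (a # bo # w1 @ [bc]) [a]"
  "rule (bo # w1 @ [bc, c]) (c # bo # w2 @ [bc])" "rule (c # bo # w2 @ [bc]) (bo # w1 @ [bc, c])"
  "rule [b] (bo # w2 @ [bc, b])" "rule (bo # w2 @ [bc, b]) [b]"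
  by (simp_all add: rule_def R_def)

definition S :: "'l list set" where
  "S = {enc us vs | us vs. us \<in> lists S1 \<and> vs \<in> lists S2}"

lemma enc_in_S: "us \<in> lists S1 \<Longrightarrow> vs \<in> lists S2 \<Longrightarrow> enc us vs \<in> S"
  by (auto simp: S_def)

text \<open>The complete list of edges that start in the component. The primed cases are rules read backwards.\<close>
lemma edge_cases:
  assumes eq: "p @ u @ q = enc us vs" and uv: "rule u v" and us: "us \<in> lists S1" and vs: "vs \<in> lists S2"
  obtains (a) "u = [a]" "v = a # bo # w1 @ [bc]" "p = []" "q = blk us @ c # blk vs @ [b]"
    | (a') us' where "u = a # bo # w1 @ [bc]" "v = [a]" "us = w1 # us'" "p = []"
      "q = blk us' @ c # blk vs @ [b]"
    | (G) us1 x y us2 where "rule1 u v" "us = us1 @ (x @ u @ y) # us2"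
      "p = a # blk us1 @ bo # x" "q = y @ bc # blk us2 @ c # blk vs @ [b]"
    | (c) us' where "u = bo # w1 @ [bc, c]" "v = c # bo # w2 @ [bc]" "us = us' @ [w1]"
      "p = a # blk us'" "q = blk vs @ [b]"
    | (c') vs' where "u = c # bo # w2 @ [bc]" "v = bo # w1 @ [bc, c]" "vs = w2 # vs'"
      "p = a # blk us" "q = blk vs' @ [b]"
    | (H) vs1 x y vs2 where "rule2 u v" "vs = vs1 @ (x @ u @ y) # vs2"
      "p = a # blk us @ c # blk vs1 @ bo # x" "q = y @ bc # blk vs2 @ [b]"
    | (b) "u = [b]" "v = bo # w2 @ [bc, b]" "p = a # blk us @ c # blk vs" "q = []"
    | (b') vs' where "u = bo # w2 @ [bc, b]" "v = [b]" "vs = vs' @ [w2]"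
      "p = a # blk us @ c # blk vs'" "q = []"
proof -
  note us' = lists_S1[OF us] and vs' = lists_S2[OF vs]
  from eq uv us' vs' show thesis
  proof (cases rule: parse_enc)
    case (middle p')
    from middle(2) uv us' vs' show thesis
    proof (cases rule: parse_middle)
      case (right p'')
      from right(2) uv vs' show thesis
        by (cases rule: parse_right) (use middle right that in auto)
    qed (use middle that in auto)
  qed (use that in auto)
qed

lemma S_closed:
  assumes "p @ u @ q \<in> S" "rule u v"
  shows "p @ v @ q \<in> S"
proof -
  obtain us vs where eq: "p @ u @ q = enc us vs" and us: "us \<in> lists S1" and vs: "vs \<in> lists S2"
    using assms(1) by (auto simp: S_def)
  from eq assms(2) us vs show ?thesis
  proof (cases rule: edge_cases)
    case a
    then show ?thesis
      using enc_in_S[of "w1 # us" vs] us vs K1.root by (simp add: enc_def)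
  next
    case (a' us')
    then show ?thesis
      using enc_in_S[of us' vs] us vs by (simp add: enc_def)
  next
    case (G us1 x y us2)
    then show ?thesis
      using enc_in_S[of "us1 @ (x @ v @ y) # us2" vs] us vs S1_step[of x u y v] by (simp add: enc_def)
  next
    case (c us')
    then show ?thesis
      using enc_in_S[of us' "w2 # vs"] us vs K2.root by (simp add: enc_def)
  next
    case (c' vs')
    then show ?thesis
      using enc_in_S[of "us @ [w1]" vs'] us vs K1.root by (simp add: enc_def)
  next
    case (H vs1 x y vs2)
    then show ?thesis
      using enc_in_S[of us "vs1 @ (x @ v @ y) # vs2"] us vs S2_step[of x u y v] by (simp add: enc_def)
  next
    case b
    then show ?thesis
      using enc_in_S[of us "vs @ [w2]"] us vs K2.root by (simp add: enc_def)
  next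
    case (b' vs')
    then show ?thesis
      using enc_in_S[of us vs'] us vs by (simp add: enc_def)
  qed
qed

subsection \<open>A spanning system of paths\<close>

lemma lifts_is_path:
  assumes "is_path K u P v" "\<alpha> \<in> lists \<Sigma>" "\<beta> \<in> lists \<Sigma>"
  shows "is_path K (\<alpha> @ u @ \<beta>) (lifts \<alpha> \<beta> P) (\<alpha> @ v @ \<beta>)"
  using complex_map.map_is_path[OF complex_map_lift assms(1)] presentation assms by blast

lemma K1_is_path:
  assumes "is_path (squier_complex \<Sigma>1 R1) u P v"
  shows "is_path K u P v"
  using complex_map.map_is_path[OF complex_map_lift[of _ _ \<Sigma> R "[]" "[]"] assms] pres1 sub_alphabets
  by (simp add: map_idI)

lemma K2_is_path:
  assumes "is_path (squier_complex \<Sigma>2 R2) u P v"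
  shows "is_path K u P v"
  using complex_map.map_is_path[OF complex_map_lift[of _ _ \<Sigma> R "[]" "[]"] assms] pres2 sub_alphabets
  by (simp add: map_idI)

lemmas \<gamma>1_path = K1_is_path[OF K1.\<gamma>_path] and \<gamma>2_path = K2_is_path[OF K2.\<gamma>_path]

text \<open>A path from \<open>a\<close> to \<open>a[u\<^sub>1]...[u\<^sub>n]\<close>: starting with the last word, it creates the block \<open>[w\<^sub>1]\<close> next to \<open>a\<close> and
transforms \<open>w\<^sub>1\<close> along the path that was chosen in the first given complex.\<close>
primrec left_path :: "'l list list \<Rightarrow> 'l squier_edge list" where
  "left_path [] = []"
| "left_path (u # us) = left_path us @
    ([], [a], a # bo # w1 @ [bc], blk us) # lifts [a, bo] (bc # blk us) (\<gamma>1 u)"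

text \<open>The mirror image, from \<open>b\<close> to \<open>[v\<^sub>1]...[v\<^sub>n]b\<close>. New blocks appear next to \<open>b\<close>, at the end of the list;
so the recursion runs over the reversed list.\<close>
primrec right_path_rev :: "'l list list \<Rightarrow> 'l squier_edge list" where
  "right_path_rev [] = []"
| "right_path_rev (v # vs) = right_path_rev vs @
    (blk (rev vs), [b], bo # w2 @ [bc, b], []) # lifts (blk (rev vs) @ [bo]) [bc, b] (\<gamma>2 v)"

definition right_path :: "'l list list \<Rightarrow> 'l squier_edge list" where
  "right_path vs = right_path_rev (rev vs)"

lemma right_path_simps [simp]:
  "right_path [] = []"
  "right_path (vs @ [v]) = right_path vs @
    (blk vs, [b], bo # w2 @ [bc, b], []) # lifts (blk vs @ [bo]) [bc, b] (\<gamma>2 v)"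
  by (simp_all add: right_path_def)

lemma is_path_Cons_edge:
  assumes "p \<in> lists \<Sigma>" "q \<in> lists \<Sigma>" "rule u v" "s = p @ u @ q" "is_path K (p @ v @ q) P t"
  shows "is_path K s ((p, u, v, q) # P) t"
  using assms by (simp add: rule_def)

lemma is_path_edge:
  assumes "p \<in> lists \<Sigma>" "q \<in> lists \<Sigma>" "rule u v" "s = p @ u @ q" "t = p @ v @ q"
  shows "is_path K s [(p, u, v, q)] t"
  using assms rule_in_\<Sigma>[of u v] semigroup_presentationD[OF presentation, of v u] by (auto simp: rule_def)

lemma left_path_is_path: "us \<in> lists S1 \<Longrightarrow> is_path K [a] (left_path us) (a # blk us)"
proof (induction us)
  case (Cons u us)
  have "is_path K ([a, bo] @ w1 @ (bc # blk us)) (lifts [a, bo] (bc # blk us) (\<gamma>1 u)) ([a, bo] @ u @ (bc # blk us))"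
    using Cons.prems by (intro lifts_is_path \<gamma>1_path) auto
  then have "is_path K (a # blk us) (([], [a], a # bo # w1 @ [bc], blk us) # lifts [a, bo] (bc # blk us) (\<gamma>1 u))
      (a # blk (u # us))"
    using Cons.prems by (intro is_path_Cons_edge) auto
  with Cons show ?case
    by (simp only: left_path.simps K.is_path_append) auto
qed simp

lemma right_path_is_path: "vs \<in> lists S2 \<Longrightarrow> is_path K [b] (right_path vs) (blk vs @ [b])"
proof (induction vs rule: rev_induct)
  case (snoc v vs)
  have "is_path K ((blk vs @ [bo]) @ w2 @ [bc, b]) (lifts (blk vs @ [bo]) [bc, b] (\<gamma>2 v)) ((blk vs @ [bo]) @ v @ [bc, b])"
    using snoc.prems by (intro lifts_is_path \<gamma>2_path) auto
  then have "is_path K (blk vs @ [b]) ((blk vs, [b], bo # w2 @ [bc, b], []) # lifts (blk vs @ [bo]) [bc, b] (\<gamma>2 v))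
      (blk (vs @ [v]) @ [b])"
    using snoc.prems by (intro is_path_Cons_edge) auto
  with snoc show ?case
    by (simp only: right_path_simps K.is_path_append) auto
qed simp

definition tree_path :: "'l list list \<Rightarrow> 'l list list \<Rightarrow> 'l squier_edge list" where
  "tree_path us vs = lifts [] [c, b] (left_path us) @ lifts (a # blk us @ [c]) [] (right_path vs)"

text \<open>The chosen paths as a function of the word. Words of the component determine their two lists of
blocks, so the description is unique.\<close>
definition \<gamma> :: "'l list \<Rightarrow> 'l squier_edge list" where
  "\<gamma> x = (THE P. \<exists>us\<in>lists S1. \<exists>vs\<in>lists S2. x = enc us vs \<and> P = tree_path us vs)"

lemma \<gamma>_enc:
  assumes "us \<in> lists S1" "vs \<in> lists S2"
  shows "\<gamma> (enc us vs) = tree_path us vs"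
  unfolding \<gamma>_def
proof (rule the_equality)
  show "P = tree_path us vs"
    if "\<exists>us'\<in>lists S1. \<exists>vs'\<in>lists S2. enc us vs = enc us' vs' \<and> P = tree_path us' vs'" for P
    using that enc_inject assms lists_S1 lists_S2 by metis
qed (use assms in blast)

lemma left_context_path:
  assumes "us \<in> lists S1" "\<beta> \<in> lists \<Sigma>"
  shows "is_path K (a # \<beta>) (lifts [] \<beta> (left_path us)) (a # blk us @ \<beta>)"
  using lifts_is_path[OF left_path_is_path[OF assms(1)], of "[]" \<beta>] assms by simp

lemma right_context_path:
  assumes "vs \<in> lists S2" "\<alpha> \<in> lists \<Sigma>"
  shows "is_path K (\<alpha> @ [b]) (lifts \<alpha> [] (right_path vs)) (\<alpha> @ blk vs @ [b])"
  using lifts_is_path[OF right_path_is_path[OF assms(1)], of \<alpha> "[]"] assms by simp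

lemma tree_path_is_path:
  assumes "us \<in> lists S1" "vs \<in> lists S2"
  shows "is_path K (enc [] []) (tree_path us vs) (enc us vs)"
proof -
  have "is_path K (enc [] []) (lifts [] [c, b] (left_path us)) (enc us [])"
    using left_context_path[of us "[c, b]"] assms by (simp add: enc_def)
  moreover have "is_path K (enc us []) (lifts (a # blk us @ [c]) [] (right_path vs)) (enc us vs)"
    using right_context_path[of vs "a # blk us @ [c]"] assms by (simp add: enc_def)
  ultimately show ?thesis
    unfolding tree_path_def K.is_path_append by blast
qed

sublocale KS: rooted_complex K S "enc [] []" \<gamma>
proof unfold_locales
  show "enc [] [] \<in> S"
    by (rule enc_in_S) auto
  show "\<gamma> (enc [] []) = []"
    by (simp add: \<gamma>_enc tree_path_def)
  show "is_path K (enc [] []) (\<gamma> u) u" if "u \<in> S" for u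
    using that by (auto simp: S_def \<gamma>_enc tree_path_is_path)
  show "tgt K e \<in> S" if "e \<in> edges K" "src K e \<in> S" for e
    using that S_closed by (cases e) (auto simp: rule_def)
qed

section \<open>Classes of edges in the diagram group\<close>

abbreviation DG where "DG \<equiv> pi1 K (enc [] [])"
text \<open>The product of the classes of the edges of a path. The lemmas below show that \<open>V\<close> is trivial on the outer
rules, and that its value on an edge in a block depends, apart from the edge itself, only on the number of
blocks between this block and \<open>c\<close>. First come the edges that prolong a chosen path; the others follow by the interchange law.\<close>
abbreviation V where "V \<equiv> path_val DG KS.edge_class"

sublocale SL: squier_labelling \<Sigma> R DG S KS.edge_class
  by unfold_locales (rule presentation)

lemma V_append: "is_path K u P v \<Longrightarrow> is_path K v Q w \<Longrightarrow> u \<in> S \<Longrightarrow> V (P @ Q) = V P \<otimes>\<^bsub>DG\<^esub> V Q"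
  by (rule KS.val_append)

lemma in_S [simp]:
  "us \<in> lists S1 \<Longrightarrow> vs \<in> lists S2 \<Longrightarrow> a # blk us @ c # blk vs @ [b] \<in> S"
  "us \<in> lists S1 \<Longrightarrow> a # blk us @ [c, b] \<in> S"
  "vs \<in> lists S2 \<Longrightarrow> a # c # blk vs @ [b] \<in> S"
  using enc_in_S[of us vs] enc_in_S[of us "[]"] enc_in_S[of "[]" vs] by (simp_all add: enc_def)

lemma V_tree:
  assumes "us \<in> lists S1" "vs \<in> lists S2" "us' \<in> lists S1" "vs' \<in> lists S2"
    and "tree_path us' vs' = tree_path us vs @ P" and "is_path K (enc us vs) P (enc us' vs')"
  shows "V P = \<one>\<^bsub>DG\<^esub>"
  using assms by (intro KS.val_tree) (auto simp: \<gamma>_enc enc_in_S)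

lemma V_right_tree:
  assumes "us \<in> lists S1" "vs \<in> lists S2"
  shows "V (lifts (a # blk us @ [c]) [] (right_path vs)) = \<one>\<^bsub>DG\<^esub>"
  using assms right_context_path[of vs "a # blk us @ [c]"]
  by (intro V_tree[of us "[]" us vs]) (auto simp: tree_path_def enc_def)

lemma V_a_tree:
  assumes "us \<in> lists S1"
  shows "V [([], [a], a # bo # w1 @ [bc], blk us @ [c, b])] = \<one>\<^bsub>DG\<^esub>"
  using assms K1.root
  by (intro V_tree[of us "[]" "w1 # us" "[]"] is_path_edge) (auto simp: tree_path_def enc_def K1.\<gamma>_root)

lemma V_b:
  assumes "us \<in> lists S1" "vs \<in> lists S2"
  shows "V [(a # blk us @ c # blk vs, [b], bo # w2 @ [bc, b], [])] = \<one>\<^bsub>DG\<^esub>"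
  using assms K2.root
  by (intro V_tree[of us vs us "vs @ [w2]"] is_path_edge) (auto simp: tree_path_def enc_def K2.\<gamma>_root)

lemma V_G_tree:
  assumes "us \<in> lists S1" "u \<in> S1"
  shows "V (lifts [a, bo] (bc # blk us @ [c, b]) (\<gamma>1 u)) = \<one>\<^bsub>DG\<^esub>"
  using assms K1.root lifts_is_path[OF \<gamma>1_path[OF assms(2)], of "[a, bo]" "bc # blk us @ [c, b]"]
  by (intro V_tree[of "w1 # us" "[]" "u # us" "[]"]) (auto simp: tree_path_def enc_def K1.\<gamma>_root)

lemma V_H_tree:
  assumes "us \<in> lists S1" "vs \<in> lists S2" "v \<in> S2"
  shows "V (lifts (a # blk us @ c # blk vs @ [bo]) [bc, b] (\<gamma>2 v)) = \<one>\<^bsub>DG\<^esub>"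
  using assms K2.root lifts_is_path[OF \<gamma>2_path[OF assms(3)], of "a # blk us @ c # blk vs @ [bo]" "[bc, b]"]
  by (intro V_tree[of us "vs @ [w2]" us "vs @ [v]"]) (auto simp: tree_path_def enc_def K2.\<gamma>_root)

text \<open>What happens to the left of \<open>c\<close> commutes with the creation of the blocks to its right, which has trivial
value by \<open>V_right_tree\<close>. So these blocks can be removed.\<close>
lemma V_strip_right:
  assumes P: "is_path K (a # blk us) P (a # blk us')" and us: "us \<in> lists S1" "us' \<in> lists S1"
    and vs: "vs \<in> lists S2"
  shows "V (lifts [] (c # blk vs @ [b]) P) = V (lifts [] [c, b] P)"
proof -
  have Q: "is_path K [c, b] (lifts [c] [] (right_path vs)) (c # blk vs @ [b])"
    using right_context_path[OF vs, of "[c]"] by simp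
  have "V (lifts [] ((c # blk vs @ [b]) @ []) P) = V (lifts [] ([c, b] @ []) P)"
    by (rule SL.square_trivial_right[OF P Q]) (use us vs V_right_tree in \<open>simp_all add: comp_def\<close>)
  then show ?thesis by simp
qed

lemma V_a:
  assumes us: "us \<in> lists S1" and vs: "vs \<in> lists S2"
  shows "V [([], [a], a # bo # w1 @ [bc], blk us @ c # blk vs @ [b])] = \<one>\<^bsub>DG\<^esub>"
proof -
  have "is_path K (a # blk us) [([], [a], a # bo # w1 @ [bc], blk us)] (a # blk (w1 # us))"
    using us by (intro is_path_edge) auto
  from V_strip_right[OF this us _ vs] show ?thesis
    using us K1.root V_a_tree[OF us] by simp
qed

lemma V_G_first:
  assumes us: "us \<in> lists S1" and vs: "vs \<in> lists S2" and u: "u \<in> S1"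
  shows "V (lifts [a, bo] (bc # blk us @ c # blk vs @ [b]) (\<gamma>1 u)) = \<one>\<^bsub>DG\<^esub>"
proof -
  have "is_path K (a # blk (w1 # us)) (lifts [a, bo] (bc # blk us) (\<gamma>1 u)) (a # blk (u # us))"
    using lifts_is_path[OF \<gamma>1_path[OF u], of "[a, bo]" "bc # blk us"] us by simp
  from V_strip_right[OF this _ _ vs] show ?thesis
    using us u K1.root V_G_tree[OF us u] by (simp add: comp_def)
qed

text \<open>The counterpart of \<open>V_right_tree\<close> in front of an arbitrary rest of the word. It needs the two preceding
lemmas, because only the prefix \<open>left_path us\<close> of a chosen path is at hand if that rest has blocks of
its own.\<close>
lemma V_left_tree:
  assumes "us \<in> lists S1" and us': "us' \<in> lists S1" and vs: "vs \<in> lists S2"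
  shows "V (lifts [] (blk us' @ c # blk vs @ [b]) (left_path us)) = \<one>\<^bsub>DG\<^esub>"
  using assms(1)
proof (induction us rule: list.induct)
  case (Cons u us)
  let ?\<beta> = "blk us' @ c # blk vs @ [b]"
  let ?e = "([], [a], a # bo # w1 @ [bc], blk us @ ?\<beta>)" and ?g = "lifts [a, bo] (bc # blk us @ ?\<beta>) (\<gamma>1 u)"
  have us: "us \<in> lists S1" "u \<in> S1" "us @ us' \<in> lists S1"
    using Cons.prems us' by auto
  have \<beta>: "?\<beta> \<in> lists \<Sigma>"
    using us' vs by simp
  have 1: "is_path K (a # ?\<beta>) (lifts [] ?\<beta> (left_path us)) (a # blk us @ ?\<beta>)"
    using us \<beta> by (intro left_context_path)
  have 2: "is_path K (a # blk us @ ?\<beta>) [?e] (a # bo # w1 @ bc # blk us @ ?\<beta>)"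
    using us \<beta> by (intro is_path_edge) auto
  have 3: "is_path K (a # bo # w1 @ bc # blk us @ ?\<beta>) ?g (a # bo # u @ bc # blk us @ ?\<beta>)"
    using lifts_is_path[OF \<gamma>1_path[OF us(2)], of "[a, bo]" "bc # blk us @ ?\<beta>"] us \<beta> by simp
  have 23: "is_path K (a # blk us @ ?\<beta>) ([?e] @ ?g) (a # bo # u @ bc # blk us @ ?\<beta>)"
    using 2 3 K.is_path_append by blast
  have S: "a # ?\<beta> \<in> S" "a # blk us @ ?\<beta> \<in> S"
    using in_S(1)[OF us' vs] in_S(1)[OF us(3) vs] by simp_all
  have eq: "lifts [] ?\<beta> (left_path (u # us)) = lifts [] ?\<beta> (left_path us) @ [?e] @ ?g"
    by (simp add: comp_def)
  have "V (lifts [] ?\<beta> (left_path (u # us))) = V (lifts [] ?\<beta> (left_path us)) \<otimes>\<^bsub>DG\<^esub> (V [?e] \<otimes>\<^bsub>DG\<^esub> V ?g)"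
    unfolding eq using V_append[OF 1 23 S(1)] V_append[OF 2 3 S(2)] by simp
  also have "\<dots> = \<one>\<^bsub>DG\<^esub> \<otimes>\<^bsub>DG\<^esub> (\<one>\<^bsub>DG\<^esub> \<otimes>\<^bsub>DG\<^esub> \<one>\<^bsub>DG\<^esub>)"
    using V_a[OF us(3) vs] V_G_first[OF us(3) vs us(2)]
    by (simp only: Cons.IH[OF us(1)] blk_simps append_assoc)
  finally show ?case
    by (simp only: KS.L.l_one KS.L.one_closed)
qed simp

lemma V_strip_left:
  assumes Q: "is_path K (blk us1 @ c # blk vs1 @ [b]) Q (blk us2 @ c # blk vs2 @ [b])"
    and us: "us \<in> lists S1" "us1 \<in> lists S1" "us2 \<in> lists S1" and vs: "vs1 \<in> lists S2" "vs2 \<in> lists S2"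
  shows "V (lifts (a # blk us) [] Q) = V (lifts [a] [] Q)"
proof -
  have "V (lifts ([] @ a # blk us) [] Q) = V (lifts ([] @ [a]) [] Q)"
  proof (rule SL.square_trivial_left[OF left_path_is_path[OF us(1)] Q])
    show "[] @ [a] @ (blk us1 @ c # blk vs1 @ [b]) @ [] \<in> S"
      using us vs by simp
  qed (use us vs V_left_tree in simp_all)
  then show ?thesis by simp
qed

lemma V_G_anywhere:
  assumes us: "us \<in> lists S1" "us' \<in> lists S1" and vs: "vs \<in> lists S2" and u: "u \<in> S1"
  shows "V (lifts (a # blk us @ [bo]) (bc # blk us' @ c # blk vs @ [b]) (\<gamma>1 u)) = \<one>\<^bsub>DG\<^esub>"
proof -
  have "is_path K (blk (w1 # us') @ c # blk vs @ [b]) (lifts [bo] (bc # blk us' @ c # blk vs @ [b]) (\<gamma>1 u))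
      (blk (u # us') @ c # blk vs @ [b])"
    using lifts_is_path[OF \<gamma>1_path[OF u], of "[bo]" "bc # blk us' @ c # blk vs @ [b]"] us vs by simp
  from V_strip_left[OF this us(1) _ _ vs vs] show ?thesis
    using us u K1.root V_G_first[OF us(2) vs u] by (simp add: comp_def)
qed

text \<open>The value of a path in a block to the left of \<open>c\<close> if \<open>d\<close> blocks lie between this block and \<open>c\<close>, in a
normal form of the context. By lemma \<open>V_G\<close> no other context needs to be considered.\<close>
definition G_val :: "nat \<Rightarrow> 'l squier_edge list \<Rightarrow> 'l squier_edge list set" where
  "G_val d P = V (lifts [a, bo] (bc # blk (replicate d w1) @ [c, b]) P)"

text \<open>The blocks between a given block and \<open>c\<close> may contain any words. Each of them is transformed from \<open>w\<^sub>1\<close> along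
its chosen path, with trivial value, and this commutes with what happens in the given block.\<close>
lemma V_G_replace:
  assumes P: "is_path (squier_complex \<Sigma>1 R1) u P u'" and u: "u \<in> S1"
    and us: "us1 \<in> lists S1" "us2 \<in> lists S1"
  shows "V (lifts [a, bo] (bc # blk (us1 @ us2) @ [c, b]) P)
    = V (lifts [a, bo] (bc # blk (us1 @ replicate (length us2) w1) @ [c, b]) P)"
  using us
proof (induction us2 arbitrary: us1)
  case (Cons x us2)
  have u': "u' \<in> S1"
    using K1.path_in_component[OF P u] .
  have x: "x \<in> S1" "us2 \<in> lists S1"
    using Cons.prems by auto
  let ?Q = "lifts (bc # blk us1 @ [bo]) (bc # blk us2 @ [c, b]) (\<gamma>1 x)"
  have Q: "is_path K (bc # blk (us1 @ w1 # us2) @ [c, b]) ?Q (bc # blk (us1 @ x # us2) @ [c, b])"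
    using lifts_is_path[OF \<gamma>1_path[OF x(1)], of "bc # blk us1 @ [bo]" "bc # blk us2 @ [c, b]"] Cons.prems
    by simp
  have "V (lifts [a, bo] ((bc # blk (us1 @ x # us2) @ [c, b]) @ []) P)
      = V (lifts [a, bo] ((bc # blk (us1 @ w1 # us2) @ [c, b]) @ []) P)"
  proof (rule SL.square_trivial_right[OF K1_is_path[OF P] Q])
    show "[a, bo] @ u @ (bc # blk (us1 @ w1 # us2) @ [c, b]) @ [] \<in> S"
      using in_S(2)[of "u # us1 @ w1 # us2"] u Cons.prems K1.root by simp
    show "V (lifts ([a, bo] @ u) [] ?Q) = \<one>\<^bsub>DG\<^esub>" "V (lifts ([a, bo] @ u') [] ?Q) = \<one>\<^bsub>DG\<^esub>"
      using V_G_anywhere[of "u # us1" us2 "[]" x] V_G_anywhere[of "u' # us1" us2 "[]" x] u u' x Cons.prems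
      by (simp_all add: comp_def)
  qed simp_all
  then show ?case
    using Cons.IH[of "us1 @ [w1]"] Cons.prems K1.root by simp
qed simp

lemma V_G:
  assumes P: "is_path (squier_complex \<Sigma>1 R1) u P u'" and u: "u \<in> S1"
    and us: "us1 \<in> lists S1" "us2 \<in> lists S1" and vs: "vs \<in> lists S2"
  shows "V (lifts (a # blk us1 @ [bo]) (bc # blk us2 @ c # blk vs @ [b]) P) = G_val (length us2) P"
proof -
  have u': "u' \<in> S1"
    using K1.path_in_component[OF P u] .
  have "is_path K (blk (u # us2) @ c # blk vs @ [b]) (lifts [bo] (bc # blk us2 @ c # blk vs @ [b]) P)
      (blk (u' # us2) @ c # blk vs @ [b])"
    using lifts_is_path[OF K1_is_path[OF P], of "[bo]" "bc # blk us2 @ c # blk vs @ [b]"] us vs by simp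
  from V_strip_left[OF this us(1) _ _ vs vs]
  have "V (lifts (a # blk us1 @ [bo]) (bc # blk us2 @ c # blk vs @ [b]) P)
      = V (lifts [a, bo] (bc # blk us2 @ c # blk vs @ [b]) P)"
    using u u' us by (simp add: comp_def)
  also have "\<dots> = V (lifts [a, bo] (bc # blk us2 @ [c, b]) P)"
  proof -
    have "is_path K (a # blk (u # us2)) (lifts [a, bo] (bc # blk us2) P) (a # blk (u' # us2))"
      using lifts_is_path[OF K1_is_path[OF P], of "[a, bo]" "bc # blk us2"] us by simp
    from V_strip_right[OF this _ _ vs] show ?thesis
      using u u' us by (simp add: comp_def)
  qed
  also have "\<dots> = G_val (length us2) P"
    using V_G_replace[OF P u _ us(2), of "[]"] by (simp add: G_val_def)
  finally show ?thesis .
qed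

lemma V_right_tree':
  assumes us: "us \<in> lists S1" and vs: "vs \<in> lists S2" and "vs' \<in> lists S2"
  shows "V (lifts (a # blk us @ c # blk vs) [] (right_path vs')) = \<one>\<^bsub>DG\<^esub>"
  using assms(3)
proof (induction vs' rule: rev_induct)
  case (snoc v vs')
  let ?\<alpha> = "a # blk us @ c # blk vs"
  let ?e = "(?\<alpha> @ blk vs', [b], bo # w2 @ [bc, b], [])" and ?g = "lifts (?\<alpha> @ blk vs' @ [bo]) [bc, b] (\<gamma>2 v)"
  have vs': "vs' \<in> lists S2" "v \<in> S2" "vs @ vs' \<in> lists S2"
    using snoc.prems vs by auto
  have \<alpha>: "?\<alpha> \<in> lists \<Sigma>"
    using us vs by simp
  have 1: "is_path K (?\<alpha> @ [b]) (lifts ?\<alpha> [] (right_path vs')) (?\<alpha> @ blk vs' @ [b])"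
    using vs' \<alpha> by (intro right_context_path)
  have 2: "is_path K (?\<alpha> @ blk vs' @ [b]) [?e] (?\<alpha> @ blk vs' @ bo # w2 @ [bc, b])"
    using vs' \<alpha> by (intro is_path_edge) auto
  have 3: "is_path K (?\<alpha> @ blk vs' @ bo # w2 @ [bc, b]) ?g (?\<alpha> @ blk vs' @ bo # v @ [bc, b])"
    using lifts_is_path[OF \<gamma>2_path[OF vs'(2)], of "?\<alpha> @ blk vs' @ [bo]" "[bc, b]"] vs' \<alpha> by simp
  have 23: "is_path K (?\<alpha> @ blk vs' @ [b]) ([?e] @ ?g) (?\<alpha> @ blk vs' @ bo # v @ [bc, b])"
    using 2 3 K.is_path_append by blast
  have S: "?\<alpha> @ [b] \<in> S" "?\<alpha> @ blk vs' @ [b] \<in> S"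
    using in_S(1)[OF us vs] in_S(1)[OF us vs'(3)] by simp_all
  have eq: "lifts ?\<alpha> [] (right_path (vs' @ [v])) = lifts ?\<alpha> [] (right_path vs') @ [?e] @ ?g"
    by (simp add: comp_def)
  have "V (lifts ?\<alpha> [] (right_path (vs' @ [v]))) = V (lifts ?\<alpha> [] (right_path vs')) \<otimes>\<^bsub>DG\<^esub> (V [?e] \<otimes>\<^bsub>DG\<^esub> V ?g)"
    unfolding eq using V_append[OF 1 23 S(1)] V_append[OF 2 3 S(2)] by simp
  also have "\<dots> = \<one>\<^bsub>DG\<^esub> \<otimes>\<^bsub>DG\<^esub> (\<one>\<^bsub>DG\<^esub> \<otimes>\<^bsub>DG\<^esub> \<one>\<^bsub>DG\<^esub>)"
    using V_b[OF us vs'(3)] V_H_tree[OF us vs'(3,2)]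
    by (simp only: snoc.IH[OF vs'(1)] blk_simps append_assoc append_Cons)
  finally show ?case
    by (simp only: KS.L.l_one KS.L.one_closed)
qed simp

lemma V_H_strip_right:
  assumes P: "is_path K v P v'" and v: "v \<in> S2" "v' \<in> S2"
    and us: "us \<in> lists S1" and vs: "vs1 \<in> lists S2" "vs2 \<in> lists S2"
  shows "V (lifts (a # blk us @ c # blk vs1 @ [bo]) (bc # blk vs2 @ [b]) P)
    = V (lifts (a # blk us @ c # blk vs1 @ [bo]) [bc, b] P)"
proof -
  let ?\<alpha> = "a # blk us @ c # blk vs1"
  have P': "is_path K (bo # v @ [bc]) (lifts [bo] [bc] P) (bo # v' @ [bc])"
    using lifts_is_path[OF P, of "[bo]" "[bc]"] by simp
  have "V (lifts ?\<alpha> ((blk vs2 @ [b]) @ []) (lifts [bo] [bc] P)) = V (lifts ?\<alpha> ([b] @ []) (lifts [bo] [bc] P))"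
  proof (rule SL.square_trivial_right[OF P' right_path_is_path[OF vs(2)]])
    show "?\<alpha> @ (bo # v @ [bc]) @ [b] @ [] \<in> S"
      using in_S(1)[of us "vs1 @ [v]"] us vs v by simp
    show "V (lifts (?\<alpha> @ bo # v @ [bc]) [] (right_path vs2)) = \<one>\<^bsub>DG\<^esub>"
      "V (lifts (?\<alpha> @ bo # v' @ [bc]) [] (right_path vs2)) = \<one>\<^bsub>DG\<^esub>"
      using V_right_tree'[of us "vs1 @ [v]" vs2] V_right_tree'[of us "vs1 @ [v']" vs2] us vs v by simp_all
  qed (use us vs in simp_all)
  then show ?thesis by (simp add: comp_def)
qed

lemma V_H_anywhere:
  assumes "us \<in> lists S1" "vs1 \<in> lists S2" "vs2 \<in> lists S2" "v \<in> S2"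
  shows "V (lifts (a # blk us @ c # blk vs1 @ [bo]) (bc # blk vs2 @ [b]) (\<gamma>2 v)) = \<one>\<^bsub>DG\<^esub>"
  using V_H_strip_right[OF \<gamma>2_path[OF assms(4)] K2.root assms(4) assms(1-3)] V_H_tree[OF assms(1,2,4)] by simp

text \<open>The counterpart of \<open>G_val\<close> for blocks to the right of \<open>c\<close>: \<open>d\<close> blocks lie between \<open>c\<close> and the block.\<close>
definition H_val :: "nat \<Rightarrow> 'l squier_edge list \<Rightarrow> 'l squier_edge list set" where
  "H_val d P = V (lifts (a # c # blk (replicate d w2) @ [bo]) [bc, b] P)"

lemma V_H_replace:
  assumes P: "is_path (squier_complex \<Sigma>2 R2) v P v'" and v: "v \<in> S2"
    and vs: "vs1 \<in> lists S2" "vs2 \<in> lists S2"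
  shows "V (lifts (a # c # blk (vs1 @ vs2) @ [bo]) [bc, b] P)
    = V (lifts (a # c # blk (vs1 @ replicate (length vs2) w2) @ [bo]) [bc, b] P)"
  using vs
proof (induction vs2 arbitrary: vs1)
  case (Cons x vs2)
  have v': "v' \<in> S2"
    using K2.path_in_component[OF P v] .
  have x: "x \<in> S2" "vs2 \<in> lists S2"
    using Cons.prems by auto
  let ?Q = "lifts (bc # blk vs2 @ [bo]) [bc, b] P"
  let ?\<alpha> = "a # c # blk vs1 @ [bo]"
  have Q: "is_path K (bc # blk (vs2 @ [v]) @ [b]) ?Q (bc # blk (vs2 @ [v']) @ [b])"
    using lifts_is_path[OF K2_is_path[OF P], of "bc # blk vs2 @ [bo]" "[bc, b]"] Cons.prems
    by simp
  have "V (lifts (?\<alpha> @ x) [] ?Q) = V (lifts (?\<alpha> @ w2) [] ?Q)"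
  proof (rule SL.square_trivial_left[OF \<gamma>2_path[OF x(1)] Q])
    show "?\<alpha> @ w2 @ (bc # blk (vs2 @ [v]) @ [b]) @ [] \<in> S"
      using in_S(3)[of "vs1 @ w2 # vs2 @ [v]"] v Cons.prems K2.root by simp
    show "V (lifts ?\<alpha> ((bc # blk (vs2 @ [v]) @ [b]) @ []) (\<gamma>2 x)) = \<one>\<^bsub>DG\<^esub>"
      "V (lifts ?\<alpha> ((bc # blk (vs2 @ [v']) @ [b]) @ []) (\<gamma>2 x)) = \<one>\<^bsub>DG\<^esub>"
      using V_H_anywhere[of "[]" vs1 "vs2 @ [v]" x] V_H_anywhere[of "[]" vs1 "vs2 @ [v']" x] v v' x Cons.prems
      by simp_all
  qed (use Cons.prems in simp_all)
  then show ?case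
    using Cons.IH[of "vs1 @ [w2]"] Cons.prems K2.root by (simp add: comp_def)
qed simp

lemma V_H:
  assumes P: "is_path (squier_complex \<Sigma>2 R2) v P v'" and v: "v \<in> S2"
    and us: "us \<in> lists S1" and vs: "vs1 \<in> lists S2" "vs2 \<in> lists S2"
  shows "V (lifts (a # blk us @ c # blk vs1 @ [bo]) (bc # blk vs2 @ [b]) P) = H_val (length vs1) P"
proof -
  have v': "v' \<in> S2"
    using K2.path_in_component[OF P v] .
  have "is_path K (blk [] @ c # blk (vs1 @ v # vs2) @ [b]) (lifts (c # blk vs1 @ [bo]) (bc # blk vs2 @ [b]) P)
      (blk [] @ c # blk (vs1 @ v' # vs2) @ [b])"
    using lifts_is_path[OF K2_is_path[OF P], of "c # blk vs1 @ [bo]" "bc # blk vs2 @ [b]"] vs by simp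
  from V_strip_left[OF this us]
  have "V (lifts (a # blk us @ c # blk vs1 @ [bo]) (bc # blk vs2 @ [b]) P)
      = V (lifts (a # blk [] @ c # blk vs1 @ [bo]) (bc # blk vs2 @ [b]) P)"
    using v v' vs by (simp add: comp_def)
  also have "\<dots> = V (lifts (a # blk [] @ c # blk vs1 @ [bo]) [bc, b] P)"
    using V_H_strip_right[OF K2_is_path[OF P] v v', of "[]" vs1 vs2] vs by simp
  also have "\<dots> = H_val (length vs1) P"
    using V_H_replace[OF P v _ vs(1), of "[]"] by (simp add: H_val_def)
  finally show ?thesis .
qed

text \<open>The image of the generator \<open>t\<close>: the border moves one block to the left. By \<open>V_c\<close> the value is the same
in every context.\<close>
definition T where
  "T = V [([a], bo # w1 @ [bc, c], c # bo # w2 @ [bc], [b])]"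

lemma V_c:
  assumes us: "us \<in> lists S1" and vs: "vs \<in> lists S2"
  shows "V [(a # blk us, bo # w1 @ [bc, c], c # bo # w2 @ [bc], blk vs @ [b])] = T"
proof -
  let ?l = "bo # w1 @ [bc, c]" and ?r = "c # bo # w2 @ [bc]"
  have "is_path K (blk [w1] @ c # blk vs @ [b]) [([], ?l, ?r, blk vs @ [b])] (blk [] @ c # blk (w2 # vs) @ [b])"
    using vs by (intro is_path_edge) auto
  from V_strip_left[OF this us]
  have "V [(a # blk us, ?l, ?r, blk vs @ [b])] = V [([a], ?l, ?r, blk vs @ [b])]"
    using vs K1.root K2.root by simp
  also have "\<dots> = V (lifts [a] ((blk vs @ [b]) @ []) [([], ?l, ?r, [])])"
    by simp
  also have "\<dots> = V (lifts [a] ([b] @ []) [([], ?l, ?r, [])])"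
  proof (rule SL.square_trivial_right[OF _ right_path_is_path[OF vs]])
    show "is_path K ?l [([], ?l, ?r, [])] ?r"
      by (intro is_path_edge) auto
    show "[a] @ ?l @ [b] @ [] \<in> S"
      using in_S(2)[of "[w1]"] K1.root by simp
    show "V (lifts ([a] @ ?l) [] (right_path vs)) = \<one>\<^bsub>DG\<^esub>" "V (lifts ([a] @ ?r) [] (right_path vs)) = \<one>\<^bsub>DG\<^esub>"
      using V_right_tree'[of "[w1]" "[]" vs] V_right_tree'[of "[]" "[w2]" vs] K1.root K2.root vs by simp_all
  qed simp_all
  finally show ?thesis
    by (simp add: T_def)
qed

end

section \<open>The relations of \<open>O(G, H)\<close> in the diagram group\<close>

context O_complex
begin

lemma replicate_w1 [simp]: "replicate n w1 \<in> lists S1"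
  using K1.root by (induction n) auto

lemma replicate_w2 [simp]: "replicate n w2 \<in> lists S2"
  using K2.root by (induction n) auto

lemma group_DG: "group DG"
  by (rule KS.L.group_axioms)

lemma T_carrier [simp]: "T \<in> carrier DG"
proof -
  have "is_path K (enc [w1] []) [([a], bo # w1 @ [bc, c], c # bo # w2 @ [bc], [b])] (enc [] [w2])"
    by (intro is_path_edge) (auto simp: enc_def)
  then show ?thesis
    unfolding T_def by (rule KS.val_carrier) (use K1.root in \<open>simp add: enc_in_S\<close>)
qed

lemma G_val_path:
  assumes "is_path (squier_complex \<Sigma>1 R1) u P u'"
  shows "is_path K (enc (u # replicate d w1) []) (lifts [a, bo] (bc # blk (replicate d w1) @ [c, b]) P)
    (enc (u' # replicate d w1) [])"
  using lifts_is_path[OF K1_is_path[OF assms], of "[a, bo]" "bc # blk (replicate d w1) @ [c, b]"]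
  by (simp add: enc_def)

lemma G_val_carrier:
  assumes "is_path (squier_complex \<Sigma>1 R1) u P u'" "u \<in> S1"
  shows "G_val d P \<in> carrier DG"
  unfolding G_val_def using assms by (intro KS.val_carrier[OF G_val_path]) (auto intro: enc_in_S)

lemma G_val_append:
  assumes "is_path (squier_complex \<Sigma>1 R1) u P u'" "is_path (squier_complex \<Sigma>1 R1) u' Q u''" "u \<in> S1"
  shows "G_val d (P @ Q) = G_val d P \<otimes>\<^bsub>DG\<^esub> G_val d Q"
  unfolding G_val_def map_append using assms
  by (intro V_append[OF G_val_path G_val_path]) (auto intro: enc_in_S)

lemma H_val_path:
  assumes "is_path (squier_complex \<Sigma>2 R2) v P v'"
  shows "is_path K (enc [] (replicate d w2 @ [v])) (lifts (a # c # blk (replicate d w2) @ [bo]) [bc, b] P)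
    (enc [] (replicate d w2 @ [v']))"
  using lifts_is_path[OF K2_is_path[OF assms], of "a # c # blk (replicate d w2) @ [bo]" "[bc, b]"]
  by (simp add: enc_def)

lemma H_val_carrier:
  assumes "is_path (squier_complex \<Sigma>2 R2) v P v'" "v \<in> S2"
  shows "H_val d P \<in> carrier DG"
  unfolding H_val_def using assms by (intro KS.val_carrier[OF H_val_path]) (auto intro: enc_in_S)

lemma H_val_append:
  assumes "is_path (squier_complex \<Sigma>2 R2) v P v'" "is_path (squier_complex \<Sigma>2 R2) v' Q v''" "v \<in> S2"
  shows "H_val d (P @ Q) = H_val d P \<otimes>\<^bsub>DG\<^esub> H_val d Q"
  unfolding H_val_def map_append using assms
  by (intro V_append[OF H_val_path H_val_path]) (auto intro: enc_in_S)

lemma G_hom_exists: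
  "\<exists>\<phi>\<in>hom (pi1 (squier_complex \<Sigma>1 R1) w1) DG. \<forall>P. is_path (squier_complex \<Sigma>1 R1) w1 P w1 \<longrightarrow>
    \<phi> (K1.cls w1 P) = G_val 0 P"
proof -
  interpret G: labelling "squier_complex \<Sigma>1 R1" DG S1 "\<lambda>e. KS.edge_class (lift [a, bo] [bc, c, b] e)"
  proof (rule labelling_pullback[where fe = "lift [a, bo] [bc, c, b]" and f = KS.edge_class])
    show "complex_map (squier_complex \<Sigma>1 R1) K (\<lambda>u. [a, bo] @ u @ [bc, c, b]) (lift [a, bo] [bc, c, b])"
      using pres1 sub_alphabets by (intro complex_map_lift) auto
    show "labelling K DG S KS.edge_class"
      by (rule KS.labelling_axioms)
    show "(\<lambda>u. [a, bo] @ u @ [bc, c, b]) ` S1 \<subseteq> S"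
      using enc_in_S[of "[_]" "[]"] by (auto simp: enc_def)
    show "tgt (squier_complex \<Sigma>1 R1) e \<in> S1"
      if "e \<in> edges (squier_complex \<Sigma>1 R1)" "src (squier_complex \<Sigma>1 R1) e \<in> S1" for e
      using that by (rule K1.component_closed)
  qed
  show ?thesis
    using G.pi1_hom_hom[OF K1.root] G.pi1_hom_cls[OF K1.root]
    by (intro bexI[of _ G.pi1_hom]) (simp_all add: G_val_def path_val_map)
qed

lemma H_hom_exists:
  "\<exists>\<psi>\<in>hom (pi1 (squier_complex \<Sigma>2 R2) w2) DG. \<forall>P. is_path (squier_complex \<Sigma>2 R2) w2 P w2 \<longrightarrow>
    \<psi> (K2.cls w2 P) = H_val 0 P"
proof -
  interpret H: labelling "squier_complex \<Sigma>2 R2" DG S2 "\<lambda>e. KS.edge_class (lift [a, c, bo] [bc, b] e)"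
  proof (rule labelling_pullback[where fe = "lift [a, c, bo] [bc, b]" and f = KS.edge_class])
    show "complex_map (squier_complex \<Sigma>2 R2) K (\<lambda>u. [a, c, bo] @ u @ [bc, b]) (lift [a, c, bo] [bc, b])"
      using pres2 sub_alphabets by (intro complex_map_lift) auto
    show "labelling K DG S KS.edge_class"
      by (rule KS.labelling_axioms)
    show "(\<lambda>u. [a, c, bo] @ u @ [bc, b]) ` S2 \<subseteq> S"
      using enc_in_S[of "[]" "[_]"] by (auto simp: enc_def)
    show "tgt (squier_complex \<Sigma>2 R2) e \<in> S2"
      if "e \<in> edges (squier_complex \<Sigma>2 R2)" "src (squier_complex \<Sigma>2 R2) e \<in> S2" for e
      using that by (rule K2.component_closed)
  qed
  show ?thesis
    using H.pi1_hom_hom[OF K2.root] H.pi1_hom_cls[OF K2.root]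
    by (intro bexI[of _ H.pi1_hom]) (simp_all add: H_val_def path_val_map)
qed

text \<open>Moving the border to the left brings a block of the first kind one step closer to \<open>c\<close>. As this commutes with
what happens inside the block, \<open>G_val (d + 1)\<close> is conjugated to \<open>G_val d\<close> by \<open>T\<close>. Hence distance \<open>d\<close>
corresponds to the copy of \<open>G\<close> with index \<open>-d\<close>.\<close>
lemma G_val_shift:
  assumes P: "is_path (squier_complex \<Sigma>1 R1) w1 P w1"
  shows "G_val d P = shift DG T (- int d) (G_val 0 P)"
proof (induction d)
  case 0
  then show ?case
    using KS.L.shift_0[OF T_carrier G_val_carrier[OF P K1.root]] by simp
next
  case (Suc d)
  note car = G_val_carrier[OF P K1.root]
  let ?l = "bo # w1 @ [bc, c]" and ?r = "c # bo # w2 @ [bc]" and ?us = "replicate d w1"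
  let ?Q = "[(bc # blk ?us, ?l, ?r, [b])]"
  have Q: "is_path K (bc # blk (?us @ [w1]) @ [c, b]) ?Q (bc # blk ?us @ c # blk [w2] @ [b])"
    by (intro is_path_edge) auto
  have "V (lifts [a, bo] ((bc # blk (?us @ [w1]) @ [c, b]) @ []) P) \<otimes>\<^bsub>DG\<^esub> V (lifts ([a, bo] @ w1) [] ?Q)
      = V (lifts ([a, bo] @ w1) [] ?Q) \<otimes>\<^bsub>DG\<^esub> V (lifts [a, bo] ((bc # blk ?us @ c # blk [w2] @ [b]) @ []) P)"
    by (rule SL.path_square[OF K1_is_path[OF P] Q])
      (use in_S(2)[of "w1 # ?us @ [w1]"] K1.root in simp_all)
  moreover have "V (lifts ([a, bo] @ w1) [] ?Q) = T"
    using V_c[of "w1 # ?us" "[]"] K1.root by (simp del: path_val_simps)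
  moreover have "V (lifts [a, bo] ((bc # blk (?us @ [w1]) @ [c, b]) @ []) P) = G_val (Suc d) P"
    using V_G[OF P K1.root, of "[]" "?us @ [w1]" "[]"] K1.root by simp
  moreover have "V (lifts [a, bo] ((bc # blk ?us @ c # blk [w2] @ [b]) @ []) P) = G_val d P"
    using V_G[OF P K1.root, of "[]" ?us "[w2]"] K2.root by simp
  ultimately have TG: "G_val (Suc d) P \<otimes>\<^bsub>DG\<^esub> T = T \<otimes>\<^bsub>DG\<^esub> G_val d P"
    by simp
  have "G_val (Suc d) P = (G_val (Suc d) P \<otimes>\<^bsub>DG\<^esub> T) \<otimes>\<^bsub>DG\<^esub> inv\<^bsub>DG\<^esub> T"
    using car by (simp add: KS.L.m_assoc)
  also have "\<dots> = shift DG T (- 1) (G_val d P)"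
    using car by (simp add: TG shift_def KS.L.int_pow_neg)
  also have "\<dots> = shift DG T (- int (Suc d)) (G_val 0 P)"
    using car Suc by (simp add: KS.L.shift_shift)
  finally show ?case .
qed

text \<open>On the other side of the border the distance grows, so distance \<open>d\<close> corresponds to the copy of \<open>H\<close> with
index \<open>d\<close>.\<close>
lemma H_val_shift:
  assumes P: "is_path (squier_complex \<Sigma>2 R2) w2 P w2"
  shows "H_val d P = shift DG T (int d) (H_val 0 P)"
proof (induction d)
  case 0
  then show ?case
    using KS.L.shift_0[OF T_carrier H_val_carrier[OF P K2.root]] by simp
next
  case (Suc d)
  note car = H_val_carrier[OF P K2.root]
  let ?l = "bo # w1 @ [bc, c]" and ?r = "c # bo # w2 @ [bc]" and ?vs = "replicate d w2"
  let ?e = "[([], ?l, ?r, [])]" and ?Q = "lifts (blk ?vs @ [bo]) [bc, b] P"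
  have e: "is_path K ?l ?e ?r"
    by (intro is_path_edge) auto
  have Q: "is_path K (blk (?vs @ [w2]) @ [b]) ?Q (blk (?vs @ [w2]) @ [b])"
    using lifts_is_path[OF K2_is_path[OF P], of "blk ?vs @ [bo]" "[bc, b]"] by simp
  have "V (lifts [a] ((blk (?vs @ [w2]) @ [b]) @ []) ?e) \<otimes>\<^bsub>DG\<^esub> V (lifts ([a] @ ?r) [] ?Q)
      = V (lifts ([a] @ ?l) [] ?Q) \<otimes>\<^bsub>DG\<^esub> V (lifts [a] ((blk (?vs @ [w2]) @ [b]) @ []) ?e)"
    by (rule SL.path_square[OF e Q])
      (use in_S(1)[of "[w1]" "?vs @ [w2]"] K1.root K2.root in simp_all)
  moreover have "V (lifts [a] ((blk (?vs @ [w2]) @ [b]) @ []) ?e) = T"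
    using V_c[of "[]" "?vs @ [w2]"] K2.root by (simp del: path_val_simps)
  moreover have "V (lifts ([a] @ ?r) [] ?Q) = H_val (Suc d) P"
    using V_H[OF P K2.root, of "[]" "w2 # ?vs" "[]"] K2.root by (simp add: comp_def)
  moreover have "V (lifts ([a] @ ?l) [] ?Q) = H_val d P"
    using V_H[OF P K2.root, of "[w1]" ?vs "[]"] K1.root by (simp add: comp_def)
  ultimately have TH: "T \<otimes>\<^bsub>DG\<^esub> H_val (Suc d) P = H_val d P \<otimes>\<^bsub>DG\<^esub> T"
    by simp
  have "H_val (Suc d) P = inv\<^bsub>DG\<^esub> T \<otimes>\<^bsub>DG\<^esub> (T \<otimes>\<^bsub>DG\<^esub> H_val (Suc d) P)"
    using car by (simp add: KS.L.cancel_left_inv)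
  also have "\<dots> = shift DG T 1 (H_val d P)"
    using car by (simp add: TH shift_def KS.L.int_pow_neg KS.L.m_assoc)
  also have "\<dots> = shift DG T (int (Suc d)) (H_val 0 P)"
    using car Suc by (simp add: KS.L.shift_shift)
  finally show ?case .
qed

text \<open>The two loops live in different blocks of the same word. The same holds in the next two lemmas.\<close>
lemma G_G_commute:
  assumes P: "is_path (squier_complex \<Sigma>1 R1) w1 P w1" and Q: "is_path (squier_complex \<Sigma>1 R1) w1 Q w1"
  shows "G_val (Suc d) P \<otimes>\<^bsub>DG\<^esub> G_val 0 Q = G_val 0 Q \<otimes>\<^bsub>DG\<^esub> G_val (Suc d) P"
proof -
  let ?us = "replicate d w1"
  let ?Q = "lifts (bc # blk ?us @ [bo]) [bc, c, b] Q"
  have Q': "is_path K (bc # blk (?us @ [w1]) @ [c, b]) ?Q (bc # blk (?us @ [w1]) @ [c, b])"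
    using lifts_is_path[OF K1_is_path[OF Q], of "bc # blk ?us @ [bo]" "[bc, c, b]"] by simp
  have "V (lifts [a, bo] ((bc # blk (?us @ [w1]) @ [c, b]) @ []) P) \<otimes>\<^bsub>DG\<^esub> V (lifts ([a, bo] @ w1) [] ?Q)
      = V (lifts ([a, bo] @ w1) [] ?Q) \<otimes>\<^bsub>DG\<^esub> V (lifts [a, bo] ((bc # blk (?us @ [w1]) @ [c, b]) @ []) P)"
    by (rule SL.path_square[OF K1_is_path[OF P] Q'])
      (use in_S(2)[of "w1 # ?us @ [w1]"] K1.root in simp_all)
  moreover have "V (lifts [a, bo] ((bc # blk (?us @ [w1]) @ [c, b]) @ []) P) = G_val (Suc d) P"
    using V_G[OF P K1.root, of "[]" "?us @ [w1]" "[]"] K1.root by simp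
  moreover have "V (lifts ([a, bo] @ w1) [] ?Q) = G_val 0 Q"
    using V_G[OF Q K1.root, of "w1 # ?us" "[]" "[]"] K1.root by (simp add: comp_def)
  ultimately show ?thesis
    by simp
qed

lemma H_H_commute:
  assumes P: "is_path (squier_complex \<Sigma>2 R2) w2 P w2" and Q: "is_path (squier_complex \<Sigma>2 R2) w2 Q w2"
  shows "H_val 0 P \<otimes>\<^bsub>DG\<^esub> H_val (Suc d) Q = H_val (Suc d) Q \<otimes>\<^bsub>DG\<^esub> H_val 0 P"
proof -
  let ?vs = "replicate d w2"
  let ?Q = "lifts (bc # blk ?vs @ [bo]) [bc, b] Q"
  have Q': "is_path K (bc # blk (?vs @ [w2]) @ [b]) ?Q (bc # blk (?vs @ [w2]) @ [b])"
    using lifts_is_path[OF K2_is_path[OF Q], of "bc # blk ?vs @ [bo]" "[bc, b]"] by simp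
  have "V (lifts [a, c, bo] ((bc # blk (?vs @ [w2]) @ [b]) @ []) P) \<otimes>\<^bsub>DG\<^esub> V (lifts ([a, c, bo] @ w2) [] ?Q)
      = V (lifts ([a, c, bo] @ w2) [] ?Q) \<otimes>\<^bsub>DG\<^esub> V (lifts [a, c, bo] ((bc # blk (?vs @ [w2]) @ [b]) @ []) P)"
    by (rule SL.path_square[OF K2_is_path[OF P] Q'])
      (use in_S(3)[of "w2 # ?vs @ [w2]"] K2.root in simp_all)
  moreover have "V (lifts [a, c, bo] ((bc # blk (?vs @ [w2]) @ [b]) @ []) P) = H_val 0 P"
    using V_H[OF P K2.root, of "[]" "[]" "?vs @ [w2]"] K2.root by simp
  moreover have "V (lifts ([a, c, bo] @ w2) [] ?Q) = H_val (Suc d) Q"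
    using V_H[OF Q K2.root, of "[]" "w2 # ?vs" "[]"] K2.root by (simp add: comp_def)
  ultimately show ?thesis
    by simp
qed

text \<open>The case \<open>d = 0\<close> is included, because the border separates the two blocks next to it. This is why
\<open>g\<^sub>i\<close> and \<open>h\<^sub>j\<close> commute for all \<open>i \<le> j\<close>, and not only for \<open>i < j\<close>.\<close>
lemma G_H_commute:
  assumes P: "is_path (squier_complex \<Sigma>1 R1) w1 P w1" and Q: "is_path (squier_complex \<Sigma>2 R2) w2 Q w2"
  shows "G_val 0 P \<otimes>\<^bsub>DG\<^esub> H_val d Q = H_val d Q \<otimes>\<^bsub>DG\<^esub> G_val 0 P"
proof -
  let ?vs = "replicate d w2"
  let ?Q = "lifts (bc # c # blk ?vs @ [bo]) [bc, b] Q"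
  have Q': "is_path K (bc # c # blk (?vs @ [w2]) @ [b]) ?Q (bc # c # blk (?vs @ [w2]) @ [b])"
    using lifts_is_path[OF K2_is_path[OF Q], of "bc # c # blk ?vs @ [bo]" "[bc, b]"] by simp
  have "V (lifts [a, bo] ((bc # c # blk (?vs @ [w2]) @ [b]) @ []) P) \<otimes>\<^bsub>DG\<^esub> V (lifts ([a, bo] @ w1) [] ?Q)
      = V (lifts ([a, bo] @ w1) [] ?Q) \<otimes>\<^bsub>DG\<^esub> V (lifts [a, bo] ((bc # c # blk (?vs @ [w2]) @ [b]) @ []) P)"
    by (rule SL.path_square[OF K1_is_path[OF P] Q'])
      (use in_S(1)[of "[w1]" "?vs @ [w2]"] K1.root K2.root in simp_all)
  moreover have "V (lifts [a, bo] ((bc # c # blk (?vs @ [w2]) @ [b]) @ []) P) = G_val 0 P"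
    using V_G[OF P K1.root, of "[]" "[]" "?vs @ [w2]"] K2.root by simp
  moreover have "V (lifts ([a, bo] @ w1) [] ?Q) = H_val d Q"
    using V_H[OF Q K2.root, of "[w1]" ?vs "[]"] K1.root by (simp add: comp_def)
  ultimately show ?thesis
    by simp
qed

text \<open>The chosen paths of the given complex have trivial value, so an edge has the same value as the loop by which
it represents an element of the given diagram group.\<close>
lemma G_val_edge:
  assumes "e \<in> edges (squier_complex \<Sigma>1 R1)" "src (squier_complex \<Sigma>1 R1) e \<in> S1"
  shows "G_val d [e] = G_val d (\<gamma>1 (src (squier_complex \<Sigma>1 R1) e) @ [e] @
    K1.path_inv (\<gamma>1 (tgt (squier_complex \<Sigma>1 R1) e)))"
    (is "_ = G_val d (\<gamma>1 ?u @ [e] @ K1.path_inv (\<gamma>1 ?v))")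
proof -
  have v: "?v \<in> S1"
    using assms by (rule K1.component_closed)
  have e: "is_path (squier_complex \<Sigma>1 R1) ?u [e] ?v"
    using assms K1.tgt_verts by simp
  note p = K1.\<gamma>_path[OF assms(2)] K1.\<gamma>_path[OF v]
  have 1: "G_val d (\<gamma>1 x) = \<one>\<^bsub>DG\<^esub>" if "x \<in> S1" for x
    unfolding G_val_def using that by (intro V_G_tree) simp_all
  have "G_val d (K1.path_inv (\<gamma>1 ?v)) \<otimes>\<^bsub>DG\<^esub> G_val d (\<gamma>1 ?v) = \<one>\<^bsub>DG\<^esub>"
  proof -
    let ?P = "lifts [a, bo] (bc # blk (replicate d w1) @ [c, b]) (\<gamma>1 ?v)"
    have "lifts [a, bo] (bc # blk (replicate d w1) @ [c, b]) (K1.path_inv (\<gamma>1 ?v)) = K.path_inv ?P"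
      by (induction "\<gamma>1 ?v" rule: rev_induct)
        (auto simp: K1.path_inv_def K.path_inv_def rev_map lift_def split: prod.split)
    then have "G_val d (K1.path_inv (\<gamma>1 ?v)) = inv\<^bsub>DG\<^esub> G_val d (\<gamma>1 ?v)"
      unfolding G_val_def using KS.val_inv[OF G_val_path[OF p(2), of d]] K1.root
      by (simp add: enc_in_S)
    then show ?thesis
      using G_val_carrier[OF p(2) K1.root] by simp
  qed
  then have 2: "G_val d (K1.path_inv (\<gamma>1 ?v)) = \<one>\<^bsub>DG\<^esub>"
    using 1[OF v] G_val_carrier[OF K1.is_path_inv[OF p(2)] v] by simp
  have ev: "is_path (squier_complex \<Sigma>1 R1) ?u ([e] @ K1.path_inv (\<gamma>1 ?v)) w1"
    using e K1.is_path_inv[OF p(2)] K1.is_path_append by blast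
  show ?thesis
    using G_val_append[OF p(1) ev K1.root] G_val_append[OF e K1.is_path_inv[OF p(2)] assms(2)]
      1[OF assms(2)] 2 G_val_carrier[OF e assms(2)] by simp
qed

lemma H_val_edge:
  assumes "e \<in> edges (squier_complex \<Sigma>2 R2)" "src (squier_complex \<Sigma>2 R2) e \<in> S2"
  shows "H_val d [e] = H_val d (\<gamma>2 (src (squier_complex \<Sigma>2 R2) e) @ [e] @
    K2.path_inv (\<gamma>2 (tgt (squier_complex \<Sigma>2 R2) e)))"
    (is "_ = H_val d (\<gamma>2 ?u @ [e] @ K2.path_inv (\<gamma>2 ?v))")
proof -
  have v: "?v \<in> S2"
    using assms by (rule K2.component_closed)
  have e: "is_path (squier_complex \<Sigma>2 R2) ?u [e] ?v"
    using assms K2.tgt_verts by simp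
  note p = K2.\<gamma>_path[OF assms(2)] K2.\<gamma>_path[OF v]
  have 1: "H_val d (\<gamma>2 x) = \<one>\<^bsub>DG\<^esub>" if "x \<in> S2" for x
    unfolding H_val_def using that V_H_tree[of "[]" "replicate d w2" x] by simp
  have "H_val d (K2.path_inv (\<gamma>2 ?v)) \<otimes>\<^bsub>DG\<^esub> H_val d (\<gamma>2 ?v) = \<one>\<^bsub>DG\<^esub>"
  proof -
    let ?P = "lifts (a # c # blk (replicate d w2) @ [bo]) [bc, b] (\<gamma>2 ?v)"
    have "lifts (a # c # blk (replicate d w2) @ [bo]) [bc, b] (K2.path_inv (\<gamma>2 ?v)) = K.path_inv ?P"
      by (induction "\<gamma>2 ?v" rule: rev_induct)
        (auto simp: K2.path_inv_def K.path_inv_def rev_map lift_def split: prod.split)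
    then have "H_val d (K2.path_inv (\<gamma>2 ?v)) = inv\<^bsub>DG\<^esub> H_val d (\<gamma>2 ?v)"
      unfolding H_val_def using KS.val_inv[OF H_val_path[OF p(2), of d]] K2.root
      by (simp add: enc_in_S)
    then show ?thesis
      using H_val_carrier[OF p(2) K2.root] by simp
  qed
  then have 2: "H_val d (K2.path_inv (\<gamma>2 ?v)) = \<one>\<^bsub>DG\<^esub>"
    using 1[OF v] H_val_carrier[OF K2.is_path_inv[OF p(2)] v] by simp
  have ev: "is_path (squier_complex \<Sigma>2 R2) ?u ([e] @ K2.path_inv (\<gamma>2 ?v)) w2"
    using e K2.is_path_inv[OF p(2)] K2.is_path_append by blast
  show ?thesis
    using H_val_append[OF p(1) ev K2.root] H_val_append[OF e K2.is_path_inv[OF p(2)] assms(2)]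
      1[OF assms(2)] 2 H_val_carrier[OF e assms(2)] by simp
qed

end

section \<open>The labelling of the component by \<open>O(G, H)\<close>\<close>

locale O_iso = O_complex bo bc \<Sigma>1 \<Sigma>2 R1 R2 w1 w2 a b c S1 S2 \<gamma>1 \<gamma>2 + O_pair G H
  for bo bc :: 'l and \<Sigma>1 \<Sigma>2 R1 R2 w1 w2 a b c S1 S2 \<gamma>1 \<gamma>2
    and G :: "('g, 'm) monoid_scheme" and H :: "('h, 'n) monoid_scheme" +
  fixes \<theta>1 :: "'g \<Rightarrow> 'l squier_edge list set" and \<theta>2 :: "'h \<Rightarrow> 'l squier_edge list set"
  assumes \<theta>1: "\<theta>1 \<in> iso G (pi1 (squier_complex \<Sigma>1 R1) w1)"
    and \<theta>2: "\<theta>2 \<in> iso H (pi1 (squier_complex \<Sigma>2 R2) w2)"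
begin

definition \<kappa>1 where "\<kappa>1 = inv_into (carrier G) \<theta>1"
definition \<kappa>2 where "\<kappa>2 = inv_into (carrier H) \<theta>2"

lemma \<kappa>1: "\<kappa>1 \<in> hom (pi1 (squier_complex \<Sigma>1 R1) w1) G"
  and \<kappa>1_\<theta>1: "g \<in> carrier G \<Longrightarrow> \<kappa>1 (\<theta>1 g) = g"
  and \<theta>1_\<kappa>1: "z \<in> carrier (pi1 (squier_complex \<Sigma>1 R1) w1) \<Longrightarrow> \<theta>1 (\<kappa>1 z) = z"
  using G.iso_set_sym[OF \<theta>1] \<theta>1
  by (auto simp: \<kappa>1_def iso_def bij_betw_def f_inv_into_f)

lemma \<kappa>2: "\<kappa>2 \<in> hom (pi1 (squier_complex \<Sigma>2 R2) w2) H"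
  and \<kappa>2_\<theta>2: "g \<in> carrier H \<Longrightarrow> \<kappa>2 (\<theta>2 g) = g"
  and \<theta>2_\<kappa>2: "z \<in> carrier (pi1 (squier_complex \<Sigma>2 R2) w2) \<Longrightarrow> \<theta>2 (\<kappa>2 z) = z"
  using H.iso_set_sym[OF \<theta>2] \<theta>2
  by (auto simp: \<kappa>2_def iso_def bij_betw_def f_inv_into_f)

text \<open>The element of \<open>G\<close> that an edge of the first given complex represents.\<close>
definition G_label where "G_label e = \<kappa>1 (K1.edge_class e)"
definition H_label where "H_label e = \<kappa>2 (K2.edge_class e)"

sublocale LG: squier_labelling \<Sigma>1 R1 G S1 G_label
  unfolding squier_labelling_def squier_labelling_axioms_def G_label_def[abs_def]
  using labelling_hom(1)[OF K1.labelling_axioms G.group_axioms \<kappa>1] pres1 by simp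

sublocale LH: squier_labelling \<Sigma>2 R2 H S2 H_label
  unfolding squier_labelling_def squier_labelling_axioms_def H_label_def[abs_def]
  using labelling_hom(1)[OF K2.labelling_axioms H.group_axioms \<kappa>2] pres2 by simp

lemma G_label_loop: "is_path (squier_complex \<Sigma>1 R1) w1 P w1 \<Longrightarrow> path_val G G_label P = \<kappa>1 (K1.cls w1 P)"
  using labelling_hom(2)[OF K1.labelling_axioms G.group_axioms \<kappa>1 _ K1.root] K1.val_loop
  by (simp add: G_label_def[abs_def])

lemma H_label_loop: "is_path (squier_complex \<Sigma>2 R2) w2 P w2 \<Longrightarrow> path_val H H_label P = \<kappa>2 (K2.cls w2 P)"
  using labelling_hom(2)[OF K2.labelling_axioms H.group_axioms \<kappa>2 _ K2.root] K2.val_loop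
  by (simp add: H_label_def[abs_def])

lemma G_label_tree: "u \<in> S1 \<Longrightarrow> path_val G G_label (\<gamma>1 u) = \<one>\<^bsub>G\<^esub>"
proof -
  assume u: "u \<in> S1"
  have "path_val G G_label (\<gamma>1 u) = \<kappa>1 (path_val (pi1 (squier_complex \<Sigma>1 R1) w1) K1.edge_class (\<gamma>1 u))"
    using labelling_hom(2)[OF K1.labelling_axioms G.group_axioms \<kappa>1 K1.\<gamma>_path[OF u] K1.root]
    by (simp add: G_label_def[abs_def])
  also have "path_val (pi1 (squier_complex \<Sigma>1 R1) w1) K1.edge_class (\<gamma>1 u) = \<one>\<^bsub>pi1 (squier_complex \<Sigma>1 R1) w1\<^esub>"
    using K1.\<gamma>_path[OF u] K1.root by (rule K1.val_tree) (simp add: K1.\<gamma>_root)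
  finally show ?thesis
    using hom_one[OF \<kappa>1 K1.L.group_axioms G.group_axioms] by simp
qed

lemma H_label_tree: "u \<in> S2 \<Longrightarrow> path_val H H_label (\<gamma>2 u) = \<one>\<^bsub>H\<^esub>"
proof -
  assume u: "u \<in> S2"
  have "path_val H H_label (\<gamma>2 u) = \<kappa>2 (path_val (pi1 (squier_complex \<Sigma>2 R2) w2) K2.edge_class (\<gamma>2 u))"
    using labelling_hom(2)[OF K2.labelling_axioms H.group_axioms \<kappa>2 K2.\<gamma>_path[OF u] K2.root]
    by (simp add: H_label_def[abs_def])
  also have "path_val (pi1 (squier_complex \<Sigma>2 R2) w2) K2.edge_class (\<gamma>2 u) = \<one>\<^bsub>pi1 (squier_complex \<Sigma>2 R2) w2\<^esub>"
    using K2.\<gamma>_path[OF u] K2.root by (rule K2.val_tree) (simp add: K2.\<gamma>_root)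
  finally show ?thesis
    using hom_one[OF \<kappa>2 K2.L.group_axioms H.group_axioms] by simp
qed

text \<open>The inverse map, edge by edge. The outer rules get the trivial label and the middle rule gets \<open>t\<close>; an
edge in a block gets the element that it represents in the given group, in the copy whose index is \<open>-d\<close> or
\<open>d\<close>, where \<open>d\<close> is the distance of the block from \<open>c\<close>. The block is recovered as the part around
the edge that contains no brackets, and \<open>d\<close> is the number of brackets of one kind on the way to \<open>c\<close>.\<close>
definition label :: "'l squier_edge \<Rightarrow> ('g, 'h) O_free_elem set" where
  "label = (\<lambda>(p, u, v, q).
    let x = rev (takeWhile (\<lambda>s. s \<noteq> bo) (rev p)); y = takeWhile (\<lambda>s. s \<noteq> bc) q in
    if c \<in> set u then (if hd u = c then inv\<^bsub>OGH\<^esub> gen_t else gen_t)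
    else if a \<in> set u \<or> b \<in> set u then \<one>\<^bsub>OGH\<^esub>
    else if set u \<subseteq> \<Sigma>1
      then gen_G (- int (count_list (takeWhile (\<lambda>s. s \<noteq> c) q) bo)) (G_label (x, u, v, y))
      else gen_H (int (count_list (takeWhile (\<lambda>s. s \<noteq> c) (rev p)) bc)) (H_label (x, u, v, y)))"

lemma label_simps [simp]:
  "label (p, [a], v, q) = \<one>\<^bsub>OGH\<^esub>" "label (p, a # bo # w1 @ [bc], v, q) = \<one>\<^bsub>OGH\<^esub>"
  "label (p, [b], v, q) = \<one>\<^bsub>OGH\<^esub>" "label (p, bo # w2 @ [bc, b], v, q) = \<one>\<^bsub>OGH\<^esub>"
  "label (p, bo # w1 @ [bc, c], v, q) = gen_t"
  "label (p, c # bo # w2 @ [bc], v, q) = inv\<^bsub>OGH\<^esub> gen_t"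
  by (simp_all add: label_def)

lemma count_list_0: "x \<notin> set ys \<Longrightarrow> count_list ys x = 0"
  by (induction ys) auto

lemma count_brackets:
  assumes "us \<in> lists (lists \<Sigma>1) \<or> us \<in> lists (lists \<Sigma>2)"
  shows "count_list (blk us) bo = length us" "count_list (blk us) bc = length us"
  using marker_notin_blk(4,5)[OF assms] by (induction us) (auto simp: count_list_0)

lemma count_list_rev': "count_list (rev xs) x = count_list xs x"
  by (induction xs) auto

lemma takeWhile_before:
  "x \<notin> set s \<Longrightarrow> takeWhile (\<lambda>z. z \<noteq> x) (s @ x # t) = s"
  by (induction s) auto

lemma label_G:
  assumes u: "rule1 u v" and x: "x \<in> lists \<Sigma>1" and y: "y \<in> lists \<Sigma>1" and us: "us \<in> lists S1"
  shows "label (s @ bo # x, u, v, y @ bc # blk us @ c # t) = gen_G (- int (length us)) (G_label (x, u, v, y))"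
proof -
  note m = not_marker[OF disjI1]
  have u': "u \<in> lists \<Sigma>1" "set u \<subseteq> \<Sigma>1"
    using rule1D[OF u] by (auto simp: in_lists_conv_set)
  have "takeWhile (\<lambda>z. z \<noteq> c) ((y @ bc # blk us) @ c # t) = y @ bc # blk us"
    by (rule takeWhile_before) (use m[OF y] marker_notin_blk[OF disjI1[OF lists_S1[OF us]]] in auto)
  moreover have "takeWhile (\<lambda>z. z \<noteq> bo) (rev x @ bo # rev s) = rev x"
    by (rule takeWhile_before) (use m[OF x] in auto)
  moreover have "takeWhile (\<lambda>z. z \<noteq> bc) (y @ bc # blk us @ c # t) = y"
    by (rule takeWhile_before) (use m[OF y] in auto)
  ultimately show ?thesis
    using m[OF u'(1)] u' m[OF y] count_brackets[OF disjI1[OF lists_S1[OF us]]]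
    by (simp add: label_def count_list_0)
qed

lemma label_H:
  assumes u: "rule2 u v" and x: "x \<in> lists \<Sigma>2" and y: "y \<in> lists \<Sigma>2" and vs: "vs \<in> lists S2"
  shows "label (s @ c # blk vs @ bo # x, u, v, y @ bc # t) = gen_H (int (length vs)) (H_label (x, u, v, y))"
proof -
  note m = not_marker[OF disjI2]
  have u': "u \<in> lists \<Sigma>2" "\<not> set u \<subseteq> \<Sigma>1"
    using rule2D[OF u] disjoint by (cases u; auto)+
  have "takeWhile (\<lambda>z. z \<noteq> c) (rev (blk vs @ bo # x) @ c # rev s) = rev (blk vs @ bo # x)"
    by (rule takeWhile_before) (use m[OF x] marker_notin_blk[OF disjI2[OF lists_S2[OF vs]]] in auto)
  moreover have "takeWhile (\<lambda>z. z \<noteq> bo) (rev x @ bo # rev (s @ c # blk vs)) = rev x"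
    by (rule takeWhile_before) (use m[OF x] in auto)
  moreover have "takeWhile (\<lambda>z. z \<noteq> bc) (y @ bc # t) = y"
    by (rule takeWhile_before) (use m[OF y] in auto)
  ultimately show ?thesis
    using m[OF u'(1)] u' m[OF x] count_brackets[OF disjI2[OF lists_S2[OF vs]]]
    by (simp add: label_def count_list_0 count_list_rev')
qed

lemma G_label_carrier:
  assumes "x @ u @ y \<in> S1" "rule1 u v"
  shows "G_label (x, u, v, y) \<in> carrier G"
  using LG.f_carrier[OF S1_step(4)[OF assms]] assms by simp

lemma H_label_carrier:
  assumes "x @ u @ y \<in> S2" "rule2 u v"
  shows "H_label (x, u, v, y) \<in> carrier H"
  using LH.f_carrier[OF S2_step(4)[OF assms]] assms by simp

lemma rule1_sym: "rule1 u v \<Longrightarrow> rule1 v u"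
  by (auto simp: rule1_def)

lemma rule2_sym: "rule2 u v \<Longrightarrow> rule2 v u"
  by (auto simp: rule2_def)

lemma R_antisym: "(u, v) \<in> R \<Longrightarrow> (v, u) \<notin> R"
  using presentation unfolding semigroup_presentation_def by blast

lemma R_members:
  "([a], a # bo # w1 @ [bc]) \<in> R" "(bo # w1 @ [bc, c], c # bo # w2 @ [bc]) \<in> R"
  "([b], bo # w2 @ [bc, b]) \<in> R"
  by (auto simp: R_def)

lemma label_edge:
  assumes eq: "p @ u @ q = enc us vs" and uv: "rule u v" and us: "us \<in> lists S1" and vs: "vs \<in> lists S2"
  shows "label (p, u, v, q) \<in> carrier OGH \<and> label (p, u, v, q) \<otimes>\<^bsub>OGH\<^esub> label (p, v, u, q) = \<one>\<^bsub>OGH\<^esub>"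
  using eq uv us vs
proof (cases rule: edge_cases)
  case (G us1 x y us2)
  have xuy: "x @ u @ y \<in> S1" and us2: "us2 \<in> lists S1"
    using G us by auto
  note xy = S1_step[OF xuy G(1)]
  have g: "G_label (x, u, v, y) \<in> carrier G" "G_label (x, v, u, y) \<in> carrier G"
    using G_label_carrier[OF xuy G(1)] G_label_carrier[OF xy(1) rule1_sym[OF G(1)]] by simp_all
  have "G_label (x, u, v, y) \<otimes>\<^bsub>G\<^esub> G_label (x, v, u, y) = \<one>\<^bsub>G\<^esub>"
    using LG.f_opp[OF xy(4)] xuy by simp
  moreover have "label (p, u, v, q) = gen_G (- int (length us2)) (G_label (x, u, v, y))"
    "label (p, v, u, q) = gen_G (- int (length us2)) (G_label (x, v, u, y))"
    using label_G[OF G(1) xy(2,3) us2, of "a # blk us1"] label_G[OF rule1_sym[OF G(1)] xy(2,3) us2, of "a # blk us1"] G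
    by simp_all
  ultimately show ?thesis
    using g hom_one[OF gen_G_hom G.group_axioms group_OGH] by (simp flip: hom_mult[OF gen_G_hom])
next
  case (H vs1 x y vs2)
  have xuy: "x @ u @ y \<in> S2" and vs1: "vs1 \<in> lists S2"
    using H vs by auto
  note xy = S2_step[OF xuy H(1)]
  have g: "H_label (x, u, v, y) \<in> carrier H" "H_label (x, v, u, y) \<in> carrier H"
    using H_label_carrier[OF xuy H(1)] H_label_carrier[OF xy(1) rule2_sym[OF H(1)]] by simp_all
  have "H_label (x, u, v, y) \<otimes>\<^bsub>H\<^esub> H_label (x, v, u, y) = \<one>\<^bsub>H\<^esub>"
    using LH.f_opp[OF xy(4)] xuy by simp
  moreover have "label (p, u, v, q) = gen_H (int (length vs1)) (H_label (x, u, v, y))"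
    "label (p, v, u, q) = gen_H (int (length vs1)) (H_label (x, v, u, y))"
    using label_H[OF H(1) xy(2,3) vs1, of "a # blk us"] label_H[OF rule2_sym[OF H(1)] xy(2,3) vs1, of "a # blk us"] H
    by simp_all
  ultimately show ?thesis
    using g hom_one[OF gen_H_hom H.group_axioms group_OGH] by (simp flip: hom_mult[OF gen_H_hom])
qed simp_all

end

context O_iso
begin

text \<open>The labels respect the 2-cells. Two edges in one block reduce to a cell of a given complex. Otherwise the
equation is a defining relation: copies with different indices commute, \<open>g\<^sub>i\<close> and \<open>h\<^sub>j\<close> commute for
\<open>i \<le> 0 \<le> j\<close>, and the middle rule changes the distance of the blocks on either side by one, as
conjugation by \<open>t\<close> changes the index. Next to an outer rule the distances do not change.\<close>
lemma label_square:
  assumes R: "(l1, r1) \<in> R" "(l2, r2) \<in> R" and eq: "p @ l1 @ z @ l2 @ q = enc us vs"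
    and us: "us \<in> lists S1" and vs: "vs \<in> lists S2"
  shows "label (p, l1, r1, z @ l2 @ q) \<otimes>\<^bsub>OGH\<^esub> label (p @ r1 @ z, l2, r2, q)
    = label (p @ l1 @ z, l2, r2, q) \<otimes>\<^bsub>OGH\<^esub> label (p, l1, r1, z @ r2 @ q)"
proof -
  have rl1: "rule l1 r1" and rl2: "rule l2 r2"
    using R by (simp_all add: rule_def)
  note us' = lists_S1[OF us] and vs' = lists_S2[OF vs]
  have no1: False if "(v, u) \<in> R" "l1 = u" "r1 = v" for u v
    using that R R_antisym by blast
  have no2: False if "(v, u) \<in> R" "l2 = u" "r2 = v" for u v
    using that R R_antisym by blast
  from eq rl1 us vs show ?thesis
  proof (cases rule: edge_cases)
    case a
    from a(4) rl2 us' vs' show ?thesis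
    proof (cases rule: parse_middle)
      case (G us1 x y us2)
      then have xly: "x @ l2 @ y \<in> S1" and us2: "us2 \<in> lists S1"
        using us by auto
      note xy = S1_step[OF xly G(1)]
      show ?thesis
        using label_G[OF G(1) xy(2,3) us2, of "a # blk us1"] label_G[OF G(1) xy(2,3) us2, of "a # bo # w1 @ bc # blk us1"]
          a G G_label_carrier[OF xly G(1)] by simp
    next
      case (right p')
      from right(2) rl2 vs' show ?thesis
      proof (cases rule: parse_right)
        case (H vs1 x y vs2)
        then have xly: "x @ l2 @ y \<in> S2" and vs1: "vs1 \<in> lists S2"
          using vs by auto
        note xy = S2_step[OF xly H(1)]
        show ?thesis
          using label_H[OF H(1) xy(2,3) vs1, of "a # blk us"] label_H[OF H(1) xy(2,3) vs1, of "a # bo # w1 @ bc # blk us"]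
            a right H H_label_carrier[OF xly H(1)] by simp
      qed (use a in simp_all)
    qed (use a in simp_all)
  next
    case (a' us')
    then show ?thesis
      using no1[OF R_members(1)] by blast
  next
    case (c' vs')
    then show ?thesis
      using no1[OF R_members(2)] by blast
  next
    case (b' vs')
    then show ?thesis
      using no1[OF R_members(3)] by blast
  next
    case b
    then show ?thesis
      using rule_nonempty[OF rl2] by simp
  next
    case (c us1)
    from c(5) rl2 vs' show ?thesis
    proof (cases rule: parse_right)
      case (H vs1 x y vs2)
      then have xly: "x @ l2 @ y \<in> S2" and vs1: "vs1 \<in> lists S2" "w2 # vs1 \<in> lists S2"
        using vs K2.root by auto
      note xy = S2_step[OF xly H(1)]
      show ?thesis
        using label_H[OF H(1) xy(2,3) vs1(1), of "a # blk us"] label_H[OF H(1) xy(2,3) vs1(2), of "a # blk us1"]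
          c H gen_H_shift[OF H_label_carrier[OF xly H(1)], of "int (length vs1)"] by (simp add: add.commute)
    qed (use c no2[OF R_members(3)] in simp_all)
  next
    case (G us1 x y us2)
    then have xly: "x @ l1 @ y \<in> S1" and us2: "us2 \<in> lists S1"
      using us by auto
    note xy = S1_step[OF xly G(1)]
    from G(4) rl2 disjI1[OF xy(3)] show ?thesis
    proof (cases rule: parse_block_rest)
      case (inside q')
      have q': "z \<in> lists \<Sigma>1" "q' \<in> lists \<Sigma>1" "l2 \<in> lists \<Sigma>1"
        using xy(3) inside by simp_all
      then have "\<not> rule2 l2 r2"
        using rule2D[of l2 r2] disjoint by (cases l2) auto
      with inside have rl: "rule1 l2 r2"
        by simp
      have r: "r1 \<in> lists \<Sigma>1" "r2 \<in> lists \<Sigma>1" "l1 \<in> lists \<Sigma>1"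
        using rule1D[OF G(1)] rule1D[OF rl] by auto
      have S: "x @ l1 @ z @ l2 @ q' \<in> S1"
        using xly inside by simp
      have S2: "x @ r1 @ z @ l2 @ q' \<in> S1" "x @ l1 @ z @ r2 @ q' \<in> S1"
        using S1_step(1)[of x l1 "z @ l2 @ q'" r1] S1_step(1)[of "x @ l1 @ z" l2 q' r2] S G(1) rl by simp_all
      let ?i = "- int (length us2)"
      have 1: "label (p, l1, r1, z @ l2 @ q) = gen_G ?i (G_label (x, l1, r1, z @ l2 @ q'))"
        using label_G[OF G(1) xy(2) _ us2, of "z @ l2 @ q'" "a # blk us1"] G inside q' by simp
      have 2: "label (p @ r1 @ z, l2, r2, q) = gen_G ?i (G_label (x @ r1 @ z, l2, r2, q'))"
        using label_G[OF rl _ q'(2) us2, of "x @ r1 @ z" "a # blk us1"] G inside q' r xy(2) by simp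
      have 3: "label (p @ l1 @ z, l2, r2, q) = gen_G ?i (G_label (x @ l1 @ z, l2, r2, q'))"
        using label_G[OF rl _ q'(2) us2, of "x @ l1 @ z" "a # blk us1"] G inside q' r xy(2) by simp
      have 4: "label (p, l1, r1, z @ r2 @ q) = gen_G ?i (G_label (x, l1, r1, z @ r2 @ q'))"
        using label_G[OF G(1) xy(2) _ us2, of "z @ r2 @ q'" "a # blk us1"] G inside q' r by simp
      have sq: "G_label (x, l1, r1, z @ l2 @ q') \<otimes>\<^bsub>G\<^esub> G_label (x @ r1 @ z, l2, r2, q')
          = G_label (x @ l1 @ z, l2, r2, q') \<otimes>\<^bsub>G\<^esub> G_label (x, l1, r1, z @ r2 @ q')"
        using G(1) rl xy(2) q' S unfolding rule1_def by (intro LG.edge_square)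
      have "G_label (x, l1, r1, z @ l2 @ q') \<in> carrier G" "G_label (x @ r1 @ z, l2, r2, q') \<in> carrier G"
        "G_label (x @ l1 @ z, l2, r2, q') \<in> carrier G" "G_label (x, l1, r1, z @ r2 @ q') \<in> carrier G"
        using S S2 G(1) rl by (simp_all add: G_label_carrier)
      with sq show ?thesis
        unfolding 1 2 3 4 by (simp flip: hom_mult[OF gen_G_hom])
    next
      case (beyond p')
      note g1 = G_label_carrier[OF xly G(1)]
      from beyond(2) rl2 lists_S1[OF us2] vs' show ?thesis
      proof (cases rule: parse_middle)
        case inner: (G us3 x' y' us4)
        then have xly': "x' @ l2 @ y' \<in> S1" and us4: "us4 \<in> lists S1" "us3 \<in> lists S1"
          using us2 by auto
        note xy' = S1_step[OF xly' inner(1)]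
        note g2 = G_label_carrier[OF xly' inner(1)]
        have us5: "us3 @ (x' @ r2 @ y') # us4 \<in> lists S1"
          using us4 xy'(1) by simp
        have "- int (length us2) \<noteq> - int (length us4)"
          using inner by simp
        from gen_G_commute[OF this g1 g2] show ?thesis
          using label_G[OF G(1) xy(2,3) us2, of "a # blk us1"] label_G[OF G(1) xy(2,3) us5, of "a # blk us1"]
            label_G[OF inner(1) xy'(2,3) us4(1), of "a # blk (us1 @ (x @ r1 @ y) # us3)"]
            label_G[OF inner(1) xy'(2,3) us4(1), of "a # blk (us1 @ (x @ l1 @ y) # us3)"]
            G beyond inner by simp
      next
        case (c us3)
        then have us3: "us3 \<in> lists S1"
          using us2 by auto
        show ?thesis
          using label_G[OF G(1) xy(2,3) us2, of "a # blk us1"] label_G[OF G(1) xy(2,3) us3, of "a # blk us1"]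
            G beyond c gen_G_shift[OF g1, of "- int (length us2)"] by simp
      next
        case (c' vs'')
        then show ?thesis
          using no2[OF R_members(2)] by blast
      next
        case (right p'')
        from right(2) rl2 vs' show ?thesis
        proof (cases rule: parse_right)
          case (H vs1 x' y' vs2)
          then have xly': "x' @ l2 @ y' \<in> S2" and vs1: "vs1 \<in> lists S2"
            using vs by auto
          note xy' = S2_step[OF xly' H(1)]
          note g2 = H_label_carrier[OF xly' H(1)]
          have "- int (length us2) \<le> int (length vs1)"
            by simp
          from gen_GH_commute[OF this g1 g2] show ?thesis
            using label_G[OF G(1) xy(2,3) us2, of "a # blk us1"]
              label_H[OF H(1) xy'(2,3) vs1, of "a # blk (us1 @ (x @ r1 @ y) # us2)"]
              label_H[OF H(1) xy'(2,3) vs1, of "a # blk (us1 @ (x @ l1 @ y) # us2)"]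
              G beyond right H by simp
        next
          case b
          show ?thesis
            using label_G[OF G(1) xy(2,3) us2, of "a # blk us1"] G beyond right b g1 by simp
        next
          case (b' vs'')
          then show ?thesis
            using no2[OF R_members(3)] by blast
        qed
      qed
    qed
  next
    case (H vs1 x y vs2)
    then have xly: "x @ l1 @ y \<in> S2" and vs1: "vs1 \<in> lists S2" "vs2 \<in> lists S2"
      using vs by auto
    note xy = S2_step[OF xly H(1)]
    from H(4) rl2 disjI2[OF xy(3)] show ?thesis
    proof (cases rule: parse_block_rest)
      case (inside q')
      have q': "z \<in> lists \<Sigma>2" "q' \<in> lists \<Sigma>2" "l2 \<in> lists \<Sigma>2"
        using xy(3) inside by simp_all
      then have "\<not> rule1 l2 r2"
        using rule1D[of l2 r2] disjoint by (cases l2) auto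
      with inside have rl: "rule2 l2 r2"
        by simp
      have r: "r1 \<in> lists \<Sigma>2" "r2 \<in> lists \<Sigma>2" "l1 \<in> lists \<Sigma>2"
        using rule2D[OF H(1)] rule2D[OF rl] by auto
      have S: "x @ l1 @ z @ l2 @ q' \<in> S2"
        using xly inside by simp
      have S2: "x @ r1 @ z @ l2 @ q' \<in> S2" "x @ l1 @ z @ r2 @ q' \<in> S2"
        using S2_step(1)[of x l1 "z @ l2 @ q'" r1] S2_step(1)[of "x @ l1 @ z" l2 q' r2] S H(1) rl by simp_all
      let ?i = "int (length vs1)"
      have 1: "label (p, l1, r1, z @ l2 @ q) = gen_H ?i (H_label (x, l1, r1, z @ l2 @ q'))"
        using label_H[OF H(1) xy(2) _ vs1(1), of "z @ l2 @ q'" "a # blk us"] H inside q' by simp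
      have 2: "label (p @ r1 @ z, l2, r2, q) = gen_H ?i (H_label (x @ r1 @ z, l2, r2, q'))"
        using label_H[OF rl _ q'(2) vs1(1), of "x @ r1 @ z" "a # blk us"] H inside q' r xy(2) by simp
      have 3: "label (p @ l1 @ z, l2, r2, q) = gen_H ?i (H_label (x @ l1 @ z, l2, r2, q'))"
        using label_H[OF rl _ q'(2) vs1(1), of "x @ l1 @ z" "a # blk us"] H inside q' r xy(2) by simp
      have 4: "label (p, l1, r1, z @ r2 @ q) = gen_H ?i (H_label (x, l1, r1, z @ r2 @ q'))"
        using label_H[OF H(1) xy(2) _ vs1(1), of "z @ r2 @ q'" "a # blk us"] H inside q' r by simp
      have sq: "H_label (x, l1, r1, z @ l2 @ q') \<otimes>\<^bsub>H\<^esub> H_label (x @ r1 @ z, l2, r2, q')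
          = H_label (x @ l1 @ z, l2, r2, q') \<otimes>\<^bsub>H\<^esub> H_label (x, l1, r1, z @ r2 @ q')"
        using H(1) rl xy(2) q' S unfolding rule2_def by (intro LH.edge_square)
      have "H_label (x, l1, r1, z @ l2 @ q') \<in> carrier H" "H_label (x @ r1 @ z, l2, r2, q') \<in> carrier H"
        "H_label (x @ l1 @ z, l2, r2, q') \<in> carrier H" "H_label (x, l1, r1, z @ r2 @ q') \<in> carrier H"
        using S S2 H(1) rl by (simp_all add: H_label_carrier)
      with sq show ?thesis
        unfolding 1 2 3 4 by (simp flip: hom_mult[OF gen_H_hom])
    next
      case (beyond p')
      note g1 = H_label_carrier[OF xly H(1)]
      from beyond(2) rl2 lists_S2[OF vs1(2)] show ?thesis
      proof (cases rule: parse_right)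
        case inner: (H vs3 x' y' vs4)
        then have xly': "x' @ l2 @ y' \<in> S2" and vs4: "vs4 \<in> lists S2" "vs3 \<in> lists S2"
          using vs1 by auto
        note xy' = S2_step[OF xly' inner(1)]
        note g2 = H_label_carrier[OF xly' inner(1)]
        have vs5: "vs1 @ (x @ r1 @ y) # vs3 \<in> lists S2" "vs1 @ (x @ l1 @ y) # vs3 \<in> lists S2"
          using vs1 vs4 xy(1) xly by simp_all
        have "int (length vs1) \<noteq> int (length (vs1 @ (x @ r1 @ y) # vs3))"
          by simp
        from gen_H_commute[OF this g1 g2] show ?thesis
          using label_H[OF H(1) xy(2,3) vs1(1), of "a # blk us"]
            label_H[OF inner(1) xy'(2,3) vs5(1), of "a # blk us"]
            label_H[OF inner(1) xy'(2,3) vs5(2), of "a # blk us"]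
            H beyond inner by simp
      next
        case b
        show ?thesis
          using label_H[OF H(1) xy(2,3) vs1(1), of "a # blk us"] H beyond b g1 by simp
      next
        case (b' vs'')
        then show ?thesis
          using no2[OF R_members(3)] by blast
      qed
    qed
  qed
qed

sublocale LB: labelling K OGH S label
proof unfold_locales
  fix e assume e: "e \<in> edges K" "src K e \<in> S"
  obtain p u v q where puvq: "e = (p, u, v, q)"
    by (cases e)
  then obtain us vs where "p @ u @ q = enc us vs" "us \<in> lists S1" "vs \<in> lists S2"
    using e(2) by (auto simp: S_def)
  with e puvq have "label (p, u, v, q) \<in> carrier OGH \<and> label (p, u, v, q) \<otimes>\<^bsub>OGH\<^esub> label (p, v, u, q) = \<one>\<^bsub>OGH\<^esub>"
    by (intro label_edge) (auto simp: rule_def)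
  then show "label e \<in> carrier OGH" "label e \<otimes>\<^bsub>OGH\<^esub> label (opp K e) = \<one>\<^bsub>OGH\<^esub>"
    using puvq by simp_all
  show "tgt K e \<in> S"
    using e by (rule KS.S_closed)
next
  fix d w assume d: "d \<in> cells K" "is_path K w d w" "w \<in> S"
  then obtain p l1 r1 z l2 r2 q where dd: "d = squier_cell p l1 r1 z l2 r2 q"
    and pzq: "p \<in> lists \<Sigma>" "z \<in> lists \<Sigma>" "q \<in> lists \<Sigma>" and R: "(l1, r1) \<in> R" "(l2, r2) \<in> R"
    unfolding cells_squier_complex by blast
  have w: "w = p @ l1 @ z @ l2 @ q"
    using d(2) by (simp add: dd squier_cell_def)
  then obtain us vs where eq: "p @ l1 @ z @ l2 @ q = enc us vs" and us: "us \<in> lists S1" "vs \<in> lists S2"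
    using d(3) by (auto simp: S_def)
  have rl: "rule l1 r1" "rule l2 r2"
    using R by (simp_all add: rule_def)
  have S: "p @ l1 @ z @ l2 @ q \<in> S" "p @ r1 @ z @ l2 @ q \<in> S" "p @ l1 @ z @ r2 @ q \<in> S"
    using d(3) w S_closed[of p l1 "z @ l2 @ q" r1] S_closed[of "p @ l1 @ z" l2 q r2] rl by simp_all
  have edge: "label (p', u, v, q') \<in> carrier OGH \<and> label (p', u, v, q') \<otimes>\<^bsub>OGH\<^esub> label (p', v, u, q') = \<one>\<^bsub>OGH\<^esub>"
    if "p' @ u @ q' \<in> S" "rule u v" for p' u v q'
    using that label_edge unfolding S_def by blast
  let ?A = "label (p, l1, r1, z @ l2 @ q)" and ?B = "label (p @ r1 @ z, l2, r2, q)"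
  let ?C = "label (p @ l1 @ z, l2, r2, q)" and ?D = "label (p, l1, r1, z @ r2 @ q)"
  let ?C' = "label (p @ l1 @ z, r2, l2, q)" and ?D' = "label (p, r1, l1, z @ r2 @ q)"
  have S': "p @ r1 @ z @ r2 @ q \<in> S"
    using S_closed[of "p @ r1 @ z" l2 q r2] S rl by simp
  have rl': "rule r1 l1" "rule r2 l2"
    using rl by (auto simp: rule_def)
  have car: "?A \<in> carrier OGH" "?B \<in> carrier OGH" "?C \<in> carrier OGH" "?D \<in> carrier OGH"
    "?C' \<in> carrier OGH" "?D' \<in> carrier OGH"
    using edge[of p l1 "z @ l2 @ q" r1] edge[of "p @ r1 @ z" l2 q r2] edge[of "p @ l1 @ z" l2 q r2]
      edge[of p l1 "z @ r2 @ q" r1] edge[of "p @ l1 @ z" r2 q l2] edge[of p r1 "z @ r2 @ q" l1] S S' rl rl' by simp_all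
  have inv: "?C \<otimes>\<^bsub>OGH\<^esub> ?C' = \<one>\<^bsub>OGH\<^esub>" "?D \<otimes>\<^bsub>OGH\<^esub> ?D' = \<one>\<^bsub>OGH\<^esub>"
    using edge[of "p @ l1 @ z" l2 q r2] edge[of p l1 "z @ r2 @ q" r1] S rl by simp_all
  have "path_val OGH label d = (?A \<otimes>\<^bsub>OGH\<^esub> ?B) \<otimes>\<^bsub>OGH\<^esub> (?D' \<otimes>\<^bsub>OGH\<^esub> ?C')"
    using car by (simp add: dd squier_cell_def OGH.m_assoc)
  also have "\<dots> = ?C \<otimes>\<^bsub>OGH\<^esub> (?D \<otimes>\<^bsub>OGH\<^esub> ?D') \<otimes>\<^bsub>OGH\<^esub> ?C'"
    using car label_square[OF R eq us] by (simp add: OGH.m_assoc)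
  also have "\<dots> = \<one>\<^bsub>OGH\<^esub>"
    using car inv by simp
  finally show "path_val OGH label d = \<one>\<^bsub>OGH\<^esub>" .
qed

abbreviation label_val where "label_val \<equiv> path_val OGH label"

lemma label_val_G:
  assumes "is_path (squier_complex \<Sigma>1 R1) u P u'" "u \<in> S1" and us2: "us2 \<in> lists S1"
  shows "label_val (lifts (s @ [bo]) (bc # blk us2 @ c # t) P) = gen_G (- int (length us2)) (path_val G G_label P)"
  using assms(1,2)
proof (induction P arbitrary: u)
  case Nil
  then show ?case
    using hom_one[OF gen_G_hom G.group_axioms group_OGH] by simp
next
  case (Cons e P)
  obtain x l r y where e: "e = (x, l, r, y)"
    by (cases e)
  have u: "u = x @ l @ y" and rl: "rule1 l r" and P: "is_path (squier_complex \<Sigma>1 R1) (x @ r @ y) P u'"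
    using Cons.prems e by (auto simp: rule1_def)
  have xly: "x @ l @ y \<in> S1"
    using Cons.prems u by simp
  note xy = S1_step[OF xly rl]
  show ?case
    using Cons.IH[OF P xy(1)] label_G[OF rl xy(2,3) us2, of s t] G_label_carrier[OF xly rl]
      LG.val_carrier[OF P xy(1)] by (simp add: e hom_mult[OF gen_G_hom])
qed

lemma label_val_H:
  assumes "is_path (squier_complex \<Sigma>2 R2) u P u'" "u \<in> S2" and vs: "vs \<in> lists S2"
  shows "label_val (lifts (s @ c # blk vs @ [bo]) (bc # t) P) = gen_H (int (length vs)) (path_val H H_label P)"
  using assms(1,2)
proof (induction P arbitrary: u)
  case Nil
  then show ?case
    using hom_one[OF gen_H_hom H.group_axioms group_OGH] by simp
next
  case (Cons e P)
  obtain x l r y where e: "e = (x, l, r, y)"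
    by (cases e)
  have u: "u = x @ l @ y" and rl: "rule2 l r" and P: "is_path (squier_complex \<Sigma>2 R2) (x @ r @ y) P u'"
    using Cons.prems e by (auto simp: rule2_def)
  have xly: "x @ l @ y \<in> S2"
    using Cons.prems u by simp
  note xy = S2_step[OF xly rl]
  show ?case
    using Cons.IH[OF P xy(1)] label_H[OF rl xy(2,3) vs, of s t] H_label_carrier[OF xly rl]
      LH.val_carrier[OF P xy(1)] by (simp add: e hom_mult[OF gen_H_hom])
qed

lemma label_val_left_path: "us \<in> lists S1 \<Longrightarrow> label_val (lifts [] (c # t) (left_path us)) = \<one>\<^bsub>OGH\<^esub>"
proof (induction us)
  case (Cons u us)
  then have u: "u \<in> S1" "us \<in> lists S1"
    by auto
  have 1: "label_val (lifts [a, bo] (bc # blk us @ c # t) (\<gamma>1 u)) = \<one>\<^bsub>OGH\<^esub>"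
    using label_val_G[OF K1.\<gamma>_path[OF u(1)] K1.root u(2), of "[a]" t] G_label_tree[OF u(1)]
      hom_one[OF gen_G_hom G.group_axioms group_OGH] by simp
  have app: "label_val (P @ Q) = label_val P" if "label_val Q = \<one>\<^bsub>OGH\<^esub>" for P Q
    using that by (induction P) auto
  show ?case
    using Cons.IH[OF u(2)] 1 by (simp add: app comp_def)
qed simp

lemma label_val_right_path: "vs \<in> lists S2 \<Longrightarrow> label_val (lifts (s @ [c]) [] (right_path vs)) = \<one>\<^bsub>OGH\<^esub>"
proof (induction vs rule: rev_induct)
  case (snoc v vs)
  then have v: "v \<in> S2" "vs \<in> lists S2"
    by auto
  have 1: "label_val (lifts (s @ c # blk vs @ [bo]) [bc, b] (\<gamma>2 v)) = \<one>\<^bsub>OGH\<^esub>"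
    using label_val_H[OF K2.\<gamma>_path[OF v(1)] K2.root v(2), of s "[b]"] H_label_tree[OF v(1)]
      hom_one[OF gen_H_hom H.group_axioms group_OGH] by simp
  have app: "label_val (P @ Q) = label_val P" if "label_val Q = \<one>\<^bsub>OGH\<^esub>" for P Q
    using that by (induction P) auto
  show ?case
    using snoc.IH[OF v(2)] 1 by (simp add: app comp_def)
qed simp

text \<open>The chosen paths consist of outer rules and of chosen paths in blocks, so they have trivial labels.
Therefore the homomorphism defined by the labels can be computed on paths that are not closed.\<close>
lemma label_val_tree: "x \<in> S \<Longrightarrow> label_val (\<gamma> x) = \<one>\<^bsub>OGH\<^esub>"
proof -
  assume "x \<in> S"
  then obtain us vs where x: "x = enc us vs" "us \<in> lists S1" "vs \<in> lists S2"
    by (auto simp: S_def)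
  have app: "label_val (P @ Q) = label_val P" if "label_val Q = \<one>\<^bsub>OGH\<^esub>" for P Q
    using that by (induction P) auto
  show ?thesis
    using x label_val_left_path[OF x(2), of "[b]"] label_val_right_path[OF x(3), of "a # blk us"]
    by (simp add: \<gamma>_enc tree_path_def app)
qed

lemma pi1_hom_V:
  assumes P: "is_path K x P y" and x: "x \<in> S"
  shows "LB.pi1_hom (V P) = label_val P"
proof -
  have y: "y \<in> S"
    using KS.path_in_S[OF P x] .
  have py: "is_path K y (K.path_inv (\<gamma> y)) (enc [] [])"
    using KS.\<gamma>_path[OF y] by (rule K.is_path_inv)
  have Py: "is_path K x (P @ K.path_inv (\<gamma> y)) (enc [] [])"
    using P py K.is_path_append by blast
  have "LB.pi1_hom (V P) = label_val (\<gamma> x @ P @ K.path_inv (\<gamma> y))"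
    using KS.path_val_edge_class[OF P x] by (simp add: LB.pi1_hom_cls KS.root)
  also have "\<dots> = label_val P"
    using LB.val_append[OF KS.\<gamma>_path[OF x] Py KS.root] LB.val_append[OF P py x]
      LB.val_inv[OF KS.\<gamma>_path[OF y] KS.root] LB.val_carrier[OF P x] label_val_tree[OF x] label_val_tree[OF y] by simp
  finally show ?thesis .
qed

section \<open>The isomorphism\<close>

text \<open>The homomorphism \<open>\<Phi>\<close> from the universal property and the homomorphism \<open>\<Psi>\<close> given by the labels are
inverse to each other. One direction holds edge by edge, because \<open>\<Phi>\<close> maps the label of an edge to its class;
the other is checked on generators.\<close>
theorem O_group_iso: "OGH \<cong> DG"
proof -
  let ?K1 = "squier_complex \<Sigma>1 R1" and ?K2 = "squier_complex \<Sigma>2 R2"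
  obtain \<phi>' where \<phi>': "\<phi>' \<in> hom (pi1 ?K1 w1) DG" "\<And>P. is_path ?K1 w1 P w1 \<Longrightarrow> \<phi>' (K1.cls w1 P) = G_val 0 P"
    using G_hom_exists by blast
  obtain \<psi>' where \<psi>': "\<psi>' \<in> hom (pi1 ?K2 w2) DG" "\<And>P. is_path ?K2 w2 P w2 \<Longrightarrow> \<psi>' (K2.cls w2 P) = H_val 0 P"
    using H_hom_exists by blast
  define \<phi> where "\<phi> = \<phi>' \<circ> \<theta>1"
  define \<psi> where "\<psi> = \<psi>' \<circ> \<theta>2"
  have \<theta>1h: "\<theta>1 \<in> hom G (pi1 ?K1 w1)" and \<theta>2h: "\<theta>2 \<in> hom H (pi1 ?K2 w2)"
    using \<theta>1 \<theta>2 by (auto simp: iso_def)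
  have \<phi>: "\<phi> \<in> hom G DG" and \<psi>: "\<psi> \<in> hom H DG"
    unfolding \<phi>_def \<psi>_def using hom_compose[OF \<theta>1h \<phi>'(1)] hom_compose[OF \<theta>2h \<psi>'(1)] by simp_all
  have \<phi>_loop: "\<exists>P. is_path ?K1 w1 P w1 \<and> \<theta>1 g = K1.cls w1 P \<and> \<phi> g = G_val 0 P" if "g \<in> carrier G" for g
    using hom_in_carrier[OF \<theta>1h that] \<phi>'(2) by (auto simp: K1.carrier_pi1 \<phi>_def)
  have \<psi>_loop: "\<exists>P. is_path ?K2 w2 P w2 \<and> \<theta>2 h = K2.cls w2 P \<and> \<psi> h = H_val 0 P" if "h \<in> carrier H" for h
    using hom_in_carrier[OF \<theta>2h that] \<psi>'(2) by (auto simp: K2.carrier_pi1 \<psi>_def)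
  have "\<exists>\<Phi>\<in>hom OGH DG. (\<forall>i. \<forall>g\<in>carrier G. \<Phi> (gen_G i g) = shift DG T i (\<phi> g)) \<and>
    (\<forall>i. \<forall>h\<in>carrier H. \<Phi> (gen_H i h) = shift DG T i (\<psi> h)) \<and> \<Phi> gen_t = T"
  proof (rule O_hom_exists[OF group_DG \<phi> \<psi> T_carrier])
    fix k :: int and x y assume k: "k > 0" and xy: "x \<in> carrier G" "y \<in> carrier G"
    obtain P Q where P: "is_path ?K1 w1 P w1" "\<phi> x = G_val 0 P" and Q: "is_path ?K1 w1 Q w1" "\<phi> y = G_val 0 Q"
      using \<phi>_loop xy by metis
    obtain d where d: "k = int (Suc d)"
      using k by (metis gr0_conv_Suc zero_less_imp_eq_int)
    \<comment> \<open>The blocks lie at non-positive indices, so the relation is shifted from \<open>(0, k)\<close> to \<open>(-k, 0)\<close>.\<close>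
    have "\<phi> y \<otimes>\<^bsub>DG\<^esub> shift DG T (0 - k) (\<phi> x) = shift DG T (0 - k) (\<phi> x) \<otimes>\<^bsub>DG\<^esub> \<phi> y"
      using G_G_commute[OF P(1) Q(1), of d] G_val_shift[OF P(1), of "Suc d"] P Q d by simp
    then have "shift DG T k (\<phi> y) \<otimes>\<^bsub>DG\<^esub> shift DG T 0 (\<phi> x) = shift DG T 0 (\<phi> x) \<otimes>\<^bsub>DG\<^esub> shift DG T k (\<phi> y)"
      using xy by (intro KS.L.shift_commute T_carrier hom_in_carrier[OF \<phi>])
    then show "\<phi> x \<otimes>\<^bsub>DG\<^esub> shift DG T k (\<phi> y) = shift DG T k (\<phi> y) \<otimes>\<^bsub>DG\<^esub> \<phi> x"
      using xy by (simp add: KS.L.shift_0 hom_in_carrier[OF \<phi>])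
  next
    fix k :: int and x y assume k: "k > 0" and xy: "x \<in> carrier H" "y \<in> carrier H"
    obtain P Q where P: "is_path ?K2 w2 P w2" "\<psi> x = H_val 0 P" and Q: "is_path ?K2 w2 Q w2" "\<psi> y = H_val 0 Q"
      using \<psi>_loop xy by metis
    obtain d where d: "k = int (Suc d)"
      using k by (metis gr0_conv_Suc zero_less_imp_eq_int)
    show "\<psi> x \<otimes>\<^bsub>DG\<^esub> shift DG T k (\<psi> y) = shift DG T k (\<psi> y) \<otimes>\<^bsub>DG\<^esub> \<psi> x"
      using H_H_commute[OF P(1) Q(1), of d] H_val_shift[OF Q(1), of "Suc d"] P Q d by simp
  next
    fix k :: int and x y assume k: "k \<ge> 0" and xy: "x \<in> carrier G" "y \<in> carrier H"
    obtain P Q where P: "is_path ?K1 w1 P w1" "\<phi> x = G_val 0 P" and Q: "is_path ?K2 w2 Q w2" "\<psi> y = H_val 0 Q"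
      using \<phi>_loop \<psi>_loop xy by metis
    obtain d where d: "k = int d"
      using k zero_le_imp_eq_int by blast
    show "\<phi> x \<otimes>\<^bsub>DG\<^esub> shift DG T k (\<psi> y) = shift DG T k (\<psi> y) \<otimes>\<^bsub>DG\<^esub> \<phi> x"
      using G_H_commute[OF P(1) Q(1), of d] H_val_shift[OF Q(1), of d] P Q d by simp
  qed
  then obtain \<Phi> where \<Phi>: "\<Phi> \<in> hom OGH DG"
    and \<Phi>G: "\<And>i g. g \<in> carrier G \<Longrightarrow> \<Phi> (gen_G i g) = shift DG T i (\<phi> g)"
    and \<Phi>H: "\<And>i h. h \<in> carrier H \<Longrightarrow> \<Phi> (gen_H i h) = shift DG T i (\<psi> h)"
    and \<Phi>t: "\<Phi> gen_t = T"
    by blast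
  interpret \<Phi>: group_hom OGH DG \<Phi>
    using \<Phi> by unfold_locales
  let ?\<Psi> = "LB.pi1_hom"
  have \<Psi>: "?\<Psi> \<in> hom DG OGH"
    by (rule LB.pi1_hom_hom[OF KS.root])
  interpret \<Psi>: group_hom DG OGH ?\<Psi>
    using \<Psi> by unfold_locales

  \<comment> \<open>The class of an edge in a block has been computed as \<open>G_val\<close> or \<open>H_val\<close> at its distance from \<open>c\<close>.\<close>
  have \<Phi>_label: "\<Phi> (label e) = V [e]" if e: "e \<in> edges K" "src K e \<in> S" for e
  proof -
    obtain p u v q where puvq: "e = (p, u, v, q)"
      by (cases e)
    obtain us vs where eq: "p @ u @ q = enc us vs" and us: "us \<in> lists S1" and vs: "vs \<in> lists S2"
      using e(2) puvq by (auto simp: S_def)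
    have uv: "rule u v"
      using e(1) puvq by (simp add: rule_def)
    have flip: "V [e] = inv\<^bsub>DG\<^esub> V [(p, v, u, q)]"
      using KS.f_opp_inv[OF e] KS.f_carrier[OF e] puvq by simp
    from eq uv us vs show ?thesis
    proof (cases rule: edge_cases)
      case a
      then show ?thesis
        using V_a[OF us vs] puvq \<Phi>.hom_one by (simp del: path_val_simps)
    next
      case (a' us')
      then have "us' \<in> lists S1"
        using us by auto
      with a' show ?thesis
        unfolding flip using V_a[OF _ vs, of us'] puvq \<Phi>.hom_one by (simp del: path_val_simps)
    next
      case (c us')
      then have "us' \<in> lists S1"
        using us by auto
      with c show ?thesis
        using V_c[OF _ vs, of us'] puvq \<Phi>t by (simp del: path_val_simps)
    next
      case (c' vs')
      then have "vs' \<in> lists S2"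
        using vs by auto
      with c' show ?thesis
        unfolding flip using V_c[OF us, of vs'] puvq \<Phi>t by (simp del: path_val_simps)
    next
      case b
      then show ?thesis
        using V_b[OF us vs] puvq \<Phi>.hom_one by (simp del: path_val_simps)
    next
      case (b' vs')
      then have "vs' \<in> lists S2"
        using vs by auto
      with b' show ?thesis
        unfolding flip using V_b[OF us, of vs'] puvq \<Phi>.hom_one by (simp del: path_val_simps)
    next
      case (G us1 x y us2)
      then have xuy: "x @ u @ y \<in> S1" and us12: "us1 \<in> lists S1" "us2 \<in> lists S1"
        using us by auto
      note xy = S1_step[OF xuy G(1)]
      let ?e = "(x, u, v, y)"
      let ?P = "\<gamma>1 (x @ u @ y) @ [?e] @ K1.path_inv (\<gamma>1 (x @ v @ y))"
      have P: "is_path ?K1 w1 ?P w1"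
        using K1.loop_at_root[of "x @ u @ y" "[?e]" "x @ v @ y"] xy xuy K1.tgt_verts[OF xy(4)] by simp
      have e1: "is_path ?K1 (x @ u @ y) [?e] (x @ v @ y)"
        using xy K1.tgt_verts[OF xy(4)] by simp
      have "\<theta>1 (G_label ?e) = K1.cls w1 ?P"
        using \<theta>1_\<kappa>1[OF K1.cls_in_carrier[OF P]] by (simp add: G_label_def K1.edge_class_def)
      then have "\<phi> (G_label ?e) = G_val 0 ?P"
        using \<phi>'(2)[OF P] by (simp add: \<phi>_def)
      then have "\<Phi> (label e) = shift DG T (- int (length us2)) (G_val 0 ?P)"
        using G puvq label_G[OF G(1) xy(2,3) us12(2), of "a # blk us1"] \<Phi>G[OF G_label_carrier[OF xuy G(1)]] by simp
      also have "\<dots> = G_val (length us2) ?P"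
        by (rule G_val_shift[OF P, symmetric])
      also have "\<dots> = G_val (length us2) [?e]"
        using G_val_edge[OF xy(4)] xuy by simp
      also have "\<dots> = V [e]"
        using V_G[OF e1 xuy us12 vs] G puvq by (simp del: path_val_simps)
      finally show ?thesis .
    next
      case (H vs1 x y vs2)
      then have xuy: "x @ u @ y \<in> S2" and vs12: "vs1 \<in> lists S2" "vs2 \<in> lists S2"
        using vs by auto
      note xy = S2_step[OF xuy H(1)]
      let ?e = "(x, u, v, y)"
      let ?P = "\<gamma>2 (x @ u @ y) @ [?e] @ K2.path_inv (\<gamma>2 (x @ v @ y))"
      have P: "is_path ?K2 w2 ?P w2"
        using K2.loop_at_root[of "x @ u @ y" "[?e]" "x @ v @ y"] xy xuy K2.tgt_verts[OF xy(4)] by simp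
      have e1: "is_path ?K2 (x @ u @ y) [?e] (x @ v @ y)"
        using xy K2.tgt_verts[OF xy(4)] by simp
      have "\<theta>2 (H_label ?e) = K2.cls w2 ?P"
        using \<theta>2_\<kappa>2[OF K2.cls_in_carrier[OF P]] by (simp add: H_label_def K2.edge_class_def)
      then have "\<psi> (H_label ?e) = H_val 0 ?P"
        using \<psi>'(2)[OF P] by (simp add: \<psi>_def)
      then have "\<Phi> (label e) = shift DG T (int (length vs1)) (H_val 0 ?P)"
        using H puvq label_H[OF H(1) xy(2,3) vs12(1), of "a # blk us"] \<Phi>H[OF H_label_carrier[OF xuy H(1)]] by simp
      also have "\<dots> = H_val (length vs1) ?P"
        by (rule H_val_shift[OF P, symmetric])
      also have "\<dots> = H_val (length vs1) [?e]"
        using H_val_edge[OF xy(4)] xuy by simp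
      also have "\<dots> = V [e]"
        using V_H[OF e1 xuy us vs12] H puvq by (simp del: path_val_simps)
      finally show ?thesis .
    qed
  qed
  have \<Phi>_label_val: "\<Phi> (label_val P) = V P" if "is_path K x P y" "x \<in> S" for x P y
    using that
  proof (induction P arbitrary: x)
    case Nil
    then show ?case
      using \<Phi>.hom_one by simp
  next
    case (Cons e P)
    then have e: "e \<in> edges K" "src K e \<in> S" and P: "is_path K (tgt K e) P y" "tgt K e \<in> S"
      using KS.S_closed by auto
    then show ?case
      using Cons.IH[OF P] \<Phi>_label[OF e] LB.f_carrier[OF e] LB.val_carrier[OF P] KS.f_carrier[OF e] by simp
  qed
  have \<Phi>\<Psi>: "\<Phi> (?\<Psi> A) = A" if "A \<in> carrier DG" for A
  proof -
    obtain P where P: "is_path K (enc [] []) P (enc [] [])" "A = K.cls (enc [] []) P"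
      using \<open>A \<in> carrier DG\<close> by (auto simp: K.carrier_pi1)
    then show ?thesis
      using LB.pi1_hom_cls[OF KS.root] \<Phi>_label_val[OF P(1) KS.root] KS.val_loop[OF P(1)] by simp
  qed
  have \<Psi>T: "?\<Psi> T = gen_t"
  proof -
    have "is_path K (enc [w1] []) [([a], bo # w1 @ [bc, c], c # bo # w2 @ [bc], [b])] (enc [] [w2])"
      by (intro is_path_edge) (auto simp: enc_def)
    from pi1_hom_V[OF this] show ?thesis
      using K1.root by (simp add: T_def enc_in_S)
  qed
  have \<Psi>\<phi>: "?\<Psi> (\<phi> g) = gen_G 0 g" if g: "g \<in> carrier G" for g
  proof -
    obtain P where P: "is_path ?K1 w1 P w1" "\<theta>1 g = K1.cls w1 P" "\<phi> g = G_val 0 P"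
      using \<phi>_loop[OF g] by blast
    have "?\<Psi> (G_val 0 P) = label_val (lifts [a, bo] [bc, c, b] P)"
      using pi1_hom_V[OF G_val_path[OF P(1), of 0]] K1.root by (simp add: G_val_def enc_in_S)
    also have "\<dots> = gen_G 0 (\<kappa>1 (\<theta>1 g))"
      using label_val_G[OF P(1) K1.root, of "[]" "[a]" "[b]"] G_label_loop[OF P(1)] P(2) by simp
    finally show ?thesis
      using P \<kappa>1_\<theta>1[OF g] by simp
  qed
  have \<Psi>\<psi>: "?\<Psi> (\<psi> h) = gen_H 0 h" if h: "h \<in> carrier H" for h
  proof -
    obtain P where P: "is_path ?K2 w2 P w2" "\<theta>2 h = K2.cls w2 P" "\<psi> h = H_val 0 P"
      using \<psi>_loop[OF h] by blast
    have "?\<Psi> (H_val 0 P) = label_val (lifts [a, c, bo] [bc, b] P)"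
      using pi1_hom_V[OF H_val_path[OF P(1), of 0]] K2.root by (simp add: H_val_def enc_in_S)
    also have "\<dots> = gen_H 0 (\<kappa>2 (\<theta>2 h))"
      using label_val_H[OF P(1) K2.root, of "[]" "[a]" "[b]"] H_label_loop[OF P(1)] P(2) by simp
    finally show ?thesis
      using P \<kappa>2_\<theta>2[OF h] by simp
  qed
  have \<Psi>shift: "?\<Psi> (shift DG T i x) = shift OGH gen_t i (?\<Psi> x)" if "x \<in> carrier DG" for i x
    using that \<Psi>.hom_int_pow[OF T_carrier] by (simp add: shift_def \<Psi>T)
  have \<Psi>\<Phi>: "?\<Psi> (\<Phi> x) = x" if x: "x \<in> carrier OGH" for x
  proof -
    have "(?\<Psi> \<circ> \<Phi>) x = id x"
    proof (rule O_hom_unique[OF group_OGH _ _ _ _ _ x])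
      show "?\<Psi> \<circ> \<Phi> \<in> hom OGH OGH"
        using hom_compose[OF \<Phi> \<Psi>] .
      show "id \<in> hom OGH OGH"
        by (simp add: hom_def)
    next
      fix i g assume g: "g \<in> carrier G"
      then show "(?\<Psi> \<circ> \<Phi>) (gen_G i g) = id (gen_G i g)"
        using gen_G_eq_shift[OF g, of i, symmetric] by (simp add: \<Phi>G \<Psi>shift \<Psi>\<phi> hom_in_carrier[OF \<phi>])
    next
      fix i h assume h: "h \<in> carrier H"
      then show "(?\<Psi> \<circ> \<Phi>) (gen_H i h) = id (gen_H i h)"
        using gen_H_eq_shift[OF h, of i, symmetric] by (simp add: \<Phi>H \<Psi>shift \<Psi>\<psi> hom_in_carrier[OF \<psi>])
    qed (simp add: \<Phi>t \<Psi>T)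
    then show ?thesis by simp
  qed
  have "bij_betw \<Phi> (carrier OGH) (carrier DG)"
    by (rule bij_betw_byWitness[where f' = "?\<Psi>"]) (auto simp: \<Phi>\<Psi> \<Psi>\<Phi>)
  with \<Phi> have "\<Phi> \<in> iso OGH DG"
    by (simp add: iso_def)
  then show ?thesis
    by (auto simp: is_iso_def)
qed

end

theorem theorem13:
  fixes G :: "('a, 'm) monoid_scheme" and H :: "('b, 'n) monoid_scheme"
  assumes "is_diagram_group TYPE('s) G"
    and "is_diagram_group TYPE('t) H"
  shows "is_diagram_group TYPE('s + 't + nat) (O_group G H)"
proof -
  from assms(1) obtain \<Sigma>1 :: "'s set" and R1 w1 where G: "group G" "semigroup_presentation \<Sigma>1 R1"
      "w1 \<in> lists \<Sigma>1" "w1 \<noteq> []" "G \<cong> diagram_group \<Sigma>1 R1 w1"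
    by (auto simp: is_diagram_group_def)
  from assms(2) obtain \<Sigma>2 :: "'t set" and R2 w2 where H: "group H" "semigroup_presentation \<Sigma>2 R2"
      "w2 \<in> lists \<Sigma>2" "w2 \<noteq> []" "H \<cong> diagram_group \<Sigma>2 R2 w2"
    by (auto simp: is_diagram_group_def)
  let ?f = "Inl :: 's \<Rightarrow> 's + 't + nat" and ?g = "(\<lambda>x. Inr (Inl x)) :: 't \<Rightarrow> 's + 't + nat"
  let ?m = "\<lambda>n. Inr (Inr n) :: 's + 't + nat"
  let ?\<Sigma>1 = "?f ` \<Sigma>1" and ?R1 = "map_prod (map ?f) (map ?f) ` R1" and ?w1 = "map ?f w1"
  let ?\<Sigma>2 = "?g ` \<Sigma>2" and ?R2 = "map_prod (map ?g) (map ?g) ` R2" and ?w2 = "map ?g w2"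
  have inj: "inj ?f" "inj ?g"
    by (simp_all add: inj_def)
  interpret P: O_presentation "?m 3" "?m 4" ?\<Sigma>1 ?\<Sigma>2 ?R1 ?R2 ?w1 ?w2 "?m 0" "?m 1" "?m 2"
  proof
    show "semigroup_presentation ?\<Sigma>1 ?R1" "semigroup_presentation ?\<Sigma>2 ?R2"
      using G H inj by (simp_all add: semigroup_presentation_rename)
  qed (use G H in auto)
  let ?K1 = "squier_complex ?\<Sigma>1 ?R1" and ?K2 = "squier_complex ?\<Sigma>2 ?R2"
  interpret K1: serre_complex ?K1
    by (rule serre_squier_complex[OF P.pres1])
  interpret K2: serre_complex ?K2
    by (rule serre_squier_complex[OF P.pres2])
  obtain S1 \<gamma>1 where "rooted_complex ?K1 S1 ?w1 \<gamma>1"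
    using K1.rooted_by_reachability[of ?w1] P.w1 by auto
  moreover obtain S2 \<gamma>2 where "rooted_complex ?K2 S2 ?w2 \<gamma>2"
    using K2.rooted_by_reachability[of ?w2] P.w2 by auto
  moreover obtain \<theta>1 where "\<theta>1 \<in> iso G (pi1 ?K1 ?w1)"
    using iso_trans[OF G(5) diagram_group_rename[OF G(2) inj(1) G(3,4)]]
    by (auto simp: diagram_group_def is_iso_def)
  moreover obtain \<theta>2 where "\<theta>2 \<in> iso H (pi1 ?K2 ?w2)"
    using iso_trans[OF H(5) diagram_group_rename[OF H(2) inj(2) H(3,4)]]
    by (auto simp: diagram_group_def is_iso_def)
  ultimately interpret O_iso "?m 3" "?m 4" ?\<Sigma>1 ?\<Sigma>2 ?R1 ?R2 ?w1 ?w2 "?m 0" "?m 1" "?m 2" S1 S2 \<gamma>1 \<gamma>2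
      G H \<theta>1 \<theta>2
    using G(1) H(1) P.O_presentation_axioms
    by (simp add: O_iso_def O_complex_def O_pair_def O_iso_axioms_def)
  show ?thesis
    unfolding is_diagram_group_def
  proof (intro conjI exI)
    show "group (O_group G H)"
      by (rule group_OGH)
    show "semigroup_presentation P.\<Sigma> P.R"
      by (rule P.presentation)
    show "P.enc [] [] \<in> lists P.\<Sigma>" "P.enc [] [] \<noteq> []"
      by (rule P.base_word)+
    show "O_group G H \<cong> diagram_group P.\<Sigma> P.R (P.enc [] [])"
      using O_group_iso by (simp add: diagram_group_def)
  qed
qed

end
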